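(* Let $p$ be a prime and $h\ge1$, $n\ge 1$ integers. Let $l$ be the nonnegative integer with $p^l\le n<p^{l+1}$, and assume $h\le l$. Let $H$ be a formal group law over $\mathbb F_p$ with $[p]_H(T)=T^{p^h}$, and $H^{(n)}$ its $n$-truncation. There are natural identifications of presheaves on the category of $\mathbb F_p$-schemes $$\mathcal A_i^{H^{(n)}}/\mathcal A_{i+1}^{H^{(n)}}\cong\begin{cases}\mu_{p^h-1}, & i=0;\\ \mathbb G_a^{\mathrm{Fr}_{p^h}}, & i=p-1,\ p^2-1,\ \dots,\ p^{l-h}-1;\\ \mathbb G_a, & i=p^{l-h+1}-1,\ p^{l-h+2}-1,\ \dots,\ p^l-1;\\ 0,&\text{otherwise}\end{cases}\qquad(0\le i\le n-1),$$ and $$\mathcal A_i^{H}/\mathcal A_{i+1}^{H}\cong\begin{cases}\mu_{p^h-1}, & i=0;\\ \mathbb G_a^{\mathrm{Fr}_{p^h}}, & i=p-1,\ p^2-1,\ p^3-1,\ \dots;\\ 0,&\text{otherwise}\end{cases}\qquad(i\ge 0).$$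
   Context: Formal group laws are commutative and 1-parameter; $[1]_F(T)=T$, $[m+1]_F(T)=F([m]_F(T),T)$. A formal group law $H$ over $\mathbb F_p$ with $[p]_H(T)=T^{p^h}$ exists and is fixed. $H^{(n)}\in\mathbb F_p[T_1,T_2]/(T_1,T_2)^{n+1}$ is the $n$-bud law obtained by discarding terms of degree $\ge n+1$. For a scheme $S$ over $\mathbb F_p$ write $\Gamma(S)=\Gamma(S,\mathcal O_S)$. $\operatorname{Aut}_{\Gamma(S)}(H)$ is the group under composition of invertible power series $f\in\Gamma(S)[[T]]$ with zero constant term and $f(H(T_1,T_2))=H(f(T_1),f(T_2))$; $\operatorname{Aut}_{\Gamma(S)}(H^{(n)})$ is defined in the same way with $f\in\Gamma(S)[T]/(T)^{n+1}$ and the identity required modulo $(T_1,T_2)^{n+1}$. Filtrations (by normal subgroup presheaves on $\mathbb F_p$-schemes). $\mathcal A^{H^{(n)}}_0(S)=\operatorname{Aut}_{\Gamma(S)}(H^{(n)})$; for $1\le i\le n$, $\mathcal A^{H^{(n)}}_i(S)$ is the subgroup of those $f$ of the form $T+a_{i+1}T^{i+1}+\dots+a_nT^n$ (so $\mathcal A^{H^{(n)}}_n=1$). $\mathcal A^H_0(S)=\operatorname{Aut}_{\Gamma(S)}(H)$; for $i\ge1$, $\mathcal A^H_i(S)$ is the subgroup of those $f$ of the form $T+a_{i+1}T^{i+1}+(\text{higher order terms})$. Quotients are taken in presheaves of groups. The natural maps are those sending the class of $f$ to the coefficient $a_{i+1}$ of $T^{i+1}$ in $f$, giving monomorphisms into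 $\mathbb G_m$ for $i=0$ and into $\mathbb G_a$ for $i\ge1$ (group schemes over $\mathbb F_p$); the identifications are with the indicated subgroups. Here $\mu_{p^h-1}(S)=\{a\in\Gamma(S)^\times: a^{p^h-1}=1\}$ and $\mathbb G_a^{\mathrm{Fr}_{p^h}}(S)=\{a\in\Gamma(S): a^{p^h}=a\}$. *)

theory Defs
  imports
    "HOL-Analysis.Abstract_Topology"
    "HOL-Library.Numeral_Type"
    "HOL-Algebra.QuotRing"
    "HOL-Number_Theory.Residues"
begin

section \<open>Schemes\<close>

text \<open>A space with a presheaf of rings. All sections, over all open sets, live in one type;
  only the values at open sets matter. \<^term>\<open>rst X U V\<close> restricts sections from \<^term>\<open>U\<close> to
  \<^term>\<open>V\<close>.\<close>

record ('a, 'b) rspace =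
  rtop :: "'a topology"
  sec :: "'a set \<Rightarrow> 'b ring"
  rst :: "'a set \<Rightarrow> 'a set \<Rightarrow> 'b \<Rightarrow> 'b"

definition ringed_space :: "('a, 'b) rspace \<Rightarrow> bool" where
  "ringed_space X \<longleftrightarrow>
    (\<forall>U. openin (rtop X) U \<longrightarrow> cring (sec X U)) \<and>
    (\<forall>U V. openin (rtop X) U \<and> openin (rtop X) V \<and> V \<subseteq> U \<longrightarrow>
      rst X U V \<in> ring_hom (sec X U) (sec X V)) \<and>
    (\<forall>U s. openin (rtop X) U \<and> s \<in> carrier (sec X U) \<longrightarrow> rst X U U s = s) \<and>
    (\<forall>U V W s. openin (rtop X) U \<and> openin (rtop X) V \<and> openin (rtop X) W \<and>
      W \<subseteq> V \<and> V \<subseteq> U \<and> s \<in> carrier (sec X U) \<longrightarrow> rst X V W (rst X U V s) = rst X U W s) \<and>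
    (\<forall>\<U> s t. (\<forall>V\<in>\<U>. openin (rtop X) V) \<and> s \<in> carrier (sec X (\<Union>\<U>)) \<and> t \<in> carrier (sec X (\<Union>\<U>)) \<and>
      (\<forall>V\<in>\<U>. rst X (\<Union>\<U>) V s = rst X (\<Union>\<U>) V t) \<longrightarrow> s = t) \<and>
    (\<forall>\<U> \<sigma>. (\<forall>V\<in>\<U>. openin (rtop X) V \<and> \<sigma> V \<in> carrier (sec X V)) \<and>
      (\<forall>V\<in>\<U>. \<forall>W\<in>\<U>. rst X V (V \<inter> W) (\<sigma> V) = rst X W (V \<inter> W) (\<sigma> W)) \<longrightarrow>
      (\<exists>s\<in>carrier (sec X (\<Union>\<U>)). \<forall>V\<in>\<U>. rst X (\<Union>\<U>) V s = \<sigma> V))"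

definition germ :: "('a, 'b) rspace \<Rightarrow> 'a \<Rightarrow> 'a set \<Rightarrow> 'b \<Rightarrow> ('a set \<times> 'b) set" where
  "germ X x U s = {(V, t). openin (rtop X) V \<and> x \<in> V \<and> t \<in> carrier (sec X V) \<and>
     (\<exists>W. openin (rtop X) W \<and> x \<in> W \<and> W \<subseteq> U \<inter> V \<and> rst X U W s = rst X V W t)}"

definition stalk :: "('a, 'b) rspace \<Rightarrow> 'a \<Rightarrow> ('a set \<times> 'b) set ring" where
  "stalk X x =
    \<lparr>carrier = {germ X x U s |U s. openin (rtop X) U \<and> x \<in> U \<and> s \<in> carrier (sec X U)},
     monoid.mult = (\<lambda>A B. \<Union>(U, s)\<in>A. \<Union>(V, t)\<in>B.
       germ X x (U \<inter> V) (rst X U (U \<inter> V) s \<otimes>\<^bsub>sec X (U \<inter> V)\<^esub> rst X V (U \<inter> V) t)),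
     one = germ X x (topspace (rtop X)) \<one>\<^bsub>sec X (topspace (rtop X))\<^esub>,
     zero = germ X x (topspace (rtop X)) \<zero>\<^bsub>sec X (topspace (rtop X))\<^esub>,
     add = (\<lambda>A B. \<Union>(U, s)\<in>A. \<Union>(V, t)\<in>B.
       germ X x (U \<inter> V) (rst X U (U \<inter> V) s \<oplus>\<^bsub>sec X (U \<inter> V)\<^esub> rst X V (U \<inter> V) t))\<rparr>"

definition local_ring :: "('a, 'm) ring_scheme \<Rightarrow> bool" where
  "local_ring R \<longleftrightarrow> cring R \<and> (\<exists>!M. maximalideal M R)"

definition locally_ringed_space :: "('a, 'b) rspace \<Rightarrow> bool" where
  "locally_ringed_space X \<longleftrightarrow> ringed_space X \<and> (\<forall>x\<in>topspace (rtop X). local_ring (stalk X x))"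

text \<open>For \<^term>\<open>f\<close> from \<^term>\<open>X\<close> to \<^term>\<open>Y\<close> and \<^term>\<open>V\<close> open in \<^term>\<open>Y\<close>,
  \<^term>\<open>pull f V\<close> maps sections of \<^term>\<open>Y\<close> over \<^term>\<open>V\<close> to sections of \<^term>\<open>X\<close> over the
  preimage of \<^term>\<open>V\<close>.\<close>

record ('a, 'b, 'c, 'd) rmor =
  base :: "'a \<Rightarrow> 'c"
  pull :: "'c set \<Rightarrow> 'd \<Rightarrow> 'b"

definition preim :: "('a, 'b) rspace \<Rightarrow> ('a, 'b, 'c, 'd) rmor \<Rightarrow> 'c set \<Rightarrow> 'a set" where
  "preim X f V = {x \<in> topspace (rtop X). base f x \<in> V}"

definition stalk_map ::
  "('a, 'b) rspace \<Rightarrow> ('a, 'b, 'c, 'd) rmor \<Rightarrow> 'a \<Rightarrow> ('c set \<times> 'd) set \<Rightarrow> ('a set \<times> 'b) set" where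
  "stalk_map X f x A = (\<Union>(V, s)\<in>A. germ X x (preim X f V) (pull f V s))"

definition lrs_mor :: "('a, 'b) rspace \<Rightarrow> ('c, 'd) rspace \<Rightarrow> ('a, 'b, 'c, 'd) rmor \<Rightarrow> bool" where
  "lrs_mor X Y f \<longleftrightarrow>
    continuous_map (rtop X) (rtop Y) (base f) \<and>
    (\<forall>V. openin (rtop Y) V \<longrightarrow> pull f V \<in> ring_hom (sec Y V) (sec X (preim X f V))) \<and>
    (\<forall>V W s. openin (rtop Y) V \<and> openin (rtop Y) W \<and> W \<subseteq> V \<and> s \<in> carrier (sec Y V) \<longrightarrow>
      pull f W (rst Y V W s) = rst X (preim X f V) (preim X f W) (pull f V s)) \<and>
    (\<forall>x\<in>topspace (rtop X). \<forall>A\<in>carrier (stalk Y (base f x)).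
      stalk_map X f x A \<in> Units (stalk X x) \<longrightarrow> A \<in> Units (stalk Y (base f x)))"

text \<open>Equality of morphisms ignores the values of the representing functions outside their
  domains.\<close>

definition rmor_eq ::
  "('a, 'b) rspace \<Rightarrow> ('c, 'd) rspace \<Rightarrow> ('a, 'b, 'c, 'd) rmor \<Rightarrow> ('a, 'b, 'c, 'd) rmor \<Rightarrow> bool" where
  "rmor_eq X Y f g \<longleftrightarrow> (\<forall>x\<in>topspace (rtop X). base f x = base g x) \<and>
    (\<forall>V s. openin (rtop Y) V \<and> s \<in> carrier (sec Y V) \<longrightarrow> pull f V s = pull g V s)"

definition rmor_id :: "('a, 'b, 'a, 'b) rmor" where
  "rmor_id = \<lparr>base = (\<lambda>x. x), pull = (\<lambda>_ s. s)\<rparr>"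

text \<open>The composite of \<^term>\<open>f\<close> from \<^term>\<open>X\<close> to \<^term>\<open>Y\<close> with \<^term>\<open>g\<close> defined on
  \<^term>\<open>Y\<close>.\<close>

definition rmor_comp ::
  "('c, 'd) rspace \<Rightarrow> ('c, 'd, 'e, 'f) rmor \<Rightarrow> ('a, 'b, 'c, 'd) rmor \<Rightarrow> ('a, 'b, 'e, 'f) rmor" where
  "rmor_comp Y g f = \<lparr>base = (\<lambda>x. base g (base f x)), pull = (\<lambda>V s. pull f (preim Y g V) (pull g V s))\<rparr>"

definition lrs_isomorphic :: "('a, 'b) rspace \<Rightarrow> ('c, 'd) rspace \<Rightarrow> bool" where
  "lrs_isomorphic X Y \<longleftrightarrow> (\<exists>f g. lrs_mor X Y f \<and> lrs_mor Y X g \<and>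
     rmor_eq X X (rmor_comp Y g f) rmor_id \<and> rmor_eq Y Y (rmor_comp X f g) rmor_id)"

definition open_subspace :: "('a, 'b) rspace \<Rightarrow> 'a set \<Rightarrow> ('a, 'b) rspace" where
  "open_subspace X U = \<lparr>rtop = subtopology (rtop X) U, sec = sec X, rst = rst X\<rparr>"

text \<open>\<^term>\<open>lfrac A P a s\<close> is the fraction \<^term>\<open>a\<close> over \<^term>\<open>s\<close> in the localization of
  \<^term>\<open>A\<close> at the prime ideal \<^term>\<open>P\<close>, as an equivalence class of pairs.\<close>

definition lfrac :: "'a ring \<Rightarrow> 'a set \<Rightarrow> 'a \<Rightarrow> 'a \<Rightarrow> ('a \<times> 'a) set" where
  "lfrac A P a s = {(b, t). b \<in> carrier A \<and> t \<in> carrier A - P \<and>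
     (\<exists>u\<in>carrier A - P. u \<otimes>\<^bsub>A\<^esub> (a \<otimes>\<^bsub>A\<^esub> t \<ominus>\<^bsub>A\<^esub> b \<otimes>\<^bsub>A\<^esub> s) = \<zero>\<^bsub>A\<^esub>)}"

definition localization :: "'a ring \<Rightarrow> 'a set \<Rightarrow> ('a \<times> 'a) set ring" where
  "localization A P =
    \<lparr>carrier = {lfrac A P a s |a s. a \<in> carrier A \<and> s \<in> carrier A - P},
     monoid.mult = (\<lambda>x y. \<Union>(a, s)\<in>x. \<Union>(b, t)\<in>y. lfrac A P (a \<otimes>\<^bsub>A\<^esub> b) (s \<otimes>\<^bsub>A\<^esub> t)),
     one = lfrac A P \<one>\<^bsub>A\<^esub> \<one>\<^bsub>A\<^esub>,
     zero = lfrac A P \<zero>\<^bsub>A\<^esub> \<one>\<^bsub>A\<^esub>,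
     add = (\<lambda>x y. \<Union>(a, s)\<in>x. \<Union>(b, t)\<in>y. lfrac A P (a \<otimes>\<^bsub>A\<^esub> t \<oplus>\<^bsub>A\<^esub> b \<otimes>\<^bsub>A\<^esub> s) (s \<otimes>\<^bsub>A\<^esub> t))\<rparr>"

definition spec_top :: "'a ring \<Rightarrow> 'a set topology" where
  "spec_top A = topology_generated_by {{P. primeideal P A \<and> a \<notin> P} |a. a \<in> carrier A}"

definition spec_sections :: "'a ring \<Rightarrow> 'a set set \<Rightarrow> ('a set \<Rightarrow> ('a \<times> 'a) set) set" where
  "spec_sections A U = {\<sigma> \<in> (\<Pi>\<^sub>E P\<in>U. carrier (localization A P)).
     \<forall>P\<in>U. \<exists>V a s. openin (spec_top A) V \<and> P \<in> V \<and> V \<subseteq> U \<and> a \<in> carrier A \<and> s \<in> carrier A \<and>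
       (\<forall>Q\<in>V. s \<notin> Q \<and> \<sigma> Q = lfrac A Q a s)}"

definition Spec :: "'a ring \<Rightarrow> ('a set, 'a set \<Rightarrow> ('a \<times> 'a) set) rspace" where
  "Spec A =
    \<lparr>rtop = spec_top A,
     sec = (\<lambda>U. \<lparr>carrier = spec_sections A U,
       monoid.mult = (\<lambda>\<sigma> \<tau>. \<lambda>P\<in>U. \<sigma> P \<otimes>\<^bsub>localization A P\<^esub> \<tau> P),
       one = (\<lambda>P\<in>U. \<one>\<^bsub>localization A P\<^esub>),
       zero = (\<lambda>P\<in>U. \<zero>\<^bsub>localization A P\<^esub>),
       add = (\<lambda>\<sigma> \<tau>. \<lambda>P\<in>U. \<sigma> P \<oplus>\<^bsub>localization A P\<^esub> \<tau> P)\<rparr>),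
     rst = (\<lambda>U V \<sigma>. restrict \<sigma> V)\<rparr>"

text \<open>It is no restriction that the ring \<^term>\<open>A\<close> below has the type of the sections of
  \<^term>\<open>X\<close>: if an open subspace is isomorphic to the spectrum of a ring of any type, then that
  ring is isomorphic to the ring of sections over the subspace.\<close>

definition scheme :: "('a, 'b) rspace \<Rightarrow> bool" where
  "scheme X \<longleftrightarrow> locally_ringed_space X \<and>
    (\<forall>x\<in>topspace (rtop X). \<exists>U. openin (rtop X) U \<and> x \<in> U \<and>
      (\<exists>A :: 'b ring. cring A \<and> lrs_isomorphic (open_subspace X U) (Spec A)))"


section \<open>Schemes over the prime field and presheaves of groups on them\<close>

abbreviation prime_field :: "nat \<Rightarrow> int ring" where
  "prime_field p \<equiv> residue_ring (int p)"

record ('a, 'b) fp_scheme =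
  total :: "('a, 'b) rspace"
  struct :: "('a, 'b, int set, int set \<Rightarrow> (int \<times> int) set) rmor"

definition is_fp_scheme :: "nat \<Rightarrow> ('a, 'b) fp_scheme \<Rightarrow> bool" where
  "is_fp_scheme p S \<longleftrightarrow> scheme (total S) \<and> lrs_mor (total S) (Spec (prime_field p)) (struct S)"

definition is_fp_mor ::
  "nat \<Rightarrow> ('a, 'b) fp_scheme \<Rightarrow> ('c, 'd) fp_scheme \<Rightarrow> ('a, 'b, 'c, 'd) rmor \<Rightarrow> bool" where
  "is_fp_mor p S' S g \<longleftrightarrow> lrs_mor (total S') (total S) g \<and>
    rmor_eq (total S') (Spec (prime_field p)) (rmor_comp (total S) (struct S) g) (struct S')"

definition Gam :: "('a, 'b) fp_scheme \<Rightarrow> 'b ring" where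
  "Gam S = sec (total S) (topspace (rtop (total S)))"

definition Gam_map :: "('c, 'd) fp_scheme \<Rightarrow> ('a, 'b, 'c, 'd) rmor \<Rightarrow> 'd \<Rightarrow> 'b" where
  "Gam_map S g = pull g (topspace (rtop (total S)))"

text \<open>The structure homomorphism from the prime field to the global sections of \<^term>\<open>S\<close>.\<close>

definition scalar :: "nat \<Rightarrow> ('a, 'b) fp_scheme \<Rightarrow> int \<Rightarrow> 'b" where
  "scalar p S c =
    pull (struct S) (topspace (spec_top (prime_field p)))
      (\<lambda>P\<in>topspace (spec_top (prime_field p)). lfrac (prime_field p) P c \<one>\<^bsub>prime_field p\<^esub>)"

text \<open>Presheaves on the category of those schemes over the prime field whose points and sections
  live in the types \<^typ>\<open>'a\<close> and \<^typ>\<open>'b\<close>, which play the role of a universe.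
  \<^term>\<open>res F S' S g\<close> is the homomorphism induced by \<^term>\<open>g\<close> from \<^term>\<open>S'\<close> to \<^term>\<open>S\<close>.\<close>

record ('a, 'b, 'g) presheaf =
  ob :: "('a, 'b) fp_scheme \<Rightarrow> 'g monoid"
  res :: "('a, 'b) fp_scheme \<Rightarrow> ('a, 'b) fp_scheme \<Rightarrow> ('a, 'b, 'a, 'b) rmor \<Rightarrow> 'g \<Rightarrow> 'g"

definition group_presheaf :: "nat \<Rightarrow> ('a, 'b, 'g) presheaf \<Rightarrow> bool" where
  "group_presheaf p F \<longleftrightarrow>
    (\<forall>S. is_fp_scheme p S \<longrightarrow> group (ob F S)) \<and>
    (\<forall>S' S g. is_fp_scheme p S' \<and> is_fp_scheme p S \<and> is_fp_mor p S' S g \<longrightarrow>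
      res F S' S g \<in> hom (ob F S) (ob F S')) \<and>
    (\<forall>S x. is_fp_scheme p S \<and> x \<in> carrier (ob F S) \<longrightarrow> res F S S rmor_id x = x) \<and>
    (\<forall>S'' S' S g' g x. is_fp_scheme p S'' \<and> is_fp_scheme p S' \<and> is_fp_scheme p S \<and>
      is_fp_mor p S'' S' g' \<and> is_fp_mor p S' S g \<and> x \<in> carrier (ob F S) \<longrightarrow>
      res F S'' S (rmor_comp (total S') g g') x = res F S'' S' g' (res F S' S g x))"

definition normal_subpresheaf ::
  "nat \<Rightarrow> ('a, 'b, 'g) presheaf \<Rightarrow> ('a, 'b, 'g) presheaf \<Rightarrow> bool" where
  "normal_subpresheaf p B A \<longleftrightarrow> group_presheaf p A \<and> group_presheaf p B \<and>
    (\<forall>S. is_fp_scheme p S \<longrightarrow>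
      carrier (ob B S) \<lhd> ob A S \<and> ob B S = (ob A S)\<lparr>carrier := carrier (ob B S)\<rparr>) \<and>
    (\<forall>S' S g x. is_fp_scheme p S' \<and> is_fp_scheme p S \<and> is_fp_mor p S' S g \<and>
      x \<in> carrier (ob B S) \<longrightarrow> res B S' S g x = res A S' S g x)"

definition quotient_presheaf ::
  "('a, 'b, 'g) presheaf \<Rightarrow> ('a, 'b, 'g) presheaf \<Rightarrow> ('a, 'b, 'g set) presheaf" where
  "quotient_presheaf A B =
    \<lparr>ob = (\<lambda>S. ob A S Mod carrier (ob B S)),
     res = (\<lambda>S' S g C. carrier (ob B S') <#>\<^bsub>ob A S'\<^esub> (res A S' S g ` C))\<rparr>"

definition presheaf_iso ::
  "nat \<Rightarrow> ('a, 'b, 'g) presheaf \<Rightarrow> ('a, 'b, 'k) presheaf \<Rightarrow> (('a, 'b) fp_scheme \<Rightarrow> 'g \<Rightarrow> 'k) \<Rightarrow> bool"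
  where
  "presheaf_iso p F G \<alpha> \<longleftrightarrow> group_presheaf p F \<and> group_presheaf p G \<and>
    (\<forall>S. is_fp_scheme p S \<longrightarrow> \<alpha> S \<in> iso (ob F S) (ob G S)) \<and>
    (\<forall>S' S g x. is_fp_scheme p S' \<and> is_fp_scheme p S \<and> is_fp_mor p S' S g \<and>
      x \<in> carrier (ob F S) \<longrightarrow> \<alpha> S' (res F S' S g x) = res G S' S g (\<alpha> S x))"

definition Ga :: "('a, 'b, 'b) presheaf" where
  "Ga = \<lparr>ob = (\<lambda>S. \<lparr>carrier = carrier (Gam S), monoid.mult = add (Gam S), one = \<zero>\<^bsub>Gam S\<^esub>\<rparr>),
     res = (\<lambda>S' S g. Gam_map S g)\<rparr>"

definition Gm :: "('a, 'b, 'b) presheaf" where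
  "Gm = \<lparr>ob = (\<lambda>S. units_of (Gam S)), res = (\<lambda>S' S g. Gam_map S g)\<rparr>"

definition mu :: "nat \<Rightarrow> ('a, 'b, 'b) presheaf" where
  "mu m = \<lparr>ob = (\<lambda>S. (ob Gm S)\<lparr>carrier := {a \<in> Units (Gam S). a [^]\<^bsub>Gam S\<^esub> m = \<one>\<^bsub>Gam S\<^esub>}\<rparr>),
     res = res Gm\<rparr>"

definition Ga_Fr :: "nat \<Rightarrow> ('a, 'b, 'b) presheaf" where
  "Ga_Fr q = \<lparr>ob = (\<lambda>S. (ob Ga S)\<lparr>carrier := {a \<in> carrier (Gam S). a [^]\<^bsub>Gam S\<^esub> q = a}\<rparr>),
     res = res Ga\<rparr>"

definition Ga_zero :: "('a, 'b, 'b) presheaf" where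
  "Ga_zero = \<lparr>ob = (\<lambda>S. (ob Ga S)\<lparr>carrier := {\<zero>\<^bsub>Gam S\<^esub>}\<rparr>), res = res Ga\<rparr>"


section \<open>Power series\<close>

text \<open>A power series in variables indexed by the finite type \<^typ>\<open>'v\<close> is the family of its
  coefficients, indexed by exponent vectors. We use the index types \<^typ>\<open>1\<close>, \<^typ>\<open>2\<close> and
  \<^typ>\<open>3\<close> for series in one, two and three variables.\<close>

type_synonym ('v, 'b) pser = "('v \<Rightarrow> nat) \<Rightarrow> 'b"

definition deg :: "('v::finite \<Rightarrow> nat) \<Rightarrow> nat" where
  "deg \<beta> = (\<Sum>v\<in>UNIV. \<beta> v)"

definition PS :: "('b, 'm) ring_scheme \<Rightarrow> ('v::finite, 'b) pser ring" where
  "PS R =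
    \<lparr>carrier = {f. \<forall>\<beta>. f \<beta> \<in> carrier R},
     monoid.mult = (\<lambda>f g \<beta>. \<Oplus>\<^bsub>R\<^esub>\<gamma>\<in>{\<gamma>. \<gamma> \<le> \<beta>}. f \<gamma> \<otimes>\<^bsub>R\<^esub> g (\<beta> - \<gamma>)),
     one = (\<lambda>\<beta>. if \<beta> = (\<lambda>_. 0) then \<one>\<^bsub>R\<^esub> else \<zero>\<^bsub>R\<^esub>),
     zero = (\<lambda>\<beta>. \<zero>\<^bsub>R\<^esub>),
     add = (\<lambda>f g \<beta>. f \<beta> \<oplus>\<^bsub>R\<^esub> g \<beta>)\<rparr>"

definition var :: "('b, 'm) ring_scheme \<Rightarrow> 'v::finite \<Rightarrow> ('v, 'b) pser" where
  "var R v = (\<lambda>\<beta>. if \<beta> = (\<lambda>w. if w = v then 1 else 0) then \<one>\<^bsub>R\<^esub> else \<zero>\<^bsub>R\<^esub>)"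

text \<open>Substitution of the series \<^term>\<open>g v\<close>, all with zero constant term, for the variables of
  \<^term>\<open>f\<close>. A monomial of degree greater than that of \<^term>\<open>\<alpha>\<close> does not contribute to the
  coefficient at \<^term>\<open>\<alpha>\<close>.\<close>

definition subst ::
  "('b, 'm) ring_scheme \<Rightarrow> ('v::finite, 'b) pser \<Rightarrow> ('v \<Rightarrow> ('w::finite, 'b) pser) \<Rightarrow> ('w, 'b) pser"
  where
  "subst R f g = (\<lambda>\<alpha>. \<Oplus>\<^bsub>R\<^esub>\<beta>\<in>{\<beta>. deg \<beta> \<le> deg \<alpha>}.
     f \<beta> \<otimes>\<^bsub>R\<^esub> (\<Otimes>\<^bsub>PS R\<^esub>v\<in>UNIV. g v [^]\<^bsub>PS R\<^esub> \<beta> v) \<alpha>)"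

definition trunc :: "('b, 'm) ring_scheme \<Rightarrow> nat \<Rightarrow> ('v::finite, 'b) pser \<Rightarrow> ('v, 'b) pser" where
  "trunc R n f = (\<lambda>\<beta>. if deg \<beta> \<le> n then f \<beta> else \<zero>\<^bsub>R\<^esub>)"

abbreviation coef :: "(1, 'b) pser \<Rightarrow> nat \<Rightarrow> 'b" where
  "coef f k \<equiv> f (\<lambda>_. k)"

abbreviation pair :: "'c \<Rightarrow> 'c \<Rightarrow> 2 \<Rightarrow> 'c" where
  "pair x y \<equiv> (\<lambda>v. if v = 0 then x else y)"


section \<open>Formal group laws and filtrations of their automorphism groups\<close>

definition formal_group_law :: "('b, 'm) ring_scheme \<Rightarrow> (2, 'b) pser \<Rightarrow> bool" where
  "formal_group_law R F \<longleftrightarrow> F \<in> carrier (PS R) \<and>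
    subst R F (pair (var R (0::1)) \<zero>\<^bsub>PS R\<^esub>) = var R 0 \<and>
    subst R F (pair \<zero>\<^bsub>PS R\<^esub> (var R (0::1))) = var R 0 \<and>
    subst R F (pair (var R (1::2)) (var R 0)) = F \<and>
    subst R F (pair (subst R F (pair (var R (0::3)) (var R 1))) (var R 2)) =
      subst R F (pair (var R 0) (subst R F (pair (var R 1) (var R 2))))"

fun fgl_mult :: "('b, 'm) ring_scheme \<Rightarrow> (2, 'b) pser \<Rightarrow> nat \<Rightarrow> (1, 'b) pser" where
  "fgl_mult R F 0 = \<zero>\<^bsub>PS R\<^esub>"
| "fgl_mult R F (Suc 0) = var R 0"
| "fgl_mult R F (Suc (Suc m)) = subst R F (pair (fgl_mult R F (Suc m)) (var R 0))"

definition Aut :: "('b, 'm) ring_scheme \<Rightarrow> (2, 'b) pser \<Rightarrow> (1, 'b) pser monoid" where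
  "Aut R F =
    \<lparr>carrier = {f \<in> carrier (PS R). coef f 0 = \<zero>\<^bsub>R\<^esub> \<and>
       (\<exists>g\<in>carrier (PS R). coef g 0 = \<zero>\<^bsub>R\<^esub> \<and>
         subst R f (\<lambda>_. g) = var R 0 \<and> subst R g (\<lambda>_. f) = var R 0) \<and>
       subst R f (\<lambda>_. F) = subst R F (\<lambda>v. subst R f (\<lambda>_. var R v))},
     monoid.mult = (\<lambda>f g. subst R f (\<lambda>_. g)),
     one = var R 0\<rparr>"

text \<open>Elements of the quotient of the power series ring by the series of order greater than
  \<^term>\<open>n\<close> are represented by the series without terms of degree greater than \<^term>\<open>n\<close>;
  below, the bud law \<^term>\<open>F\<close> is such a representative as well.\<close>

definition Aut_bud ::
  "('b, 'm) ring_scheme \<Rightarrow> nat \<Rightarrow> (2, 'b) pser \<Rightarrow> (1, 'b) pser monoid" where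
  "Aut_bud R n F =
    \<lparr>carrier = {f \<in> carrier (PS R). trunc R n f = f \<and> coef f 0 = \<zero>\<^bsub>R\<^esub> \<and>
       (\<exists>g\<in>carrier (PS R). trunc R n g = g \<and> coef g 0 = \<zero>\<^bsub>R\<^esub> \<and>
         trunc R n (subst R f (\<lambda>_. g)) = trunc R n (var R 0) \<and>
         trunc R n (subst R g (\<lambda>_. f)) = trunc R n (var R 0)) \<and>
       trunc R n (subst R f (\<lambda>_. F)) = trunc R n (subst R F (\<lambda>v. subst R f (\<lambda>_. var R v)))},
     monoid.mult = (\<lambda>f g. trunc R n (subst R f (\<lambda>_. g))),
     one = trunc R n (var R 0)\<rparr>"

definition filt_step :: "('b, 'm) ring_scheme \<Rightarrow> nat \<Rightarrow> (1, 'b) pser set" where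
  "filt_step R i = {f. i = 0 \<or> (coef f 1 = \<one>\<^bsub>R\<^esub> \<and> (\<forall>k. 2 \<le> k \<and> k \<le> i \<longrightarrow> coef f k = \<zero>\<^bsub>R\<^esub>))}"

definition base_change :: "nat \<Rightarrow> (2, int) pser \<Rightarrow> ('a, 'b) fp_scheme \<Rightarrow> (2, 'b) pser" where
  "base_change p F S = (\<lambda>\<beta>. scalar p S (F \<beta>))"

definition A_full :: "nat \<Rightarrow> (2, int) pser \<Rightarrow> nat \<Rightarrow> ('a, 'b, (1, 'b) pser) presheaf" where
  "A_full p H i =
    \<lparr>ob = (\<lambda>S. let G = Aut (Gam S) (base_change p H S)
       in G\<lparr>carrier := carrier G \<inter> filt_step (Gam S) i\<rparr>),
     res = (\<lambda>S' S g f \<beta>. Gam_map S g (f \<beta>))\<rparr>"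

definition A_bud :: "nat \<Rightarrow> (2, int) pser \<Rightarrow> nat \<Rightarrow> nat \<Rightarrow> ('a, 'b, (1, 'b) pser) presheaf" where
  "A_bud p H n i =
    \<lparr>ob = (\<lambda>S. let G = Aut_bud (Gam S) n (base_change p (trunc (prime_field p) n H) S)
       in G\<lparr>carrier := carrier G \<inter> filt_step (Gam S) i\<rparr>),
     res = (\<lambda>S' S g f \<beta>. Gam_map S g (f \<beta>))\<rparr>"

definition coef_identification ::
  "nat \<Rightarrow> nat \<Rightarrow> ('a, 'b, (1, 'b) pser) presheaf \<Rightarrow> ('a, 'b, (1, 'b) pser) presheaf \<Rightarrow>
    ('a, 'b, 'b) presheaf \<Rightarrow> bool" where
  "coef_identification p i A B G \<longleftrightarrow> normal_subpresheaf p B A \<and>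
    (\<exists>\<alpha>. presheaf_iso p (quotient_presheaf A B) G \<alpha> \<and>
      (\<forall>S f. is_fp_scheme p S \<and> f \<in> carrier (ob A S) \<longrightarrow>
        \<alpha> S (carrier (ob B S) #>\<^bsub>ob A S\<^esub> f) = coef f (i + 1)))"

end

theory Submission
  imports Defs "HOL-Library.Function_Algebras" "HOL-Library.Poly_Mapping" "HOL-Library.Multiset"
    "HOL-Library.Extended_Nat"
begin

text \<open>If \<open>f\<close> commutes with \<open>H\<close> in degrees below \<open>m\<close>, then the part of degree \<open>m\<close> of
  $f(H(x,y)) - H(f(x),f(y))$ is a symmetric two-cocycle. In characteristic $p$ such a cocycle is a
  multiple of $(x+y)^m - x^m - y^m$ if $m$ is not a power of $p$; it is then removed by exactly one
  choice of the coefficient of $T^m$ in $f$. If $m = p^k$, it is a multiple of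
  $((x+y)^m - x^m - y^m)/p$ that does not depend on the coefficient of $T^m$. The multiple is
  detected by comparing $f([p]_H(T))$ with $[p]_H(f(T))$ in degree $m$; as $[p]_H(T) = T^{p^h}$, it
  vanishes if and only if $k < h$ or the coefficient $a$ of $T^{p^{k-h}}$ in $f$ satisfies
  $a^{p^h} = a$. So the coefficients at the powers $T^{p^k}$ are free except for the last equation
  whenever $p^{k+h}$ is still within the truncation degree, and they determine all others.\<close>

section \<open>Power series over a commutative ring type\<close>

text \<open>The sections of a scheme form a ring with an explicit carrier. The argument therefore
  runs over a commutative ring type modulo an ideal, and every such ring is reached as a quotient of
  an integral polynomial ring. The ideal and the degree are handled together by \<open>J\<close>.
  The law over F_p is lifted once to integer coefficients, where it is a law only modulo the ideal.
  Multiplication by p sees the multiple at a power of p because [p]_H arises from p - 1 formal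
  additions of T: each addition contributes a value of the defect whose lowest part is its value at
  a point (jT, T), 0 < j < p, and the sum of these values is a unit modulo p on the generator. The
  coefficient of T^(p^k) is invisible in degree p^k because the middle binomial coefficients of p^k
  vanish modulo p. Buds and full series are one case, with the truncation degree N an extended
  natural number. The obstruction caused by the coefficient at p^k sits in degree p^(k+h) and exists
  only if that degree is at most N; hence exactly h steps of a bud are unrestricted.\<close>

abbreviation zv :: "'v \<Rightarrow> nat" where
  "zv \<equiv> \<lambda>_. 0"

lemma zv_add [simp]: "zv + \<beta> = \<beta>" "\<beta> + zv = \<beta>"
  by (auto simp: fun_eq_iff)

lemma deg_zero [simp]: "deg zv = 0"
  by (simp add: deg_def)

lemma deg_eq_0_iff [simp]: "deg \<beta> = 0 \<longleftrightarrow> \<beta> = zv"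
  by (auto simp: deg_def fun_eq_iff)

lemma deg_add [simp]: "deg (\<beta> + \<gamma>) = deg \<beta> + deg \<gamma>"
  by (simp add: deg_def sum.distrib)

lemma finite_deg_le [simp]: "finite {\<beta> :: 'v::finite \<Rightarrow> nat. deg \<beta> \<le> n}"
proof (rule finite_subset)
  show "{\<beta> :: 'v \<Rightarrow> nat. deg \<beta> \<le> n} \<subseteq> (\<Pi>\<^sub>E v\<in>UNIV. {..n})"
  proof
    fix \<beta> :: "'v \<Rightarrow> nat" assume "\<beta> \<in> {\<beta>. deg \<beta> \<le> n}"
    then have "\<beta> v \<le> n" for v
      using member_le_sum[of v UNIV \<beta>] by (auto simp: deg_def)
    then show "\<beta> \<in> (\<Pi>\<^sub>E v\<in>UNIV. {..n})"
      by auto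
  qed
  show "finite (\<Pi>\<^sub>E v\<in>(UNIV :: 'v set). {..n})"
    by (intro finite_PiE) auto
qed

lemma finite_fun_le [simp]: "finite {\<gamma> :: 'v::finite \<Rightarrow> nat. \<gamma> \<le> \<beta>}"
proof (rule finite_subset)
  show "{\<gamma>. \<gamma> \<le> \<beta>} \<subseteq> {\<gamma>. deg \<gamma> \<le> deg \<beta>}"
    by (auto simp: deg_def le_fun_def intro: sum_mono)
qed simp

definition uvec :: "'v \<Rightarrow> 'v \<Rightarrow> nat" where
  "uvec v = (\<lambda>w. if w = v then 1 else 0)"

lemma deg_uvec [simp]: "deg (uvec v) = 1"
  by (simp add: deg_def uvec_def)

lemma exponent_split:
  assumes "deg \<beta> = Suc n"
  obtains v \<gamma> where "\<beta> = \<gamma> + uvec v" "deg \<gamma> = n"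
proof -
  from assms obtain v where v: "\<beta> v > 0"
    by (metis deg_eq_0_iff gr0I nat.simps(3) ext)
  define \<gamma> where "\<gamma> = \<beta>(v := \<beta> v - 1)"
  have \<beta>: "\<beta> = \<gamma> + uvec v"
    using v by (auto simp: \<gamma>_def uvec_def fun_eq_iff)
  with assms have "deg \<gamma> = n"
    by simp
  with \<beta> show ?thesis
    using that by blast
qed

text \<open>Pairs instead of a subtraction of exponents make associativity and commutativity of the
  product plain reindexings.\<close>

definition splits :: "('v \<Rightarrow> nat) \<Rightarrow> (('v \<Rightarrow> nat) \<times> ('v \<Rightarrow> nat)) set" where
  "splits \<beta> = {(\<gamma>, \<delta>). \<gamma> + \<delta> = \<beta>}"

lemma finite_splits [simp]: "finite (splits (\<beta> :: 'v::finite \<Rightarrow> nat))"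
proof (rule finite_subset)
  show "splits \<beta> \<subseteq> {\<gamma>. \<gamma> \<le> \<beta>} \<times> {\<gamma>. \<gamma> \<le> \<beta>}"
    by (auto simp: splits_def le_fun_def)
qed auto

text \<open>Bridge to the product in \<open>PS\<close>, whose convolution subtracts
  exponents.\<close>

lemma sum_splits:
  "(\<Sum>(\<gamma>, \<delta>)\<in>splits (\<beta> :: 'v::finite \<Rightarrow> nat). g \<gamma> \<delta>) = (\<Sum>\<gamma> | \<gamma> \<le> \<beta>. g \<gamma> (\<beta> - \<gamma>))"
proof (rule sum.reindex_bij_witness[of _ "\<lambda>\<gamma>. (\<gamma>, \<beta> - \<gamma>)" fst])
  fix x assume "x \<in> splits \<beta>"
  then have x: "snd x = \<beta> - fst x" "fst x \<le> \<beta>"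
    by (auto simp: splits_def le_fun_def fun_eq_iff) (metis diff_add_inverse, metis le_add1)
  then show "(fst x, \<beta> - fst x) = x" "fst x \<in> {\<gamma>. \<gamma> \<le> \<beta>}"
    by (auto simp: prod_eq_iff)
  show "g (fst x) (\<beta> - fst x) = (case x of (\<gamma>, \<delta>) \<Rightarrow> g \<gamma> \<delta>)"
    using x by (simp add: split_def)
qed (auto simp: splits_def le_fun_def fun_eq_iff)

text \<open>The function type already carries the pointwise structure, whose addition is the one
  used on exponent vectors; the convolution product needs a type of its own.\<close>

typedef ('v, 'a) mps = "UNIV :: (('v \<Rightarrow> nat) \<Rightarrow> 'a) set"
  morphisms cf Mps ..

lemma cf_Mps [simp]: "cf (Mps f) = f"
  by (simp add: Mps_inverse)

lemma mps_eqI: "(\<And>\<beta>. cf s \<beta> = cf t \<beta>) \<Longrightarrow> s = t"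
  by (metis cf_inject ext)

instantiation mps :: (finite, comm_ring_1) comm_ring_1
begin

definition "0 = Mps (\<lambda>_. 0)"
definition "1 = Mps (\<lambda>\<beta>. if \<beta> = zv then 1 else 0)"
definition "s + t = Mps (\<lambda>\<beta>. cf s \<beta> + cf t \<beta>)"
definition "s - t = Mps (\<lambda>\<beta>. cf s \<beta> - cf t \<beta>)"
definition "- s = Mps (\<lambda>\<beta>. - cf s \<beta>)"
definition "s * t = Mps (\<lambda>\<beta>. \<Sum>(\<gamma>, \<delta>)\<in>splits \<beta>. cf s \<gamma> * cf t \<delta>)"

lemma cf_zero [simp]: "cf 0 \<beta> = 0"
  and cf_one: "cf 1 \<beta> = (if \<beta> = zv then 1 else 0)"
  and cf_add [simp]: "cf (s + t) \<beta> = cf s \<beta> + cf t \<beta>"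
  and cf_diff [simp]: "cf (s - t) \<beta> = cf s \<beta> - cf t \<beta>"
  and cf_uminus [simp]: "cf (- s) \<beta> = - cf s \<beta>"
  and cf_mult: "cf (s * t) \<beta> = (\<Sum>(\<gamma>, \<delta>)\<in>splits \<beta>. cf s \<gamma> * cf t \<delta>)"
  by (simp_all add: zero_mps_def one_mps_def plus_mps_def minus_mps_def uminus_mps_def times_mps_def)

instance
proof
  fix s t u :: "('a, 'b) mps"
  show "s * t * u = s * (t * u)"
  proof (rule mps_eqI)
    fix \<beta>
    have "cf (s * t * u) \<beta> =
      (\<Sum>((\<gamma>, \<delta>), (\<epsilon>, \<zeta>))\<in>Sigma (splits \<beta>) (\<lambda>(\<gamma>, \<delta>). splits \<gamma>). cf s \<epsilon> * cf t \<zeta> * cf u \<delta>)"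
      by (simp add: cf_mult sum_distrib_right split_def sum.Sigma)
    \<comment> \<open>Both sums run over the triples of exponents with sum \<beta>; only the
      bracketing differs.\<close>
    also have "\<dots> = (\<Sum>((\<epsilon>, \<gamma>), (\<zeta>, \<delta>))\<in>Sigma (splits \<beta>) (\<lambda>(\<epsilon>, \<gamma>). splits \<gamma>). cf s \<epsilon> * cf t \<zeta> * cf u \<delta>)"
      by (rule sum.reindex_bij_witness[of _
            "\<lambda>((\<epsilon>, \<gamma>), (\<zeta>, \<delta>)). ((\<epsilon> + \<zeta>, \<delta>), (\<epsilon>, \<zeta>))" "\<lambda>((\<gamma>, \<delta>), (\<epsilon>, \<zeta>)). ((\<epsilon>, \<zeta> + \<delta>), (\<zeta>, \<delta>))"])
        (auto simp: splits_def add.assoc)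
    also have "\<dots> = cf (s * (t * u)) \<beta>"
      by (simp add: cf_mult sum_distrib_left split_def sum.Sigma mult.assoc)
    finally show "cf (s * t * u) \<beta> = cf (s * (t * u)) \<beta>" .
  qed
  show "s * t = t * s"
  proof (rule mps_eqI)
    fix \<beta>
    show "cf (s * t) \<beta> = cf (t * s) \<beta>"
      unfolding cf_mult
      by (rule sum.reindex_bij_witness[of _ prod.swap prod.swap])
        (auto simp: splits_def add.commute mult.commute)
  qed
  show "1 * s = s"
  proof (rule mps_eqI)
    fix \<beta>
    have "cf (1 * s) \<beta> = (\<Sum>(\<gamma>, \<delta>)\<in>{(zv, \<beta>)}. cf 1 \<gamma> * cf s \<delta>)"
      unfolding cf_mult
      by (rule sum.mono_neutral_right) (simp, auto simp: splits_def cf_one split: if_splits)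
    then show "cf (1 * s) \<beta> = cf s \<beta>"
      by (simp add: cf_one)
  qed
  show "(s + t) * u = s * u + t * u"
    by (rule mps_eqI) (simp add: cf_mult split_def algebra_simps sum.distrib)
  show "0 \<noteq> (1 :: ('a, 'b) mps)"
    using cf_one[of zv] cf_zero[of zv] by (metis zero_neq_one)
qed (auto intro!: mps_eqI)

end

lemma cf_sum [simp]: "cf (sum f A) \<beta> = (\<Sum>x\<in>A. cf (f x) \<beta>)"
  by (induction A rule: infinite_finite_induct) auto

definition monom :: "('v \<Rightarrow> nat) \<Rightarrow> 'a \<Rightarrow> ('v::finite, 'a::comm_ring_1) mps" where
  "monom \<beta> c = Mps (\<lambda>\<gamma>. if \<gamma> = \<beta> then c else 0)"

abbreviation const :: "'a \<Rightarrow> ('v::finite, 'a::comm_ring_1) mps" where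
  "const \<equiv> monom zv"

abbreviation X :: "'v \<Rightarrow> ('v::finite, 'a::comm_ring_1) mps" where
  "X v \<equiv> monom (uvec v) 1"

lemma cf_monom: "cf (monom \<beta> c) \<gamma> = (if \<gamma> = \<beta> then c else 0)"
  by (simp add: monom_def)

lemma cf_monom_mult_same [simp]: "cf (monom \<beta> c * s) (\<beta> + \<gamma>) = c * cf s \<gamma>"
proof -
  have "cf (monom \<beta> c * s) (\<beta> + \<gamma>) = (\<Sum>(\<epsilon>, \<delta>)\<in>{(\<beta>, \<gamma>)}. cf (monom \<beta> c) \<epsilon> * cf s \<delta>)"
    unfolding cf_mult
    by (rule sum.mono_neutral_right) (simp, auto simp: splits_def cf_monom split: if_splits)
  then show ?thesis
    by (simp add: cf_monom)
qed

lemma cf_const_mult [simp]: "cf (const c * s) \<gamma> = c * cf s \<gamma>"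
  using cf_monom_mult_same[of zv c s \<gamma>] by simp

lemma cf_monom_mult_outside: "(\<And>\<delta>. \<gamma> \<noteq> \<beta> + \<delta>) \<Longrightarrow> cf (monom \<beta> c * s) \<gamma> = 0"
  unfolding cf_mult by (intro sum.neutral) (auto simp: splits_def cf_monom)

lemma monom_mult: "monom \<beta> c * monom \<gamma> d = monom (\<beta> + \<gamma>) (c * d)"
proof (rule mps_eqI)
  fix \<alpha>
  show "cf (monom \<beta> c * monom \<gamma> d) \<alpha> = cf (monom (\<beta> + \<gamma>) (c * d)) \<alpha>"
  proof (cases "\<exists>\<delta>. \<alpha> = \<beta> + \<delta>")
    case True
    then show ?thesis by (auto simp: cf_monom)
  next
    case False
    then show ?thesis by (auto simp: cf_monom_mult_outside cf_monom)
  qed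
qed

lemma const_1 [simp]: "const 1 = 1"
  by (rule mps_eqI) (simp add: cf_monom cf_one)

lemma monom_power: "monom \<beta> c ^ k = monom (\<lambda>v. k * \<beta> v) (c ^ k)"
proof (induction k)
  case 0
  then show ?case by (simp flip: const_1)
next
  case (Suc k)
  then show ?case by (simp add: monom_mult plus_fun_def)
qed

lemma of_nat_mps: "of_nat k = const (of_nat k)"
proof (induction k)
  case 0
  then show ?case by (intro mps_eqI) (simp add: cf_monom)
next
  case (Suc k)
  then show ?case by (intro mps_eqI) (simp add: cf_monom cf_one)
qed

subsection \<open>Congruences\<close>

text \<open>An ideal as a set. It is used for the kernel of a map into a ring with an explicit
  carrier, and as the zero ideal for exact statements about orders.\<close>

locale modulus =
  fixes I :: "'a::comm_ring_1 set"
  assumes I0 [simp]: "0 \<in> I"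
    and I_add: "a \<in> I \<Longrightarrow> b \<in> I \<Longrightarrow> a + b \<in> I"
    and I_mult: "a \<in> I \<Longrightarrow> b * a \<in> I"
begin

lemma I_mult_right: "a \<in> I \<Longrightarrow> a * b \<in> I"
  using I_mult[of a b] by (simp add: mult.commute)

lemma I_uminus [simp]: "- a \<in> I \<longleftrightarrow> a \<in> I"
  using I_mult[of _ "-1"] by force

lemma I_diff: "a \<in> I \<Longrightarrow> b \<in> I \<Longrightarrow> a - b \<in> I"
  using I_add[of a "- b"] by simp

lemma I_sum: "(\<And>x. x \<in> A \<Longrightarrow> f x \<in> I) \<Longrightarrow> sum f A \<in> I"
  by (induction A rule: infinite_finite_induct) (auto simp: I_add)

lemma I_diff_commute: "a - b \<in> I \<longleftrightarrow> b - a \<in> I"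
  using I_uminus[of "a - b"] by simp

lemma I_diff_trans: "a - b \<in> I \<Longrightarrow> b - c \<in> I \<Longrightarrow> a - c \<in> I"
  using I_add[of "a - b" "b - c"] by simp

lemma I_diff_iff: "a - b \<in> I \<Longrightarrow> a \<in> I \<longleftrightarrow> b \<in> I"
  by (metis I_add I_diff_commute diff_add_cancel)

text \<open>Membership of \<open>s - t\<close> expresses congruence modulo I and modulo terms of
  degree at least m at once; for every m it means that all coefficients are congruent modulo
  I.\<close>

definition J :: "nat \<Rightarrow> ('v::finite, 'a) mps set" where
  "J m = {s. \<forall>\<beta>. deg \<beta> < m \<longrightarrow> cf s \<beta> \<in> I}"

lemma JD: "s \<in> J m \<Longrightarrow> deg \<beta> < m \<Longrightarrow> cf s \<beta> \<in> I"
  by (auto simp: J_def)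

lemma JI: "(\<And>\<beta>. deg \<beta> < m \<Longrightarrow> cf s \<beta> \<in> I) \<Longrightarrow> s \<in> J m"
  by (auto simp: J_def)

lemma J_0 [simp]: "s \<in> J 0" and zero_J [simp]: "0 \<in> J m"
  by (auto simp: J_def)

lemma J_mono: "s \<in> J m \<Longrightarrow> k \<le> m \<Longrightarrow> s \<in> J k"
  by (auto simp: J_def)

lemma J_add: "s \<in> J m \<Longrightarrow> t \<in> J m \<Longrightarrow> s + t \<in> J m"
  by (auto simp: J_def I_add)

lemma J_diff: "s \<in> J m \<Longrightarrow> t \<in> J m \<Longrightarrow> s - t \<in> J m"
  by (auto simp: J_def I_diff)

lemma J_uminus [simp]: "- s \<in> J m \<longleftrightarrow> s \<in> J m"
  by (auto simp: J_def)

lemma J_sum: "(\<And>x. x \<in> A \<Longrightarrow> f x \<in> J m) \<Longrightarrow> sum f A \<in> J m"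
  by (induction A rule: infinite_finite_induct) (auto simp: J_add)

lemma J_mult:
  assumes "s \<in> J k" "t \<in> J m"
  shows "s * t \<in> J (k + m)"
proof (rule JI)
  fix \<beta> :: "'b \<Rightarrow> nat" assume \<beta>: "deg \<beta> < k + m"
  have "cf s \<gamma> * cf t \<delta> \<in> I" if "(\<gamma>, \<delta>) \<in> splits \<beta>" for \<gamma> \<delta>
  proof -
    have "deg \<gamma> + deg \<delta> < k + m"
      using that \<beta> by (auto simp: splits_def)
    then have "deg \<gamma> < k \<or> deg \<delta> < m"
      by linarith
    then show ?thesis
      using assms by (auto dest: JD intro: I_mult I_mult_right)
  qed
  then show "cf (s * t) \<beta> \<in> I"
    by (auto simp: cf_mult intro!: I_sum)
qed

lemma J_mult_left: "t \<in> J m \<Longrightarrow> s * t \<in> J m"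
  using J_mult[of s 0 t m] by simp

lemma J_mult_right: "t \<in> J m \<Longrightarrow> t * s \<in> J m"
  using J_mult[of t m s 0] by simp

lemma J_diff_commute: "s - t \<in> J m \<longleftrightarrow> t - s \<in> J m"
  using J_uminus[of "s - t" m] by simp

lemma J_diff_trans: "s - t \<in> J m \<Longrightarrow> t - u \<in> J m \<Longrightarrow> s - u \<in> J m"
  using J_add[of "s - t" m "t - u"] by simp

lemma J_diff_mult:
  assumes "s - s' \<in> J m" "t - t' \<in> J m"
  shows "s * t - s' * t' \<in> J m"
proof -
  have "s * t - s' * t' = (s - s') * t + s' * (t - t')"
    by (simp add: algebra_simps)
  then show ?thesis
    using assms by (simp add: J_add J_mult_left J_mult_right)
qed

lemma J_diff_power: "s - s' \<in> J m \<Longrightarrow> s ^ k - s' ^ k \<in> J m"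
  by (induction k) (auto intro: J_diff_mult)

end

subsection \<open>Substitution\<close>

definition mpow :: "('v::finite \<Rightarrow> ('w::finite, 'a::comm_ring_1) mps) \<Rightarrow> ('v \<Rightarrow> nat) \<Rightarrow> ('w, 'a) mps" where
  "mpow g \<beta> = (\<Prod>v\<in>UNIV. g v ^ \<beta> v)"

lemma mpow_0 [simp]: "mpow g zv = 1"
  by (simp add: mpow_def)

lemma mpow_add: "mpow g (\<beta> + \<gamma>) = mpow g \<beta> * mpow g \<gamma>"
  by (simp add: mpow_def power_add prod.distrib)

lemma mpow_uvec [simp]: "mpow g (uvec v) = g v"
proof -
  have "mpow g (uvec v) = (\<Prod>w\<in>UNIV. if w = v then g v else 1)"
    unfolding mpow_def uvec_def by (rule prod.cong) auto
  then show ?thesis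
    by simp
qed

definition msubst ::
  "('v::finite, 'a::comm_ring_1) mps \<Rightarrow> ('v \<Rightarrow> ('w::finite, 'a) mps) \<Rightarrow> ('w, 'a) mps" where
  "msubst f g = Mps (\<lambda>\<alpha>. \<Sum>\<beta> | deg \<beta> \<le> deg \<alpha>. cf f \<beta> * cf (mpow g \<beta>) \<alpha>)"

lemma cf_msubst: "cf (msubst f g) \<alpha> = (\<Sum>\<beta> | deg \<beta> \<le> deg \<alpha>. cf f \<beta> * cf (mpow g \<beta>) \<alpha>)"
  by (simp add: msubst_def)

context modulus
begin

lemma mpow_J:
  assumes "\<And>v. g v \<in> J 1"
  shows "mpow g \<beta> \<in> J (deg \<beta>)"
proof (induction "deg \<beta>" arbitrary: \<beta>)
  case (Suc n)
  then obtain v \<gamma> where \<gamma>: "\<beta> = \<gamma> + uvec v" "deg \<gamma> = n"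
    by (metis exponent_split)
  with Suc have "mpow g \<gamma> \<in> J n"
    by auto
  then have "mpow g \<beta> \<in> J (n + 1)"
    unfolding \<gamma> mpow_add mpow_uvec using assms by (intro J_mult) auto
  then show ?case
    using Suc by simp
qed auto

text \<open>Exchange the factors one at a time: the exchanged factor contributes order m, each of
  the remaining \<open>deg \<beta> - 1\<close> factors contributes order 1.\<close>

lemma mpow_J_diff:
  assumes g: "\<And>v. g v \<in> J 1" and g': "\<And>v. g' v \<in> J 1"
    and d: "\<And>v. g v - g' v \<in> J m" and "m \<ge> 1"
  shows "mpow g \<beta> - mpow g' \<beta> \<in> J (m + deg \<beta> - 1)"
proof (induction "deg \<beta>" arbitrary: \<beta>)
  case (Suc n)
  then obtain v \<gamma> where \<gamma>: "\<beta> = \<gamma> + uvec v" "deg \<gamma> = n"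
    by (metis exponent_split)
  with Suc have *: "mpow g \<gamma> - mpow g' \<gamma> \<in> J (m + n - 1)"
    by auto
  have "(mpow g \<gamma> - mpow g' \<gamma>) * g v \<in> J (m + n - 1 + 1)"
    using * g by (intro J_mult)
  moreover have "mpow g' \<gamma> * (g v - g' v) \<in> J (n + m)"
    using mpow_J[of g' \<gamma>] g' d \<gamma> by (intro J_mult) auto
  ultimately have "(mpow g \<gamma> - mpow g' \<gamma>) * g v + mpow g' \<gamma> * (g v - g' v) \<in> J (m + n)"
    using \<open>m \<ge> 1\<close> by (intro J_add) (auto simp: add.commute)
  then show ?case
    using Suc(2) by (simp add: \<gamma> mpow_add algebra_simps)
qed simp

end

text \<open>For the zero ideal \<open>J m\<close> consists of the series of order at least m, so the
  congruence lemmas also give vanishing of coefficients.\<close>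

interpretation zero_ideal: modulus "{0 :: 'a::comm_ring_1}"
  by unfold_locales auto

abbreviation no_const :: "('v::finite, 'a::comm_ring_1) mps \<Rightarrow> bool" where
  "no_const s \<equiv> cf s zv = 0"

lemma no_const_iff: "no_const s \<longleftrightarrow> s \<in> zero_ideal.J 1"
  by (auto simp: zero_ideal.J_def)

lemma cf_mpow_eq_0:
  assumes "\<And>v. no_const (g v)" "deg \<alpha> < deg \<beta>"
  shows "cf (mpow g \<beta>) \<alpha> = 0"
  using zero_ideal.mpow_J[of g \<beta>] assms by (auto simp: no_const_iff dest: zero_ideal.JD)

text \<open>Up to degree \<^term>\<open>n\<close> a substitution is a finite sum, so that it can be handled as a
  polynomial expression.\<close>

lemma cf_msubst_le:
  assumes "\<And>v. no_const (g v)" "deg \<alpha> \<le> n"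
  shows "cf (msubst f g) \<alpha> = (\<Sum>\<beta> | deg \<beta> \<le> n. cf f \<beta> * cf (mpow g \<beta>) \<alpha>)"
  unfolding cf_msubst
proof (rule sum.mono_neutral_left)
  show "\<forall>i\<in>{\<beta>. deg \<beta> \<le> n} - {\<beta>. deg \<beta> \<le> deg \<alpha>}. cf f i * cf (mpow g i) \<alpha> = 0"
    using assms(1) by (auto simp: cf_mpow_eq_0)
qed (use assms in auto)

lemma msubst_add: "msubst (s + t) g = msubst s g + msubst t g"
  by (rule mps_eqI) (simp add: cf_msubst algebra_simps sum.distrib)

lemma msubst_diff: "msubst (s - t) g = msubst s g - msubst t g"
  by (rule mps_eqI) (simp add: cf_msubst algebra_simps sum_subtractf)

lemma msubst_0 [simp]: "msubst 0 g = 0"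
  by (rule mps_eqI) (simp add: cf_msubst)

lemma msubst_sum: "msubst (sum f A) g = (\<Sum>x\<in>A. msubst (f x) g)"
  by (induction A rule: infinite_finite_induct) (auto simp: msubst_add)

lemma msubst_mult:
  fixes s t :: "('v::finite, 'a::comm_ring_1) mps" and g :: "'v \<Rightarrow> ('w::finite, 'a) mps"
  assumes g: "\<And>v. no_const (g v)"
  shows "msubst (s * t) g = msubst s g * msubst t g"
proof (rule mps_eqI)
  fix \<alpha> :: "'w \<Rightarrow> nat"
  define n where "n = deg \<alpha>"
  define B where "B = {\<beta> :: 'v \<Rightarrow> nat. deg \<beta> \<le> n}"
  have fB: "finite B" by (simp add: B_def)
  define F where "F = (\<lambda>(\<gamma>, \<delta>). cf s \<gamma> * cf t \<delta> * cf (mpow g (\<gamma> + \<delta>)) \<alpha>)"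
  have "cf (msubst (s * t) g) \<alpha> = (\<Sum>\<beta>\<in>B. \<Sum>x\<in>splits \<beta>. F x)"
    using g by (simp add: cf_msubst_le[of g \<alpha> n] n_def B_def F_def cf_mult sum_distrib_right split_def)
      (auto intro!: sum.cong simp: splits_def)
  also have "\<dots> = (\<Sum>(\<beta>, x)\<in>Sigma B splits. F x)"
    by (simp add: sum.Sigma fB)
  also have "\<dots> = (\<Sum>x\<in>{x \<in> B \<times> B. deg (fst x + snd x) \<le> n}. F x)"
    by (rule sum.reindex_bij_witness[of _ "\<lambda>x. (fst x + snd x, x)" snd]) (auto simp: B_def splits_def)
  \<comment> \<open>Pairs of total degree above n contribute nothing at \<alpha>. Over the whole box
    the double sum splits into a product.\<close>
  also have "\<dots> = (\<Sum>x\<in>B \<times> B. F x)"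
  proof (rule sum.mono_neutral_left)
    show "\<forall>x\<in>B \<times> B - {x \<in> B \<times> B. deg (fst x + snd x) \<le> n}. F x = 0"
    proof
      fix x assume x: "x \<in> B \<times> B - {x \<in> B \<times> B. deg (fst x + snd x) \<le> n}"
      then have "cf (mpow g (fst x + snd x)) \<alpha> = 0"
        by (intro cf_mpow_eq_0) (use g in \<open>auto simp: n_def\<close>)
      then show "F x = 0"
        by (simp add: F_def split_def)
    qed
  qed (use fB in auto)
  also have "\<dots> = (\<Sum>\<gamma>\<in>B. \<Sum>\<delta>\<in>B. cf (const (cf s \<gamma>) * mpow g \<gamma> * (const (cf t \<delta>) * mpow g \<delta>)) \<alpha>)"
  proof -
    have "F (\<gamma>, \<delta>) = cf (const (cf s \<gamma>) * mpow g \<gamma> * (const (cf t \<delta>) * mpow g \<delta>)) \<alpha>" for \<gamma> \<delta>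
    proof -
      have "const (cf s \<gamma>) * mpow g \<gamma> * (const (cf t \<delta>) * mpow g \<delta>) =
        const (cf s \<gamma>) * (const (cf t \<delta>) * mpow g (\<gamma> + \<delta>))"
        by (simp add: mpow_add algebra_simps)
      then show ?thesis
        by (simp only: F_def cf_const_mult split mult.assoc)
    qed
    then show ?thesis
      by (auto simp: sum.cartesian_product intro!: sum.cong)
  qed
  also have "\<dots> = cf ((\<Sum>\<gamma>\<in>B. const (cf s \<gamma>) * mpow g \<gamma>) * (\<Sum>\<delta>\<in>B. const (cf t \<delta>) * mpow g \<delta>)) \<alpha>"
    by (simp add: sum_product)
  also have "\<dots> = cf (msubst s g * msubst t g) \<alpha>"
  proof -
    have "cf (\<Sum>\<gamma>\<in>B. const (cf u \<gamma>) * mpow g \<gamma>) \<gamma> = cf (msubst u g) \<gamma>" if "deg \<gamma> \<le> n" for u \<gamma>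
      using that g by (simp add: cf_msubst_le[of g \<gamma> n] B_def)
    moreover have "deg \<gamma> \<le> n" "deg \<delta> \<le> n" if "(\<gamma>, \<delta>) \<in> splits \<alpha>" for \<gamma> \<delta>
      using that by (auto simp: splits_def n_def)
    ultimately show ?thesis
      unfolding cf_mult by (intro sum.cong) auto
  qed
  finally show "cf (msubst (s * t) g) \<alpha> = cf (msubst s g * msubst t g) \<alpha>" .
qed

lemma msubst_monom:
  assumes "\<And>v. no_const (g v)"
  shows "msubst (monom \<beta> c) g = const c * mpow g \<beta>"
proof (rule mps_eqI)
  fix \<alpha>
  have "cf (msubst (monom \<beta> c) g) \<alpha> = (\<Sum>\<gamma> | deg \<gamma> \<le> max (deg \<alpha>) (deg \<beta>). cf (monom \<beta> c) \<gamma> * cf (mpow g \<gamma>) \<alpha>)"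
    by (rule cf_msubst_le) (use assms in auto)
  also have "\<dots> = (\<Sum>\<gamma> | deg \<gamma> \<le> max (deg \<alpha>) (deg \<beta>). if \<gamma> = \<beta> then c * cf (mpow g \<beta>) \<alpha> else 0)"
    by (rule sum.cong) (auto simp: cf_monom)
  also have "\<dots> = cf (const c * mpow g \<beta>) \<alpha>"
    by (simp add: sum.delta)
  finally show "cf (msubst (monom \<beta> c) g) \<alpha> = cf (const c * mpow g \<beta>) \<alpha>" .
qed

lemma msubst_X [simp]: "(\<And>v. no_const (g v)) \<Longrightarrow> msubst (X v) g = g v"
  by (simp add: msubst_monom)

lemma msubst_1: "(\<And>v. no_const (g v)) \<Longrightarrow> msubst 1 g = 1"
  using msubst_monom[of g zv 1] by simp

lemma msubst_power: "(\<And>v. no_const (g v)) \<Longrightarrow> msubst (s ^ k) g = msubst s g ^ k"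
  by (induction k) (auto simp: msubst_1 msubst_mult)

lemma msubst_mpow:
  assumes "\<And>v. no_const (k v)"
  shows "msubst (mpow g \<beta>) k = mpow (\<lambda>v. msubst (g v) k) \<beta>"
proof -
  have "msubst (\<Prod>v\<in>A. g v ^ \<beta> v) k = (\<Prod>v\<in>A. msubst (g v) k ^ \<beta> v)" for A
    by (induction A rule: infinite_finite_induct)
      (use assms in \<open>auto simp: msubst_1 msubst_mult msubst_power\<close>)
  then show ?thesis
    by (simp add: mpow_def)
qed

lemma no_const_mult [simp]: "no_const s \<Longrightarrow> no_const (s * t)"
  using zero_ideal.J_mult_right[of s 1 t] by (simp add: no_const_iff)

lemma no_const_power [simp]: "no_const s \<Longrightarrow> k > 0 \<Longrightarrow> no_const (s ^ k)"
  by (cases k) auto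

lemma no_const_X [simp]: "no_const (X v)"
  by (auto simp: cf_monom) (metis deg_uvec deg_zero zero_neq_one)

lemma no_const_msubst [simp]: "no_const s \<Longrightarrow> no_const (msubst s g)"
  by (simp add: cf_msubst)

lemma msubst_assoc:
  fixes s :: "('u::finite, 'a::comm_ring_1) mps" and g :: "'u \<Rightarrow> ('v::finite, 'a) mps"
    and k :: "'v \<Rightarrow> ('w::finite, 'a) mps"
  assumes g: "\<And>v. no_const (g v)" and k: "\<And>v. no_const (k v)"
  shows "msubst (msubst s g) k = msubst s (\<lambda>v. msubst (g v) k)"
proof (rule mps_eqI)
  fix \<alpha> :: "'w \<Rightarrow> nat"
  define n where "n = deg \<alpha>"
  \<comment> \<open>P is a finite sum that agrees with \<open>msubst s g\<close> up to degree n, and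
    substitution is additive and multiplicative on it. Higher terms do not reach \<alpha>.\<close>
  define P where "P = (\<Sum>\<beta> | deg \<beta> \<le> n. const (cf s \<beta>) * mpow g \<beta>)"
  have "cf (msubst s g) \<beta> = cf P \<beta>" if "deg \<beta> \<le> n" for \<beta>
    using that g by (simp add: cf_msubst_le[of g \<beta> n] P_def)
  then have "cf (msubst (msubst s g) k) \<alpha> = cf (msubst P k) \<alpha>"
    by (simp add: cf_msubst n_def)
  also have "msubst P k = (\<Sum>\<beta> | deg \<beta> \<le> n. const (cf s \<beta>) * mpow (\<lambda>v. msubst (g v) k) \<beta>)"
    using k by (simp add: P_def msubst_sum msubst_mult msubst_mpow msubst_monom)
  also have "cf \<dots> \<alpha> = cf (msubst s (\<lambda>v. msubst (g v) k)) \<alpha>"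
    by (simp add: cf_msubst n_def)
  finally show "cf (msubst (msubst s g) k) \<alpha> = cf (msubst s (\<lambda>v. msubst (g v) k)) \<alpha>" .
qed

lemma mpow_X: "mpow X \<beta> = monom \<beta> 1"
proof -
  have "(\<Prod>v\<in>A. X v ^ \<beta> v) = (monom (\<lambda>w. if w \<in> A then \<beta> w else 0) 1 :: ('a, 'b) mps)" for A
  proof (induction A rule: infinite_finite_induct)
    case (insert v A)
    have "(\<lambda>w. \<beta> v * uvec v w) + (\<lambda>w. if w \<in> A then \<beta> w else 0) =
      (\<lambda>w. if w \<in> insert v A then \<beta> w else 0)"
      using insert by (auto simp: uvec_def)
    with insert show ?case
      by (simp add: monom_power monom_mult)
  qed (auto simp flip: const_1)
  then show ?thesis
    by (simp add: mpow_def)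
qed

lemma msubst_X_right [simp]: "msubst s X = s"
proof (rule mps_eqI)
  fix \<alpha>
  have "cf (msubst s X) \<alpha> = (\<Sum>\<beta> | deg \<beta> \<le> deg \<alpha>. if \<beta> = \<alpha> then cf s \<alpha> else 0)"
    unfolding cf_msubst by (rule sum.cong) (auto simp: mpow_X cf_monom)
  then show "cf (msubst s X) \<alpha> = cf s \<alpha>"
    by (simp add: sum.delta)
qed

context modulus
begin

lemma no_const_J1: "no_const s \<Longrightarrow> s \<in> J 1"
  by (auto simp: J_def)

lemma J_msubst: "s \<in> J m \<Longrightarrow> msubst s g \<in> J m"
  by (rule JI) (auto simp: cf_msubst intro!: I_sum I_mult_right JD[of s m])

lemma J_diff_msubst_left: "s - t \<in> J m \<Longrightarrow> msubst s g - msubst t g \<in> J m"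
  using J_msubst[of "s - t" m g] by (simp add: msubst_diff)

text \<open>Taylor expansion to first order: by \<open>mpow_J_diff\<close> a monomial of degree at
  least 2 changes only from order m + 1 on, so only the linear terms of s remain.\<close>

lemma J_msubst_first_order:
  fixes s :: "('v::finite, 'a) mps" and g g' :: "'v \<Rightarrow> ('w::finite, 'a) mps"
  assumes g: "\<And>v. g v \<in> J 1" and g': "\<And>v. g' v \<in> J 1"
    and d: "\<And>v. g v - g' v \<in> J m" and "m \<ge> 1"
  shows "msubst s g - msubst s g' - (\<Sum>v\<in>UNIV. const (cf s (uvec v)) * (g v - g' v)) \<in> J (m + 1)"
proof (rule JI)
  fix \<alpha> :: "'w \<Rightarrow> nat" assume \<alpha>: "deg \<alpha> < m + 1"
  \<comment> \<open>The maximum with 1 keeps the unit vectors in the range when \<alpha> is zero; by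
    \<open>ext\<close> the larger range changes the sums only by elements of I.\<close>
  define n where "n = max 1 (deg \<alpha>)"
  have high: "cf (mpow f \<beta>) \<alpha> \<in> I" if "\<And>v. f v \<in> J 1" "deg \<alpha> < deg \<beta>" for f and \<beta> :: "'v \<Rightarrow> nat"
    using mpow_J[of f \<beta>] that JD by blast
  have ext: "cf (msubst s f) \<alpha> - (\<Sum>\<beta> | deg \<beta> \<le> n. cf s \<beta> * cf (mpow f \<beta>) \<alpha>) \<in> I"
    if f: "\<And>v. f v \<in> J 1" for f
  proof -
    have "(\<Sum>\<beta> | deg \<beta> \<le> n. cf s \<beta> * cf (mpow f \<beta>) \<alpha>) =
      cf (msubst s f) \<alpha> + (\<Sum>\<beta>\<in>{\<beta>. deg \<beta> \<le> n} - {\<beta>. deg \<beta> \<le> deg \<alpha>}. cf s \<beta> * cf (mpow f \<beta>) \<alpha>)"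
      unfolding cf_msubst by (subst sum.subset_diff[of "{\<beta>. deg \<beta> \<le> deg \<alpha>}"]) (auto simp: n_def)
    moreover have "(\<Sum>\<beta>\<in>{\<beta>. deg \<beta> \<le> n} - {\<beta>. deg \<beta> \<le> deg \<alpha>}. cf s \<beta> * cf (mpow f \<beta>) \<alpha>) \<in> I"
      using high[of f, OF f] by (intro I_sum I_mult) auto
    ultimately show ?thesis
      by simp
  qed
  have U: "inj (uvec :: 'v \<Rightarrow> _)"
    by (auto simp: inj_def uvec_def fun_eq_iff split: if_splits)
  have "(\<Sum>\<beta> | deg \<beta> \<le> n. cf s \<beta> * cf (mpow g \<beta>) \<alpha>) - (\<Sum>\<beta> | deg \<beta> \<le> n. cf s \<beta> * cf (mpow g' \<beta>) \<alpha>)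
    - (\<Sum>v\<in>UNIV. cf s (uvec v) * cf (g v - g' v) \<alpha>) =
    (\<Sum>\<beta>\<in>{\<beta>. deg \<beta> \<le> n} - range uvec. cf s \<beta> * cf (mpow g \<beta> - mpow g' \<beta>) \<alpha>)"
  proof -
    have "(\<Sum>v\<in>UNIV. cf s (uvec v) * cf (g v - g' v) \<alpha>) =
      (\<Sum>\<beta>\<in>range uvec. cf s \<beta> * cf (mpow g \<beta> - mpow g' \<beta>) \<alpha>)"
      by (subst sum.reindex[OF U]) simp
    moreover have "(\<Sum>\<beta> | deg \<beta> \<le> n. cf s \<beta> * cf (mpow g \<beta> - mpow g' \<beta>) \<alpha>) =
      (\<Sum>\<beta>\<in>{\<beta>. deg \<beta> \<le> n} - range uvec. cf s \<beta> * cf (mpow g \<beta> - mpow g' \<beta>) \<alpha>) +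
      (\<Sum>\<beta>\<in>range uvec. cf s \<beta> * cf (mpow g \<beta> - mpow g' \<beta>) \<alpha>)"
      by (rule sum.subset_diff) (auto simp: n_def)
    moreover have "(\<Sum>\<beta> | deg \<beta> \<le> n. cf s \<beta> * cf (mpow g \<beta> - mpow g' \<beta>) \<alpha>) =
      (\<Sum>\<beta> | deg \<beta> \<le> n. cf s \<beta> * cf (mpow g \<beta>) \<alpha>) - (\<Sum>\<beta> | deg \<beta> \<le> n. cf s \<beta> * cf (mpow g' \<beta>) \<alpha>)"
      by (simp add: sum_subtractf right_diff_distrib)
    ultimately show ?thesis
      by (simp only: add_diff_cancel_right')
  qed
  also have "\<dots> \<in> I"
  proof (intro I_sum I_mult)
    fix \<beta> :: "'v \<Rightarrow> nat" assume \<beta>: "\<beta> \<in> {\<beta>. deg \<beta> \<le> n} - range uvec"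
    have "deg \<beta> \<noteq> 1"
    proof
      assume "deg \<beta> = 1"
      then obtain v \<gamma> where "\<beta> = \<gamma> + uvec v" "deg \<gamma> = 0"
        using exponent_split[of \<beta> 0] by (metis One_nat_def)
      with \<beta> show False by auto
    qed
    then consider "\<beta> = zv" | "deg \<beta> \<ge> 2"
      by (metis One_nat_def Suc_1 deg_eq_0_iff less_2_cases not_le)
    then show "cf (mpow g \<beta> - mpow g' \<beta>) \<alpha> \<in> I"
    proof cases
      case 2
      then have "mpow g \<beta> - mpow g' \<beta> \<in> J (m + 1)"
        by (intro J_mono[OF mpow_J_diff[OF g g' d]]) (use \<open>m \<ge> 1\<close> in auto)
      with \<alpha> show ?thesis by (auto dest: JD)
    qed simp
  qed
  finally have "(\<Sum>\<beta> | deg \<beta> \<le> n. cf s \<beta> * cf (mpow g \<beta>) \<alpha>)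
     - (\<Sum>\<beta> | deg \<beta> \<le> n. cf s \<beta> * cf (mpow g' \<beta>) \<alpha>)
    - (\<Sum>v\<in>UNIV. cf s (uvec v) * cf (g v - g' v) \<alpha>) \<in> I" .
  from I_diff[OF I_add[OF this ext[of g, OF g]] ext[of g', OF g']]
  show "cf (msubst s g - msubst s g' - (\<Sum>v\<in>UNIV. const (cf s (uvec v)) * (g v - g' v))) \<alpha> \<in> I"
    by simp (simp add: algebra_simps)
qed

lemma J_diff_msubst_right:
  assumes g: "\<And>v. g v \<in> J 1" and g': "\<And>v. g' v \<in> J 1"
    and d: "\<And>v. g v - g' v \<in> J m"
  shows "msubst s g - msubst s g' \<in> J m"
proof (cases "m = 0")
  case False
  then have "msubst s g - msubst s g' - (\<Sum>v\<in>UNIV. const (cf s (uvec v)) * (g v - g' v)) \<in> J m"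
    by (intro J_mono[OF J_msubst_first_order]) (use assms in auto)
  moreover have "(\<Sum>v\<in>UNIV. const (cf s (uvec v)) * (g v - g' v)) \<in> J m"
    by (intro J_sum J_mult_left d)
  ultimately show ?thesis
    using J_add by fastforce
qed auto

lemma J_diff_msubst:
  assumes "s - s' \<in> J m" "\<And>v. g v \<in> J 1" "\<And>v. g' v \<in> J 1" "\<And>v. g v - g' v \<in> J m"
  shows "msubst s g - msubst s' g' \<in> J m"
  using J_diff_trans[OF J_diff_msubst_left J_diff_msubst_right] assms by blast

text \<open>The lowest homogeneous part of \<^term>\<open>s\<close> only sees the linear parts of what is
  substituted.\<close>

lemma J_msubst_lowest:
  fixes s :: "('v::finite, 'a) mps" and g g' :: "'v \<Rightarrow> ('w::finite, 'a) mps"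
  assumes s: "s \<in> J m" and g: "\<And>v. g v \<in> J 1" and g': "\<And>v. g' v \<in> J 1"
    and d: "\<And>v. g v - g' v \<in> J 2"
  shows "msubst s g - msubst s g' \<in> J (m + 1)"
proof (rule JI)
  fix \<alpha> :: "'w \<Rightarrow> nat" assume \<alpha>: "deg \<alpha> < m + 1"
  have "cf (msubst s g - msubst s g') \<alpha> =
    (\<Sum>\<beta> | deg \<beta> \<le> deg \<alpha>. cf s \<beta> * cf (mpow g \<beta> - mpow g' \<beta>) \<alpha>)"
    by (simp add: cf_msubst sum_subtractf algebra_simps)
  also have "\<dots> \<in> I"
  proof (rule I_sum)
    fix \<beta> :: "'v \<Rightarrow> nat" assume \<beta>: "\<beta> \<in> {\<beta>. deg \<beta> \<le> deg \<alpha>}"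
    show "cf s \<beta> * cf (mpow g \<beta> - mpow g' \<beta>) \<alpha> \<in> I"
    proof (cases "deg \<beta> < m")
      case True
      then show ?thesis using s by (auto dest: JD intro: I_mult_right)
    next
      case False
      have "mpow g \<beta> - mpow g' \<beta> \<in> J (2 + deg \<beta> - 1)"
        by (rule mpow_J_diff[OF g g' d]) auto
      then have "cf (mpow g \<beta> - mpow g' \<beta>) \<alpha> \<in> I"
        using False \<alpha> by (intro JD[of _ "2 + deg \<beta> - 1"]) auto
      then show ?thesis by (rule I_mult)
    qed
  qed
  finally show "cf (msubst s g - msubst s g') \<alpha> \<in> I" .
qed

end

section \<open>Symmetric two-cocycles\<close>

lemma prime_dvd_choose_of_dvd:
  fixes p m i :: nat
  assumes "prime p" "p dvd m" "\<not> p dvd i"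
  shows "p dvd (m choose i)"
proof (cases "i = 0 \<or> m = 0")
  case True
  with assms show ?thesis by (cases i) auto
next
  case False
  then have "i * (m choose i) = m * ((m - 1) choose (i - 1))"
    by (metis Suc_pred' Suc_times_binomial_eq mult.commute not_gr0)
  with assms show ?thesis
    by (metis dvd_triv_left dvd_trans prime_dvd_mult_iff)
qed

text \<open>By Pascal's rule and divisibility of \<open>m choose Suc j\<close>, consecutive values
  are negatives of each other modulo p, starting from 1.\<close>

lemma not_dvd_choose_pred:
  fixes p m j :: nat
  assumes "prime p" "p dvd m" "m > 0" "j < p"
  shows "\<not> p dvd ((m - 1) choose j)"
  using \<open>j < p\<close>
proof (induction j)
  case 0
  then show ?case using \<open>prime p\<close> by auto
next
  case (Suc j)
  have "m choose Suc j = ((m - 1) choose Suc j) + ((m - 1) choose j)"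
    using \<open>m > 0\<close> by (cases m) auto
  moreover have "p dvd (m choose Suc j)"
    using assms Suc by (intro prime_dvd_choose_of_dvd) (auto dest: dvd_imp_le)
  ultimately show ?case
    using Suc by (metis Suc_lessD dvd_add_right_iff)
qed

text \<open>A case of Lucas' theorem. In the Vandermonde sum that splits off p elements the middle
  factors \<open>p choose k\<close> vanish modulo p; the terms k = 0 and k = p reproduce Pascal's
  rule for a and b.\<close>

lemma choose_mult_prime_cong:
  fixes p a b :: nat
  assumes "prime p"
  shows "[(p * a) choose (p * b) = a choose b] (mod p)"
proof (induction a arbitrary: b)
  case 0
  then show ?case
    using prime_gt_0_nat[OF assms] by (cases "b = 0") (auto simp: binomial_eq_0)
next
  case (Suc a)
  have p: "p > 0" using assms prime_gt_0_nat by blast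
  define f where "f k = (p choose k) * ((p * a) choose (p * b - k))" for k
  have "(p * Suc a) choose (p * b) = (\<Sum>k\<le>p * b. f k)"
    using vandermonde[of p "p * a" "p * b"] by (simp add: f_def)
  also have "[\<dots> = (\<Sum>k\<le>p * b. if k \<in> {0, p} then f k else 0)] (mod p)"
  proof (rule cong_sum)
    fix k
    consider "k = 0" | "k = p" | "k > p" | "0 < k" "k < p" by linarith
    then show "[f k = (if k \<in> {0, p} then f k else 0)] (mod p)"
    proof cases
      case 4
      then have "p dvd (p choose k)"
        using prime_dvd_choose_of_dvd[OF assms, of p k] nat_dvd_not_less[of k p] by simp
      then have "p dvd f k"
        by (simp add: f_def)
      with 4 show ?thesis by (simp add: cong_0_iff)
    qed (auto simp: f_def binomial_eq_0)
  qed
  also have "(\<Sum>k\<le>p * b. if k \<in> {0, p} then f k else 0) = (\<Sum>k\<in>{..p * b} \<inter> {0, p}. f k)"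
    by (simp only: sum.inter_restrict finite_atMost)
  also have "\<dots> = ((p * a) choose (p * b)) + (if b = 0 then 0 else (p * a) choose (p * (b - 1)))"
  proof (cases b)
    case 0
    then show ?thesis using p by (simp add: f_def)
  next
    case (Suc c)
    then have "{..p * b} \<inter> {0, p} = {0, p}" by auto
    with Suc p show ?thesis by (simp add: f_def)
  qed
  also have "[\<dots> = (a choose b) + (if b = 0 then 0 else a choose (b - 1))] (mod p)"
    by (intro cong_add) (use Suc in auto)
  also have "(a choose b) + (if b = 0 then 0 else a choose (b - 1)) = Suc a choose b"
    by (cases b) auto
  finally show ?case .
qed

text \<open>Strip factors p with \<open>choose_mult_prime_cong\<close> until m is prime to p, where
  i = 1 works. As m is not a power of p, this does not end at 1.\<close>

lemma exists_choose_not_dvd: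
  fixes p m :: nat
  assumes "prime p" "m > 0" "\<forall>k. m \<noteq> p ^ k"
  shows "\<exists>i. 1 \<le> i \<and> i < m \<and> \<not> p dvd (m choose i)"
  using assms(2,3)
proof (induction m rule: less_induct)
  case (less m)
  show ?case
  proof (cases "p dvd m")
    case False
    moreover have "m > 1" using less(2) less(3)[rule_format, of 0] by auto
    ultimately show ?thesis by (intro exI[of _ 1]) auto
  next
    case True
    then obtain m' where m: "m = p * m'" by auto
    have p: "p > 1" using assms(1) prime_gt_1_nat by blast
    have "\<forall>k. m' \<noteq> p ^ k"
      using less(3) m by (metis power_Suc)
    moreover have "m' < m" "m' > 0"
      using m less p by auto
    ultimately obtain i where i: "1 \<le> i" "i < m'" "\<not> p dvd (m' choose i)"
      using less(1) by blast
    then have "\<not> p dvd (m choose (p * i))"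
      using choose_mult_prime_cong[OF assms(1), of m' i] m cong_dvd_iff by blast
    with i p m show ?thesis
      by (intro exI[of _ "p * i"]) auto
  qed
qed

text \<open>Only the quotient by I is an algebra over F_p; the ambient ring will be a polynomial
  ring over the integers.\<close>

locale charp_modulus = modulus I for I :: "'a::comm_ring_1 set" +
  fixes p :: nat
  assumes prime_p: "prime p" and p_in_I: "of_nat p \<in> I"
begin

lemma p_gt_1: "p > 1" and p_gt_0 [simp]: "p > 0"
  using prime_p prime_gt_1_nat prime_gt_0_nat by auto

lemma of_nat_dvd_I: "p dvd k \<Longrightarrow> of_nat k \<in> I"
  by (elim dvdE) (auto intro: I_mult_right p_in_I)

lemma of_nat_cong_I:
  assumes "[a = b] (mod p)"
  shows "of_nat a - (of_nat b :: 'a) \<in> I"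
proof -
  have *: "of_nat a - (of_nat b :: 'a) \<in> I" if "[a = b] (mod p)" "b \<le> a" for a b
  proof -
    have "p dvd a - b"
      using that by (metis cong_altdef_nat cong_sym)
    then have "of_nat (a - b) \<in> I" by (rule of_nat_dvd_I)
    with that show ?thesis by (simp add: of_nat_diff)
  qed
  show ?thesis
    using *[of a b] *[of b a] assms by (metis I_diff_commute cong_sym nat_le_linear)
qed

lemma of_nat_inverse:
  assumes "\<not> p dvd k"
  obtains u where "u * of_nat k - 1 \<in> I"
proof -
  have "coprime k p"
    using prime_imp_coprime[OF prime_p assms] by (metis coprime_commute)
  then obtain x where "[k * x = 1] (mod p)"
    using cong_solve_coprime_nat by auto
  then have "of_nat (k * x) - of_nat 1 \<in> I"
    by (rule of_nat_cong_I)
  then show ?thesis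
    using that[of "of_nat x"] by (simp add: mult.commute)
qed

lemma of_nat_cancel:
  assumes "\<not> p dvd k" "of_nat k * a \<in> I"
  shows "a \<in> I"
proof -
  obtain u where u: "u * of_nat k - 1 \<in> I"
    using of_nat_inverse assms(1) by blast
  have "u * (of_nat k * a) - (u * of_nat k - 1) * a \<in> I"
    by (intro I_diff I_mult[OF assms(2)] I_mult_right u)
  then show ?thesis by (simp add: algebra_simps)
qed

lemma fermat_I: "of_nat j ^ p - (of_nat j :: 'a) \<in> I"
proof -
  have "[j ^ p = j] (mod p)"
  proof (cases "p dvd j")
    case True
    then have "p dvd j ^ p" by (simp add: dvd_power_same dvd_trans)
    with True show ?thesis by (metis cong_0_iff cong_sym cong_trans)
  next
    case False
    have "[j ^ (p - 1) * j = 1 * j] (mod p)"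
      by (intro cong_mult fermat_theorem prime_p False) auto
    then show ?thesis
      by (metis Suc_pred' mult_1 p_gt_0 power_Suc2)
  qed
  from of_nat_cong_I[OF this] show ?thesis by simp
qed

text \<open>Here \<^term>\<open>c i\<close> is the coefficient of $x^i y^{m-i}$ in a symmetric form of degree \<^term>\<open>m\<close>, and
  the first condition compares the coefficients of $x^i y^j z^{m-i-j}$ in the cocycle identity.\<close>

definition cocycle :: "nat \<Rightarrow> (nat \<Rightarrow> 'a) \<Rightarrow> bool" where
  "cocycle m c \<longleftrightarrow>
    (\<forall>i\<ge>1. \<forall>j\<ge>1. i + j < m \<longrightarrow>
      of_nat ((i + j) choose i) * c (i + j) - of_nat ((m - i) choose j) * c i \<in> I) \<and>
    (\<forall>i\<ge>1. i < m \<longrightarrow> c i - c (m - i) \<in> I)"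

text \<open>The instances (i, 1) and (1, i) of the cocycle identity share the term
  \<open>(i + 1) * c (i + 1)\<close>. For i = m - 1 no third variable is left, and symmetry gives
  the claim.\<close>

lemma cocycle_coeff:
  assumes "cocycle m c" "1 \<le> i" "i < m"
  shows "of_nat (m - i) * c i - of_nat ((m - 1) choose i) * c 1 \<in> I"
proof (cases "i + 1 < m")
  case True
  have R: "of_nat ((a + b) choose a) * c (a + b) - of_nat ((m - a) choose b) * c a \<in> I"
    if "1 \<le> a" "1 \<le> b" "a + b < m" for a b
    using assms(1) that unfolding cocycle_def by blast
  have "of_nat (i + 1) * c (i + 1) - of_nat (m - i) * c i \<in> I"
    using R[of i 1] assms True by simp
  moreover have "of_nat (i + 1) * c (i + 1) - of_nat ((m - 1) choose i) * c 1 \<in> I"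
    using R[of 1 i] assms True by simp
  ultimately show ?thesis
    by (metis I_diff_trans I_diff_commute)
next
  case False
  then have m: "m = i + 1" using assms by simp
  then have "c i - c (m - i) \<in> I"
    using assms by (auto simp: cocycle_def)
  with m show ?thesis by simp
qed

text \<open>This is \<open>cocycle_coeff\<close> at m - i, moved back to i by symmetry.\<close>

lemma cocycle_coeff':
  assumes "cocycle m c" "1 \<le> i" "i < m"
  shows "of_nat i * c i - of_nat ((m - 1) choose (i - 1)) * c 1 \<in> I"
proof -
  have "of_nat (m - (m - i)) * c (m - i) - of_nat ((m - 1) choose (m - i)) * c 1 \<in> I"
    using assms by (intro cocycle_coeff) auto
  moreover have "(m - 1) choose (m - i) = (m - 1) choose (i - 1)"
    using assms binomial_symmetric[of "i - 1" "m - 1"] by auto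
  ultimately have "of_nat i * c (m - i) - of_nat ((m - 1) choose (i - 1)) * c 1 \<in> I"
    using assms by simp
  moreover have "of_nat i * (c i - c (m - i)) \<in> I"
    using assms by (intro I_mult) (auto simp: cocycle_def)
  ultimately have "of_nat i * (c i - c (m - i)) + (of_nat i * c (m - i) - of_nat ((m - 1) choose (i - 1)) * c 1) \<in> I"
    by (intro I_add)
  then show ?thesis
    by (simp add: right_diff_distrib)
qed

text \<open>The coefficient at \<^term>\<open>i = p\<close> in \<open>cocycle_coeff'\<close> forces \<^term>\<open>c 1\<close> to vanish, and
  then all \<^term>\<open>c i\<close> with \<^term>\<open>i\<close> prime to \<^term>\<open>p\<close>; the form is one in $x^p$ and $y^p$.\<close>

lemma cocycle_reduce:
  assumes c: "cocycle (p * m) c" and m: "m > 1"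
  shows "cocycle m (\<lambda>i. c (p * i))"
    and "\<And>i. 1 \<le> i \<Longrightarrow> i < p * m \<Longrightarrow> \<not> p dvd i \<Longrightarrow> c i \<in> I"
proof -
  have "of_nat p * c p - of_nat ((p * m - 1) choose (p - 1)) * c 1 \<in> I"
    using m p_gt_1 by (intro cocycle_coeff'[OF c]) auto
  moreover have "of_nat p * c p \<in> I"
    by (rule I_mult_right[OF p_in_I])
  ultimately have "of_nat ((p * m - 1) choose (p - 1)) * c 1 \<in> I"
    using I_diff_iff by blast
  moreover have "\<not> p dvd ((p * m - 1) choose (p - 1))"
    using m by (intro not_dvd_choose_pred prime_p) auto
  ultimately have c1: "c 1 \<in> I"
    using of_nat_cancel by metis
  show "c i \<in> I" if "1 \<le> i" "i < p * m" "\<not> p dvd i" for i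
  proof -
    have "of_nat i * c i - of_nat ((p * m - 1) choose (i - 1)) * c 1 \<in> I"
      using that by (intro cocycle_coeff'[OF c]) auto
    moreover have "of_nat ((p * m - 1) choose (i - 1)) * c 1 \<in> I"
      by (rule I_mult[OF c1])
    ultimately have "of_nat i * c i \<in> I"
      by (simp only: I_diff_iff)
    then show ?thesis
      using of_nat_cancel[OF that(3)] by blast
  qed
  show "cocycle m (\<lambda>i. c (p * i))"
    unfolding cocycle_def
  proof (intro conjI allI impI)
    fix i j :: nat assume ij: "1 \<le> i" "1 \<le> j" "i + j < m"
    have lt: "p * i + p * j < p * m"
      using ij p_gt_0 by (metis add_mult_distrib2 mult_less_cancel1)
    have "of_nat ((p * i + p * j) choose (p * i)) * c (p * i + p * j)
      - of_nat ((p * m - p * i) choose (p * j)) * c (p * i) \<in> I"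
      using c ij lt p_gt_0 unfolding cocycle_def by (auto simp: Suc_le_eq)
    then have 1: "of_nat ((p * (i + j)) choose (p * i)) * c (p * (i + j))
      - of_nat ((p * (m - i)) choose (p * j)) * c (p * i) \<in> I"
      by (simp only: distrib_left right_diff_distrib')
    have 2: "(of_nat ((p * (i + j)) choose (p * i)) - of_nat ((i + j) choose i)) * c (p * (i + j)) \<in> I"
      by (intro I_mult_right of_nat_cong_I choose_mult_prime_cong prime_p)
    have 3: "(of_nat ((p * (m - i)) choose (p * j)) - of_nat ((m - i) choose j)) * c (p * i) \<in> I"
      by (intro I_mult_right of_nat_cong_I choose_mult_prime_cong prime_p)
    note I_add[OF I_diff[OF 1 2] 3]
    then show "of_nat ((i + j) choose i) * c (p * (i + j)) - of_nat ((m - i) choose j) * c (p * i) \<in> I"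
      by (simp add: algebra_simps)
  next
    fix i assume "1 \<le> i" "i < m"
    then have "c (p * i) - c (p * m - p * i) \<in> I"
      using c by (auto simp: cocycle_def Suc_le_eq)
    then show "c (p * i) - c (p * (m - i)) \<in> I"
      by (simp add: right_diff_distrib')
  qed
qed

text \<open>For m prime to p, \<open>cocycle_coeff\<close> and \<open>cocycle_coeff'\<close> add up
  to m c_i = (m choose i) c_1 modulo I, so e is c_1 divided by m. Otherwise
  \<open>cocycle_reduce\<close> passes to m / p, and the same e works because
  \<open>choose_mult_prime_cong\<close> matches the binomial coefficients.\<close>

lemma cocycle_not_power:
  assumes "cocycle m c" "m > 0" "\<forall>k. m \<noteq> p ^ k"
  shows "\<exists>e. \<forall>i. 1 \<le> i \<and> i < m \<longrightarrow> c i - e * of_nat (m choose i) \<in> I"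
  using assms
proof (induction m arbitrary: c rule: less_induct)
  case (less m)
  show ?case
  proof (cases "p dvd m")
    case False
    then obtain u where u: "u * of_nat m - 1 \<in> I"
      using of_nat_inverse by blast
    have "c i - u * c 1 * of_nat (m choose i) \<in> I" if i: "1 \<le> i" "i < m" for i
    proof -
      have *: "m choose i = ((m - 1) choose i) + ((m - 1) choose (i - 1))"
        using i by (cases m; cases i) auto
      have "of_nat (m - i) * c i - of_nat ((m - 1) choose i) * c 1
        + (of_nat i * c i - of_nat ((m - 1) choose (i - 1)) * c 1) \<in> I"
        using i by (intro I_add cocycle_coeff cocycle_coeff' less)
      also have "of_nat (m - i) * c i - of_nat ((m - 1) choose i) * c 1
        + (of_nat i * c i - of_nat ((m - 1) choose (i - 1)) * c 1) =
        of_nat m * c i - of_nat (m choose i) * c 1"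
        using i unfolding * by (simp add: of_nat_diff algebra_simps)
      finally have *: "of_nat m * c i - of_nat (m choose i) * c 1 \<in> I" .
      have "u * (of_nat m * c i - of_nat (m choose i) * c 1) - (u * of_nat m - 1) * c i \<in> I"
        by (rule I_diff[OF I_mult[OF *] I_mult_right[OF u]])
      then show ?thesis by (simp add: algebra_simps)
    qed
    then show ?thesis by (intro exI[of _ "u * c 1"]) auto
  next
    case True
    then obtain m' where m: "m = p * m'" by auto
    have np: "\<forall>k. m' \<noteq> p ^ k"
      using less(4) m by (metis power_Suc)
    moreover have m': "m' < m" "m' > 0"
      using m less p_gt_1 by auto
    moreover have m'1: "m' > 1"
      using np[rule_format, of 0] m' by simp
    moreover have cc: "cocycle (p * m') c" using less m by simp
    ultimately obtain e where e: "\<And>i. 1 \<le> i \<Longrightarrow> i < m' \<Longrightarrow> c (p * i) - e * of_nat (m' choose i) \<in> I"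
      using less(1)[of m' "\<lambda>i. c (p * i)"] cocycle_reduce(1)[of m' c] by auto
    have "c i - e * of_nat (m choose i) \<in> I" if i: "1 \<le> i" "i < m" for i
    proof (cases "p dvd i")
      case False
      have "c i \<in> I" using cocycle_reduce(2)[OF cc m'1] i False m by auto
      moreover have "of_nat (m choose i) \<in> I"
        by (intro of_nat_dvd_I prime_dvd_choose_of_dvd prime_p True False)
      ultimately show ?thesis by (intro I_diff I_mult)
    next
      case True
      then obtain i' where i': "i = p * i'" by auto
      have "e * (of_nat (m' choose i') - of_nat (m choose i)) \<in> I"
        unfolding m i'
        by (intro I_mult of_nat_cong_I) (metis choose_mult_prime_cong prime_p cong_sym)
      moreover have "c (p * i') - e * of_nat (m' choose i') \<in> I"
        by (rule e) (use i i' m in auto)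
      ultimately show ?thesis
        unfolding i' by (metis I_diff_trans right_diff_distrib)
    qed
    then show ?thesis by blast
  qed
qed

text \<open>The coefficient of $T^m$ in the sum of the form over the points $(jT, T)$, $0 < j < p$. For the
  generator $((x+y)^p - x^p - y^p)/p$ the sum telescopes to $p^{p-1} - 1$, a unit modulo $p$.\<close>

definition cocycle_trace :: "nat \<Rightarrow> (nat \<Rightarrow> 'a) \<Rightarrow> 'a" where
  "cocycle_trace m c = (\<Sum>j = 1..<p. \<Sum>i = 1..<m. c i * of_nat j ^ i)"

lemma choose_trace: "(\<Sum>j = 1..<p. \<Sum>i = 1..<p. ((p choose i) div p) * j ^ i) = p ^ (p - 1) - 1"
proof -
  have inner: "p * (\<Sum>i = 1..<p. ((p choose i) div p) * j ^ i) + j ^ p + 1 = (j + 1) ^ p" for j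
  proof -
    have "(j + 1) ^ p = (\<Sum>i\<le>p. (p choose i) * j ^ i)"
      using binomial[of j 1 p] by simp
    also have "{..p} = insert 0 (insert p {1..<p})" by auto
    also have "(\<Sum>i\<in>insert 0 (insert p {1..<p}). (p choose i) * j ^ i) =
      1 + j ^ p + (\<Sum>i = 1..<p. (p choose i) * j ^ i)"
      using p_gt_0 by (simp del: p_gt_0)
    also have "(\<Sum>i = 1..<p. (p choose i) * j ^ i) = p * (\<Sum>i = 1..<p. ((p choose i) div p) * j ^ i)"
      unfolding sum_distrib_left
    proof (rule sum.cong)
      fix i assume "i \<in> {1..<p}"
      then have "p dvd (p choose i)"
        by (intro prime_dvd_choose_of_dvd prime_p) (auto dest: dvd_imp_le)
      then show "(p choose i) * j ^ i = p * ((p choose i) div p * j ^ i)"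
        by auto
    qed simp
    finally show ?thesis by simp
  qed
  \<comment> \<open>The upper limit is freed for the induction: the terms (j+1)^p - j^p - 1 with 0 <
    j < k sum to k^p - k.\<close>
  have "p * (\<Sum>j = 1..<k. \<Sum>i = 1..<p. ((p choose i) div p) * j ^ i) + k = k ^ p" if "k \<ge> 1" for k
    using that
  proof (induction k rule: dec_induct)
    case (step k)
    then have "p * (\<Sum>j = 1..<Suc k. \<Sum>i = 1..<p. ((p choose i) div p) * j ^ i) + Suc k =
      k ^ p + p * (\<Sum>i = 1..<p. ((p choose i) div p) * k ^ i) + 1"
      by (simp add: algebra_simps)
    then show ?case using inner[of k] by simp
  qed simp
  from this[of p] have "p * (\<Sum>j = 1..<p. \<Sum>i = 1..<p. ((p choose i) div p) * j ^ i) + p = p ^ p"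
    using p_gt_1 by simp
  also have "p ^ p = p * p ^ (p - 1)"
    using p_gt_1 by (cases p) auto
  finally have "p * ((\<Sum>j = 1..<p. \<Sum>i = 1..<p. ((p choose i) div p) * j ^ i) + 1) = p * p ^ (p - 1)"
    by simp
  then have "(\<Sum>j = 1..<p. \<Sum>i = 1..<p. ((p choose i) div p) * j ^ i) + 1 = p ^ (p - 1)"
    using p_gt_1 by (simp only: mult_left_cancel)
  then show ?thesis by simp
qed

text \<open>For m = p the cocycle is determined by c_1, and its trace is c_1 times the unit of
  \<open>choose_trace\<close>. For a higher power \<open>cocycle_reduce\<close> passes to m / p, and
  the trace stays the same because j^p and j agree modulo p.\<close>

lemma cocycle_power:
  assumes "cocycle (p ^ Suc k) c"
  shows "cocycle_trace (p ^ Suc k) c \<in> I \<Longrightarrow> 1 \<le> i \<Longrightarrow> i < p ^ Suc k \<Longrightarrow> c i \<in> I"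
  using assms
proof (induction k arbitrary: c i)
  case 0
  \<comment> \<open>Multiplied by i, the integer \<open>(p choose i) div p\<close> is the binomial
    coefficient of \<open>cocycle_coeff'\<close>; since i < p, the factor i cancels modulo
    I.\<close>
  have eq: "c i - c 1 * of_nat ((p choose i) div p) \<in> I" if i: "1 \<le> i" "i < p" for i
  proof -
    have "p dvd (p choose i)"
      using i by (intro prime_dvd_choose_of_dvd prime_p) (auto dest: dvd_imp_le)
    moreover have "i * (p choose i) = p * ((p - 1) choose (i - 1))"
      using Suc_times_binomial_eq[of "p - 1" "i - 1"] i by (simp add: mult.commute)
    ultimately have "i * ((p choose i) div p) = (p - 1) choose (i - 1)"
      by (metis div_mult_swap nonzero_mult_div_cancel_left p_gt_0 neq0_conv)
    moreover have "of_nat i * c i - of_nat ((p - 1) choose (i - 1)) * c 1 \<in> I"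
      using 0 i by (intro cocycle_coeff') auto
    ultimately have "of_nat i * c i - of_nat (i * ((p choose i) div p)) * c 1 \<in> I"
      by simp
    then have "of_nat i * (c i - c 1 * of_nat ((p choose i) div p)) \<in> I"
      by (simp add: algebra_simps)
    then show ?thesis
      using i of_nat_cancel[of i] by (metis dvd_imp_le leD less_le_trans zero_less_one)
  qed
  have "cocycle_trace p c - c 1 * of_nat (\<Sum>j = 1..<p. \<Sum>i = 1..<p. ((p choose i) div p) * j ^ i)
     = (\<Sum>j = 1..<p. \<Sum>i = 1..<p. (c i - c 1 * of_nat ((p choose i) div p)) * of_nat j ^ i)"
    by (simp add: cocycle_trace_def sum_distrib_left sum_subtractf left_diff_distrib mult.assoc)
  also have "\<dots> \<in> I"
    by (intro I_sum I_mult_right eq) auto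
  finally have "c 1 * of_nat (p ^ (p - 1) - 1) \<in> I"
    using 0 unfolding choose_trace by (metis I_diff_iff power_Suc0_right One_nat_def)
  moreover have "\<not> p dvd p ^ (p - 1) - 1"
  proof
    assume *: "p dvd p ^ (p - 1) - 1"
    have "p dvd p ^ (p - 1)" using p_gt_1 by (intro dvd_power) auto
    moreover have "p ^ (p - 1) \<ge> 1" using p_gt_0 by (simp add: Suc_le_eq del: p_gt_0)
    ultimately have "p dvd 1" using * by (metis dvd_diffD1)
    then show False using p_gt_1 by simp
  qed
  ultimately have "c 1 \<in> I"
    using of_nat_cancel by (metis mult.commute)
  with eq[of i] 0 show ?case
    using I_diff_iff I_mult_right by (metis power_Suc0_right)
next
  case (Suc k)
  let ?m = "p ^ Suc k"
  have m: "p ^ Suc (Suc k) = p * ?m" "?m > 1"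
    using one_less_power[OF p_gt_1, of "Suc k"] by simp_all
  have cc: "cocycle (p * ?m) c" using Suc m by simp
  note red = cocycle_reduce[OF cc m(2)]
  \<comment> \<open>Indices prime to p contribute elements of I; at an index p i Fermat's theorem
    replaces j^(p i) by j^i.\<close>
  have "cocycle_trace (p * ?m) c - cocycle_trace ?m (\<lambda>i. c (p * i)) \<in> I"
  proof -
    have "(\<Sum>i = 1..<p * ?m. c i * of_nat j ^ i) - (\<Sum>i = 1..<?m. c (p * i) * of_nat j ^ i) \<in> I" for j
    proof -
      have "(\<Sum>i\<in>(\<lambda>i. p * i) ` {1..<?m}. c i * of_nat j ^ i) = (\<Sum>i = 1..<?m. c (p * i) * of_nat j ^ (p * i))"
        by (subst sum.reindex) (auto simp: inj_on_def)
      moreover have "(\<Sum>i = 1..<p * ?m. c i * of_nat j ^ i) =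
        (\<Sum>i\<in>{1..<p * ?m} - (\<lambda>i. p * i) ` {1..<?m}. c i * of_nat j ^ i)
        + (\<Sum>i\<in>(\<lambda>i. p * i) ` {1..<?m}. c i * of_nat j ^ i)"
        by (rule sum.subset_diff) (auto simp: Suc_le_eq)
      ultimately have "(\<Sum>i = 1..<p * ?m. c i * of_nat j ^ i) - (\<Sum>i = 1..<?m. c (p * i) * of_nat j ^ i) =
        (\<Sum>i\<in>{1..<p * ?m} - (\<lambda>i. p * i) ` {1..<?m}. c i * of_nat j ^ i)
        + (\<Sum>i = 1..<?m. c (p * i) * ((of_nat j ^ p) ^ i - of_nat j ^ i))"
        by (simp add: sum_subtractf right_diff_distrib power_mult)
      also have "\<dots> \<in> I"
      proof (rule I_add; rule I_sum)
        fix i assume i: "i \<in> {1..<p * ?m} - (\<lambda>i. p * i) ` {1..<?m}"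
        then have "\<not> p dvd i" by (auto elim!: dvdE simp del: power_Suc)
        with i have "c i \<in> I" by (intro red) auto
        then show "c i * of_nat j ^ i \<in> I" by (rule I_mult_right)
      next
        fix i
        have "(of_nat j ^ p) ^ i - (of_nat j :: 'a) ^ i \<in> I"
        proof (induction i)
          case (Suc i)
          have "(of_nat j ^ p) ^ Suc i - (of_nat j :: 'a) ^ Suc i =
            (of_nat j ^ p - of_nat j) * (of_nat j ^ p) ^ i + of_nat j * ((of_nat j ^ p) ^ i - of_nat j ^ i)"
            by (simp add: algebra_simps)
          also have "\<dots> \<in> I" by (rule I_add[OF I_mult_right[OF fermat_I] I_mult[OF Suc]])
          finally show ?case .
        qed simp
        then show "c (p * i) * ((of_nat j ^ p) ^ i - of_nat j ^ i) \<in> I" by (rule I_mult)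
      qed
      finally show ?thesis .
    qed
    then show ?thesis
      unfolding cocycle_trace_def sum_subtractf[symmetric] by (intro I_sum)
  qed
  then have tr: "cocycle_trace ?m (\<lambda>i. c (p * i)) \<in> I"
    using Suc(2) I_diff_iff m(1) by metis
  show ?case
  proof (cases "p dvd i")
    case False
    with Suc m show ?thesis by (intro red) auto
  next
    case True
    then obtain i' where i': "i = p * i'" by auto
    then have "1 \<le> i'" "i' < ?m"
      using Suc(3,4) m by (auto simp: Suc_le_eq simp del: power_Suc)
    with Suc(1)[OF tr _ _ red(1)] i' show ?thesis by simp
  qed
qed

end

section \<open>Formal group laws modulo an ideal\<close>

lemma UNIV_type_1: "UNIV = {1 :: 1}"
  by auto

lemma UNIV_type_2: "UNIV = {0, 1 :: 2}"
proof -
  have "card {0, 1 :: 2} = card (UNIV :: 2 set)" by simp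
  then show ?thesis by (metis card_subset_eq finite subset_UNIV)
qed

lemma type_3_distinct: "(1 :: 3) \<noteq> 0" "(2 :: 3) \<noteq> 0" "(2 :: 3) \<noteq> 1"
  by auto

lemma UNIV_type_3: "UNIV = {0, 1, 2 :: 3}"
proof -
  have "card {0, 1, 2 :: 3} = card (UNIV :: 3 set)" using type_3_distinct by simp
  then show ?thesis by (metis card_subset_eq finite subset_UNIV)
qed

abbreviation triple :: "'c \<Rightarrow> 'c \<Rightarrow> 'c \<Rightarrow> 3 \<Rightarrow> 'c" where
  "triple x y z \<equiv> (\<lambda>v. if v = 0 then x else if v = 1 then y else z)"

abbreviation T :: "(1, 'a::comm_ring_1) mps" where "T \<equiv> X 1"
abbreviation x\<^sub>1 :: "(2, 'a::comm_ring_1) mps" where "x\<^sub>1 \<equiv> X 0"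
abbreviation x\<^sub>2 :: "(2, 'a::comm_ring_1) mps" where "x\<^sub>2 \<equiv> X 1"

lemma exponent_1: "(\<beta> :: 1 \<Rightarrow> nat) = (\<lambda>_. \<beta> 1)"
  by (auto simp: fun_eq_iff)

lemma exponent_1_eq_iff: "(\<beta> :: 1 \<Rightarrow> nat) = (\<lambda>_. k) \<longleftrightarrow> \<beta> 1 = k"
  by (auto simp: fun_eq_iff)

lemma deg_exponent_1: "deg (\<beta> :: 1 \<Rightarrow> nat) = \<beta> 1"
  by (simp add: deg_def UNIV_type_1)

lemma uvec_1: "uvec (v :: 1) = (\<lambda>_. 1)"
  by (auto simp: uvec_def fun_eq_iff)

lemma exponent_2_eq_iff: "(\<beta> :: 2 \<Rightarrow> nat) = pair a b \<longleftrightarrow> \<beta> 0 = a \<and> \<beta> 1 = b"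
proof -
  have "(\<forall>v. P v) \<longleftrightarrow> P 0 \<and> P 1" for P :: "2 \<Rightarrow> bool"
    using UNIV_type_2 by (metis UNIV_I insertE singletonD)
  then show ?thesis by (simp add: fun_eq_iff)
qed

lemma deg_exponent_2: "deg (\<beta> :: 2 \<Rightarrow> nat) = \<beta> 0 + \<beta> 1"
  by (simp add: deg_def UNIV_type_2)

lemma exponent_3_eq_iff: "(\<beta> :: 3 \<Rightarrow> nat) = triple a b c \<longleftrightarrow> \<beta> 0 = a \<and> \<beta> 1 = b \<and> \<beta> 2 = c"
proof -
  have "(\<forall>v. P v) \<longleftrightarrow> P 0 \<and> P 1 \<and> P 2" for P :: "3 \<Rightarrow> bool"
    using UNIV_type_3 by (metis UNIV_I insertE singletonD)
  then show ?thesis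
    unfolding fun_eq_iff by (simp only: type_3_distinct if_True if_False refl)
qed

lemma deg_exponent_3: "deg (\<beta> :: 3 \<Rightarrow> nat) = \<beta> 0 + \<beta> 1 + \<beta> 2"
  unfolding deg_def UNIV_type_3 by (simp add: type_3_distinct add_ac)

lemma mpow_1: "mpow g (\<beta> :: 1 \<Rightarrow> nat) = g 1 ^ \<beta> 1"
  by (simp add: mpow_def UNIV_type_1)

lemma mpow_2: "mpow g (\<beta> :: 2 \<Rightarrow> nat) = g 0 ^ \<beta> 0 * g 1 ^ \<beta> 1"
  by (simp add: mpow_def UNIV_type_2)

lemma T_power: "T ^ k = monom (\<lambda>_. k) 1"
  by (simp add: monom_power uvec_1)

abbreviation uni :: "('w::finite, 'a::comm_ring_1) mps \<Rightarrow> 1 \<Rightarrow> ('w, 'a) mps" where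
  "uni s \<equiv> (\<lambda>_. s)"

lemma msubst_at_0: "no_const f \<Longrightarrow> msubst f (uni 0) = 0"
proof (rule mps_eqI)
  fix \<alpha> :: "'b \<Rightarrow> nat" assume "no_const f"
  then have "cf f \<beta> * cf (mpow (uni 0) \<beta>) \<alpha> = 0" for \<beta>
    using exponent_1_eq_iff[of \<beta> 0] by (cases "\<beta> 1 = 0") (auto simp: mpow_1 power_0_left)
  then show "cf (msubst f (uni 0)) \<alpha> = cf 0 \<alpha>"
    by (simp add: cf_msubst)
qed

lemma cf_msubst_linear:
  fixes f g :: "(1, 'a::comm_ring_1) mps"
  assumes "no_const f" "no_const g"
  shows "cf (msubst f (uni g)) (\<lambda>_. 1) = cf f (\<lambda>_. 1) * cf g (\<lambda>_. 1)"
proof -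
  have "{\<beta> :: 1 \<Rightarrow> nat. deg \<beta> \<le> 1} = {zv, \<lambda>_. 1}"
    by (auto simp: deg_exponent_1 exponent_1_eq_iff)
  moreover have "zv \<noteq> (\<lambda>_ :: 1. 1 :: nat)" by (simp add: fun_eq_iff)
  ultimately show ?thesis
    using assms by (subst cf_msubst_le[of _ _ 1]) (auto simp: deg_exponent_1 mpow_1)
qed

lemma cf_msubst_scale:
  fixes f :: "(1, 'a::comm_ring_1) mps"
  assumes "q > 0"
  shows "cf (msubst f (uni (T ^ q))) (\<lambda>_. k) = (if q dvd k then cf f (\<lambda>_. k div q) else 0)"
proof -
  have "cf (msubst f (uni (T ^ q))) (\<lambda>_. k) =
    (\<Sum>\<beta> :: 1 \<Rightarrow> nat | deg \<beta> \<le> deg (\<lambda>_ :: 1. k). if \<beta> = (\<lambda>_. k div q) then (if q dvd k then cf f (\<lambda>_. k div q) else 0) else 0)"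
    unfolding cf_msubst
  proof (rule sum.cong)
    fix \<beta> :: "1 \<Rightarrow> nat"
    have "(k = q * \<beta> 1) = (\<beta> 1 = k div q \<and> q dvd k)"
      using assms by auto
    moreover have "\<beta> = (\<lambda>_. k div q)" if "\<beta> 1 = k div q"
      using that exponent_1_eq_iff by blast
    moreover have "mpow (uni (T ^ q)) \<beta> = (monom (\<lambda>_. q * \<beta> 1) 1 :: (1, 'a) mps)"
      by (simp only: mpow_1 T_power) (simp add: monom_power mult.commute)
    ultimately show "cf f \<beta> * cf (mpow (uni (T ^ q)) \<beta>) (\<lambda>_. k) =
      (if \<beta> = (\<lambda>_. k div q) then (if q dvd k then cf f (\<lambda>_. k div q) else 0) else 0)"
      using assms by (auto simp: cf_monom fun_eq_iff intro!: arg_cong[of _ _ "cf f"])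
  qed simp
  then show ?thesis
    by (simp only: sum.delta[OF finite_deg_le]) (simp add: deg_exponent_1)
qed

lemma cf_msubst_swap:
  "cf (msubst s (pair x\<^sub>2 x\<^sub>1)) (pair a b) = cf s (pair b a)"
proof -
  have "cf (msubst s (pair x\<^sub>2 x\<^sub>1)) (pair a b) =
    (\<Sum>\<beta> | deg \<beta> \<le> deg (pair a b). if \<beta> = pair b a then cf s (pair b a) else 0)"
    unfolding cf_msubst
  proof (rule sum.cong)
    fix \<beta> :: "2 \<Rightarrow> nat"
    have "pair a b = (\<lambda>v. \<beta> 0 * uvec 1 v) + (\<lambda>v. \<beta> 1 * uvec 0 v) \<longleftrightarrow> \<beta> = pair b a"
      by (simp add: exponent_2_eq_iff eq_commute[of "pair a b"]) (auto simp: uvec_def)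
    then show "cf s \<beta> * cf (mpow (pair x\<^sub>2 x\<^sub>1) \<beta>) (pair a b) =
      (if \<beta> = pair b a then cf s (pair b a) else 0)"
      by (auto simp: mpow_2 monom_power monom_mult cf_monom)
  qed simp
  then show ?thesis
    by (simp only: sum.delta[OF finite_deg_le]) (simp add: deg_exponent_2)
qed

lemma cf_msubst_left_axis:
  fixes s :: "(2, 'a::comm_ring_1) mps"
  shows "cf (msubst s (pair T 0)) (\<lambda>_. k) = cf s (pair k 0)"
proof -
  have "cf (msubst s (pair T 0)) (\<lambda>_. k) =
    (\<Sum>\<beta> | deg \<beta> \<le> deg (\<lambda>_ :: 1. k). if \<beta> = pair k 0 then cf s (pair k 0) else 0)"
    unfolding cf_msubst
  proof (rule sum.cong)
    fix \<beta> :: "2 \<Rightarrow> nat"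
    have "cf (mpow (pair T (0 :: (1, 'a) mps)) \<beta>) (\<lambda>_. k) = (if \<beta> = pair k 0 then 1 else 0)"
      by (auto simp: mpow_2 T_power cf_monom exponent_2_eq_iff power_0_left fun_eq_iff)
    then show "cf s \<beta> * cf (mpow (pair T 0) \<beta>) (\<lambda>_. k) =
      (if \<beta> = pair k 0 then cf s (pair k 0) else 0)"
      by auto
  qed simp
  then show ?thesis
    by (simp only: sum.delta[OF finite_deg_le]) (simp add: deg_exponent_2 deg_exponent_1)
qed

lemma binomial_monom:
  fixes v w :: "'v::finite"
  shows "(X v + X w) ^ n =
    (\<Sum>t\<le>n. monom ((\<lambda>u. t * uvec v u) + (\<lambda>u. (n - t) * uvec w u)) (of_nat (n choose t) :: 'a::comm_ring_1))"
  unfolding binomial_ring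
proof (rule sum.cong)
  fix t
  have "of_nat (n choose t) = (const (of_nat (n choose t)) :: ('v, 'a) mps)"
    by (rule of_nat_mps)
  then show "of_nat (n choose t) * X v ^ t * X w ^ (n - t) =
    monom ((\<lambda>u. t * uvec v u) + (\<lambda>u. (n - t) * uvec w u)) (of_nat (n choose t) :: 'a)"
    by (simp add: monom_power monom_mult)
qed simp

lemma cf_binomial_2:
  "cf ((x\<^sub>1 + x\<^sub>2) ^ n) (pair a b) = (if a + b = n then of_nat (n choose a) else 0)"
proof -
  have "pair a b = (\<lambda>u. t * uvec 0 u) + (\<lambda>u. (n - t) * uvec 1 u) \<longleftrightarrow> a = t \<and> b = n - t" for t
    by (simp add: eq_commute[of "pair a b"] exponent_2_eq_iff) (auto simp: uvec_def)
  then have "cf ((x\<^sub>1 + x\<^sub>2) ^ n) (pair a b) = (\<Sum>t\<le>n. if t = a then (if b = n - a then of_nat (n choose a) else 0) else 0)"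
    unfolding binomial_monom cf_sum cf_monom by (intro sum.cong) auto
  then show ?thesis
    by (auto simp: sum.delta)
qed

text \<open>Together with \<open>cf_msubst_add_right\<close> this is the source of the two binomial
  coefficients in \<open>cocycle\<close>.\<close>

lemma cf_msubst_add_left:
  fixes s :: "(2, 'a::comm_ring_1) mps"
  shows "cf (msubst s (pair (X (0 :: 3) + X 1) (X 2))) (triple i j k) =
    of_nat ((i + j) choose i) * cf s (pair (i + j) k)"
proof -
  have "cf (msubst s (pair (X (0 :: 3) + X 1) (X 2))) (triple i j k) =
    (\<Sum>\<beta> | deg \<beta> \<le> deg (triple i j k).
      if \<beta> = pair (i + j) k then of_nat ((i + j) choose i) * cf s (pair (i + j) k) else 0)"
    unfolding cf_msubst
  proof (rule sum.cong)
    fix \<beta> :: "2 \<Rightarrow> nat"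
    have *: "triple i j k = (\<lambda>u. t * uvec 0 u) + (\<lambda>u. (\<beta> 0 - t) * uvec 1 u) + (\<lambda>u. \<beta> 1 * uvec 2 u) \<longleftrightarrow>
      i = t \<and> j = \<beta> 0 - t \<and> k = \<beta> 1" for t
      using type_3_distinct by (simp add: eq_commute[of "triple i j k"] exponent_3_eq_iff) (auto simp: uvec_def)
    have "cf (mpow (pair (X (0 :: 3) + X 1) (X 2)) \<beta>) (triple i j k) =
      (\<Sum>t\<le>\<beta> 0. cf (monom ((\<lambda>u. t * uvec 0 u) + (\<lambda>u. (\<beta> 0 - t) * uvec 1 u) + (\<lambda>u. \<beta> 1 * uvec 2 u))
        (of_nat (\<beta> 0 choose t) :: 'a)) (triple i j k))"
      by (simp add: mpow_2 binomial_monom sum_distrib_right monom_power monom_mult)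
    also have "\<dots> = (\<Sum>t\<le>\<beta> 0. if t = i then (if j = \<beta> 0 - i \<and> k = \<beta> 1 then of_nat (\<beta> 0 choose i) else 0) else 0)"
      unfolding cf_monom * by (intro sum.cong) auto
    also have "\<dots> = (if \<beta> = pair (i + j) k then of_nat ((i + j) choose i) else 0)"
      by (auto simp: sum.delta exponent_2_eq_iff)
    finally show "cf s \<beta> * cf (mpow (pair (X (0 :: 3) + X 1) (X 2)) \<beta>) (triple i j k) =
      (if \<beta> = pair (i + j) k then of_nat ((i + j) choose i) * cf s (pair (i + j) k) else 0)"
      by auto
  qed simp
  then show ?thesis
    using type_3_distinct
    by (simp only: sum.delta[OF finite_deg_le]) (simp add: deg_exponent_2 deg_exponent_3)
qed

lemma cf_msubst_add_right:
  fixes s :: "(2, 'a::comm_ring_1) mps"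
  shows "cf (msubst s (pair (X (0 :: 3)) (X 1 + X 2))) (triple i j k) =
    of_nat ((j + k) choose j) * cf s (pair i (j + k))"
proof -
  have "cf (msubst s (pair (X (0 :: 3)) (X 1 + X 2))) (triple i j k) =
    (\<Sum>\<beta> | deg \<beta> \<le> deg (triple i j k).
      if \<beta> = pair i (j + k) then of_nat ((j + k) choose j) * cf s (pair i (j + k)) else 0)"
    unfolding cf_msubst
  proof (rule sum.cong)
    fix \<beta> :: "2 \<Rightarrow> nat"
    have *: "triple i j k = (\<lambda>u. \<beta> 0 * uvec 0 u) + ((\<lambda>u. t * uvec 1 u) + (\<lambda>u. (\<beta> 1 - t) * uvec 2 u)) \<longleftrightarrow>
      i = \<beta> 0 \<and> j = t \<and> k = \<beta> 1 - t" for t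
      using type_3_distinct by (simp add: eq_commute[of "triple i j k"] exponent_3_eq_iff) (auto simp: uvec_def)
    have "cf (mpow (pair (X (0 :: 3)) (X 1 + X 2)) \<beta>) (triple i j k) =
      (\<Sum>t\<le>\<beta> 1. cf (monom ((\<lambda>u. \<beta> 0 * uvec 0 u) + ((\<lambda>u. t * uvec 1 u) + (\<lambda>u. (\<beta> 1 - t) * uvec 2 u)))
        (of_nat (\<beta> 1 choose t) :: 'a)) (triple i j k))"
      by (simp add: mpow_2 binomial_monom sum_distrib_left monom_power monom_mult)
    also have "\<dots> = (\<Sum>t\<le>\<beta> 1. if t = j then (if i = \<beta> 0 \<and> k = \<beta> 1 - j then of_nat (\<beta> 1 choose j) else 0) else 0)"
      unfolding cf_monom * by (intro sum.cong) auto
    also have "\<dots> = (if \<beta> = pair i (j + k) then of_nat ((j + k) choose j) else 0)"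
      by (auto simp: sum.delta exponent_2_eq_iff)
    finally show "cf s \<beta> * cf (mpow (pair (X (0 :: 3)) (X 1 + X 2)) \<beta>) (triple i j k) =
      (if \<beta> = pair i (j + k) then of_nat ((j + k) choose j) * cf s (pair i (j + k)) else 0)"
      by auto
  qed simp
  then show ?thesis
    using type_3_distinct
    by (simp only: sum.delta[OF finite_deg_le]) (simp add: deg_exponent_2 deg_exponent_3)
qed

text \<open>Disposes of the two terms of the cocycle identity that omit a variable.\<close>

lemma cf_msubst_two_of_three:
  fixes s :: "(2, 'a::comm_ring_1) mps"
  shows "k \<ge> 1 \<Longrightarrow> cf (msubst s (pair (X (0 :: 3)) (X 1))) (triple i j k) = 0"
    and "i \<ge> 1 \<Longrightarrow> cf (msubst s (pair (X (1 :: 3)) (X 2))) (triple i j k) = 0"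
proof -
  have "triple i j k \<noteq> (\<lambda>u. a * uvec 0 u) + (\<lambda>u. b * uvec 1 u)" if "k \<ge> 1" for a b
    using that type_3_distinct by (auto simp: fun_eq_iff uvec_def intro!: exI[of _ 2])
  then show "cf (msubst s (pair (X (0 :: 3)) (X 1))) (triple i j k) = 0" if "k \<ge> 1"
    using that by (auto simp: cf_msubst mpow_2 monom_power monom_mult cf_monom intro!: sum.neutral)
  have "triple i j k \<noteq> (\<lambda>u. a * uvec 1 u) + (\<lambda>u. b * uvec 2 u)" if "i \<ge> 1" for a b
    using that type_3_distinct by (auto simp: fun_eq_iff uvec_def intro!: exI[of _ 0])
  then show "cf (msubst s (pair (X (1 :: 3)) (X 2))) (triple i j k) = 0" if "i \<ge> 1"
    using that by (auto simp: cf_msubst mpow_2 monom_power monom_mult cf_monom intro!: sum.neutral)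
qed

text \<open>Restriction to the point (jT, T). Summed over j it becomes \<open>cocycle_trace\<close>,
  apart from the end terms i = 0 and i = m.\<close>

lemma cf_msubst_diagonal:
  fixes s :: "(2, 'a::comm_ring_1) mps"
  shows "cf (msubst s (pair (of_nat j * T) T)) (\<lambda>_. m) = (\<Sum>i\<le>m. cf s (pair i (m - i)) * of_nat j ^ i)"
proof -
  have *: "cf (mpow (pair (of_nat j * T) T) \<beta>) (\<lambda>_. m) = (if deg \<beta> = m then of_nat j ^ \<beta> 0 else 0)" for \<beta> :: "2 \<Rightarrow> nat"
    by (auto simp: mpow_2 of_nat_mps monom_mult monom_power cf_monom deg_exponent_2 uvec_1 fun_eq_iff)
  have "cf (msubst s (pair (of_nat j * T) T)) (\<lambda>_. m) =
    (\<Sum>\<beta> | deg \<beta> \<le> m. if deg \<beta> = m then cf s \<beta> * of_nat j ^ \<beta> 0 else 0)"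
    unfolding cf_msubst * by (rule sum.cong) (auto simp: deg_exponent_1)
  also have "\<dots> = (\<Sum>\<beta> | deg \<beta> = m. cf s \<beta> * of_nat j ^ \<beta> 0)"
    by (rule sum.mono_neutral_cong_right) auto
  also have "\<dots> = (\<Sum>i\<le>m. cf s (pair i (m - i)) * of_nat j ^ i)"
  proof (rule sum.reindex_bij_witness[of _ "\<lambda>i. pair i (m - i)" "\<lambda>\<beta>. \<beta> 0"])
    fix \<beta> :: "2 \<Rightarrow> nat" assume "\<beta> \<in> {\<beta>. deg \<beta> = m}"
    then have "\<beta> = pair (\<beta> 0) (m - \<beta> 0)"
      by (subst exponent_2_eq_iff) (auto simp: deg_exponent_2)
    then show "pair (\<beta> 0) (m - \<beta> 0) = \<beta>" "cf s (pair (\<beta> 0) (m - \<beta> 0)) * of_nat j ^ \<beta> 0 = cf s \<beta> * of_nat j ^ \<beta> 0"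
      by metis+
  qed (auto simp: deg_exponent_2)
  finally show ?thesis .
qed

context modulus
begin

lemma J_1_iff: "s \<in> J m \<longleftrightarrow> (\<forall>k<m. cf s (\<lambda>_ :: 1. k) \<in> I)"
proof
  assume *: "\<forall>k<m. cf s (\<lambda>_ :: 1. k) \<in> I"
  show "s \<in> J m"
  proof (rule JI)
    fix \<beta> :: "1 \<Rightarrow> nat" assume "deg \<beta> < m"
    then show "cf s \<beta> \<in> I"
      using * exponent_1[of \<beta>] by (metis deg_exponent_1)
  qed
qed (auto dest: JD simp: deg_exponent_1)

lemma J_2_SucI:
  fixes s :: "(2, 'a) mps"
  assumes "s \<in> J m" "\<And>i. i \<le> m \<Longrightarrow> cf s (pair i (m - i)) \<in> I"
  shows "s \<in> J (m + 1)"
proof (rule JI)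
  fix \<beta> :: "2 \<Rightarrow> nat" assume "deg \<beta> < m + 1"
  then consider "deg \<beta> < m" | "deg \<beta> = m" by linarith
  then show "cf s \<beta> \<in> I"
  proof cases
    case 2
    then have "\<beta> = pair (\<beta> 0) (m - \<beta> 0)"
      by (subst exponent_2_eq_iff) (auto simp: deg_exponent_2)
    with 2 assms(2)[of "\<beta> 0"] show ?thesis
      by (simp add: deg_exponent_2)
  qed (use assms in \<open>auto dest: JD\<close>)
qed

end

section \<open>The Frobenius modulo I\<close>

context charp_modulus
begin

text \<open>The middle binomial coefficients are constants in I, so the congruence holds to every
  order m.\<close>

lemma frobenius_add: "(s + t) ^ (p ^ e) - (s ^ (p ^ e) + t ^ (p ^ e)) \<in> J m"
proof (induction e)
  case (Suc e)
  let ?u = "s ^ (p ^ e)" and ?v = "t ^ (p ^ e)"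
  have "((s + t) ^ (p ^ e)) ^ p - (?u + ?v) ^ p \<in> J m"
    by (intro J_diff_power Suc)
  moreover have "(?u + ?v) ^ p - (?u ^ p + ?v ^ p) \<in> J m"
  proof -
    have "(?u + ?v) ^ p = (\<Sum>k\<in>insert 0 (insert p {1..<p}). of_nat (p choose k) * ?u ^ k * ?v ^ (p - k))"
      unfolding binomial_ring by (rule sum.cong) auto
    also have "\<dots> = ?u ^ p + ?v ^ p + (\<Sum>k\<in>{1..<p}. of_nat (p choose k) * ?u ^ k * ?v ^ (p - k))"
      using p_gt_1 by (simp add: add_ac)
    finally have "(?u + ?v) ^ p - (?u ^ p + ?v ^ p) = (\<Sum>k\<in>{1..<p}. of_nat (p choose k) * ?u ^ k * ?v ^ (p - k))"
      by simp
    also have "\<dots> \<in> J m"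
    proof (intro J_sum J_mult_right)
      fix k assume "k \<in> {1..<p}"
      then have "p dvd (p choose k)"
        by (intro prime_dvd_choose_of_dvd prime_p) (auto dest: dvd_imp_le)
      then show "of_nat (p choose k) \<in> J m"
        by (auto intro!: JI simp: of_nat_mps cf_monom of_nat_dvd_I)
    qed
    finally show ?thesis .
  qed
  ultimately show ?case
    using J_diff_trans by (simp add: mult.commute[of p] power_mult) blast
qed simp

lemma frobenius_sum: "(sum f A) ^ (p ^ e) - (\<Sum>x\<in>A. f x ^ (p ^ e)) \<in> J m"
proof (induction A rule: infinite_finite_induct)
  case (insert x A)
  have "(f x + sum f A) ^ (p ^ e) - (f x ^ (p ^ e) + sum f A ^ (p ^ e)) \<in> J m"
    by (rule frobenius_add)
  moreover have "(f x ^ (p ^ e) + sum f A ^ (p ^ e)) - (f x ^ (p ^ e) + (\<Sum>x\<in>A. f x ^ (p ^ e))) \<in> J m"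
    using insert by simp
  ultimately have "(f x + sum f A) ^ (p ^ e) - (f x ^ (p ^ e) + (\<Sum>x\<in>A. f x ^ (p ^ e))) \<in> J m"
    by (rule J_diff_trans)
  then show ?case
    using insert by simp
qed (use p_gt_1 in \<open>auto simp: power_0_left\<close>)

text \<open>Only the coefficients up to degree k matter, and on this finite sum of monomials the
  Frobenius is additive modulo I.\<close>

lemma cf_frobenius:
  fixes s :: "(1, 'a) mps"
  shows "cf (s ^ (p ^ e)) (\<lambda>_. k) - (if p ^ e dvd k then cf s (\<lambda>_. k div p ^ e) ^ (p ^ e) else 0) \<in> I"
proof -
  define t where "t = (\<Sum>j\<le>k. monom (\<lambda>_ :: 1. j) (cf s (\<lambda>_. j)))"
  have "s - t \<in> J (Suc k)"
  proof (subst J_1_iff, intro allI impI)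
    fix i assume "i < Suc k"
    then have "cf t (\<lambda>_. i) = cf s (\<lambda>_. i)"
      by (simp add: t_def cf_monom fun_eq_iff)
    then show "cf (s - t) (\<lambda>_. i) \<in> I" by simp
  qed
  then have "s ^ (p ^ e) - t ^ (p ^ e) \<in> J (Suc k)"
    by (rule J_diff_power)
  moreover have "t ^ (p ^ e) - (\<Sum>j\<le>k. monom (\<lambda>_ :: 1. j) (cf s (\<lambda>_. j)) ^ (p ^ e)) \<in> J (Suc k)"
    unfolding t_def by (rule frobenius_sum)
  ultimately have "s ^ (p ^ e) - (\<Sum>j\<le>k. monom (\<lambda>_ :: 1. j) (cf s (\<lambda>_. j)) ^ (p ^ e)) \<in> J (Suc k)"
    by (rule J_diff_trans)
  then have "cf (s ^ (p ^ e) - (\<Sum>j\<le>k. monom (\<lambda>_ :: 1. j) (cf s (\<lambda>_. j)) ^ (p ^ e))) (\<lambda>_. k) \<in> I"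
    by (rule JD) (simp add: deg_exponent_1)
  moreover have "cf (\<Sum>j\<le>k. monom (\<lambda>_ :: 1. j) (cf s (\<lambda>_. j)) ^ (p ^ e)) (\<lambda>_. k) =
    (if p ^ e dvd k then cf s (\<lambda>_. k div p ^ e) ^ (p ^ e) else 0)"
  proof -
    have pe: "p ^ e > 0" by simp
    then have "(k = p ^ e * j) = (j = k div p ^ e \<and> p ^ e dvd k)" for j
      by auto
    then have "cf (\<Sum>j\<le>k. monom (\<lambda>_ :: 1. j) (cf s (\<lambda>_. j)) ^ (p ^ e)) (\<lambda>_. k) =
      (\<Sum>j\<le>k. if j = k div p ^ e then (if p ^ e dvd k then cf s (\<lambda>_. k div p ^ e) ^ (p ^ e) else 0) else 0)"
      unfolding cf_sum by (intro sum.cong) (auto simp: monom_power cf_monom fun_eq_iff)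
    then show ?thesis
      by (simp add: sum.delta)
  qed
  ultimately show ?thesis by simp
qed

end

lemma (in modulus) no_const_J1': "no_const s \<Longrightarrow> s \<in> J (Suc 0)"
  using no_const_J1 by simp

lemma (in modulus) J_diff_diff: "s - s' \<in> J m \<Longrightarrow> t - t' \<in> J m \<Longrightarrow> (s - t) - (s' - t') \<in> J m"
  using J_diff[of "s - s'" m "t - t'"] by (simp add: algebra_simps)

lemma type_2_distinct [simp]: "(1 :: 2) \<noteq> 0"
  by auto

lemma no_const_mult_right [simp]: "no_const t \<Longrightarrow> no_const (s * t)"
  using no_const_mult[of t s] by (simp add: mult.commute)

lemma msubst_T [simp]: "msubst f (uni T) = f"
proof -
  have "uni T = (X :: 1 \<Rightarrow> (1, 'a) mps)"
    by (auto simp: fun_eq_iff)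
  then show ?thesis by simp
qed

text \<open>Pitfall: \<^term>\<open>multiple H k\<close> is the series $[k+1]_H$.\<close>

primrec multiple :: "(2, 'a::comm_ring_1) mps \<Rightarrow> nat \<Rightarrow> (1, 'a) mps" where
  "multiple H 0 = T"
| "multiple H (Suc k) = msubst H (pair (multiple H k) T)"

text \<open>The laws hold only modulo I, but to every order: an integral lift of a law over F_p need
  not satisfy them exactly. The constant term vanishes exactly, as the substitution lemmas
  require.\<close>

locale fgl_modulus = charp_modulus I p for I :: "'a::comm_ring_1 set" and p +
  fixes H :: "(2, 'a) mps" and h :: nat
  assumes no_const_H [simp]: "no_const H"
    and H_unit_right: "\<And>m. msubst H (pair T 0) - T \<in> J m"
    and H_unit_left: "\<And>m. msubst H (pair 0 T) - T \<in> J m"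
    and H_commute: "\<And>m. msubst H (pair x\<^sub>2 x\<^sub>1) - H \<in> J m"
    and H_assoc: "\<And>m. msubst H (pair (msubst H (pair (X (0 :: 3)) (X 1))) (X 2)) -
      msubst H (pair (X 0) (msubst H (pair (X 1) (X 2)))) \<in> J m"
    and H_mult_p: "\<And>m. multiple H (p - 1) - T ^ (p ^ h) \<in> J m"
    and h_pos: "h \<ge> 1"
begin

section \<open>Formal addition and the defect of a series\<close>

context
  notes if_weak_cong [cong del] no_const_J1' [simp]
begin

abbreviation fadd :: "('w::finite, 'a) mps \<Rightarrow> ('w, 'a) mps \<Rightarrow> ('w, 'a) mps" (infixl "\<boxplus>" 65) where
  "s \<boxplus> t \<equiv> msubst H (pair s t)"

lemma fadd_msubst:
  assumes "no_const s" "no_const t" "\<And>v. no_const (k v)"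
  shows "msubst (s \<boxplus> t) k = msubst s k \<boxplus> msubst t k"
proof -
  have "(\<lambda>v :: 2. msubst (pair s t v) k) = pair (msubst s k) (msubst t k)"
    by auto
  then show ?thesis
    using assms by (simp add: msubst_assoc)
qed

lemma fadd_cong:
  assumes "s - s' \<in> J m" "t - t' \<in> J m" "no_const s" "no_const s'" "no_const t" "no_const t'"
  shows "(s \<boxplus> t) - (s' \<boxplus> t') \<in> J m"
  using assms by (intro J_diff_msubst_right) (auto intro: no_const_J1)

lemma fadd_x: "x\<^sub>1 \<boxplus> x\<^sub>2 = H"
proof -
  have "pair x\<^sub>1 x\<^sub>2 = (X :: 2 \<Rightarrow> (2, 'a) mps)"
    using UNIV_type_2 by (auto simp: fun_eq_iff)
  then show ?thesis by simp
qed

lemma fadd_zero_right: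
  assumes "no_const s"
  shows "(s \<boxplus> 0) - s \<in> J m"
proof -
  have "msubst (T \<boxplus> 0) (uni s) - msubst T (uni s) \<in> J m"
    by (intro J_diff_msubst_left H_unit_right)
  then show ?thesis
    using assms by (simp add: fadd_msubst)
qed

lemma fadd_commute:
  assumes "no_const s" "no_const t"
  shows "(t \<boxplus> s) - (s \<boxplus> t) \<in> J m"
proof -
  have "msubst (x\<^sub>2 \<boxplus> x\<^sub>1) (pair s t) - msubst H (pair s t) \<in> J m"
    by (intro J_diff_msubst_left H_commute)
  moreover have "msubst (x\<^sub>2 \<boxplus> x\<^sub>1) (pair s t) = msubst x\<^sub>2 (pair s t) \<boxplus> msubst x\<^sub>1 (pair s t)"
    using assms by (intro fadd_msubst) auto
  moreover have "msubst x\<^sub>2 (pair s t) = t" "msubst x\<^sub>1 (pair s t) = s"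
    using assms by (subst msubst_X; simp)+
  ultimately show ?thesis by simp
qed

lemma fadd_assoc:
  assumes "no_const s" "no_const t" "no_const u"
  shows "((s \<boxplus> t) \<boxplus> u) - (s \<boxplus> (t \<boxplus> u)) \<in> J m"
proof -
  have "msubst ((X 0 \<boxplus> X 1) \<boxplus> X 2) (triple s t u) - msubst (X 0 \<boxplus> (X 1 \<boxplus> X 2)) (triple s t u) \<in> J m"
    by (intro J_diff_msubst_left H_assoc)
  then show ?thesis
    using assms type_3_distinct by (simp add: fadd_msubst)
qed

text \<open>Compare H(T, 0) = T and H(0, T) = T with the first-order expansion of H at the
  origin.\<close>

lemma cf_H_linear: "cf H (uvec 0) - 1 \<in> I" "cf H (uvec 1) - 1 \<in> I"
proof -
  have zero: "msubst H (\<lambda>_. 0) = (0 :: (1, 'a) mps)"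
  proof -
    have "msubst (msubst H (pair T 0)) (uni 0) = (0 :: (1, 'a) mps)"
      by (simp add: msubst_at_0)
    moreover have "(\<lambda>v :: 2. msubst (pair T 0 v) (uni (0 :: (1, 'a) mps))) = (\<lambda>_. 0)"
      by auto
    ultimately show ?thesis
      by (simp add: msubst_assoc)
  qed
  have first: "msubst H g - (const (cf H (uvec 0)) * g 0 + const (cf H (uvec 1)) * g 1) \<in> J 2"
    if "\<And>v. no_const (g v)" for g :: "2 \<Rightarrow> (1, 'a) mps"
    using J_msubst_first_order[of g "\<lambda>_. 0" 1 H] that zero
    by (simp add: no_const_J1 UNIV_type_2 numeral_2_eq_2)
  have "T - const (cf H (uvec 0)) * T \<in> J 2"
    using J_diff_trans[OF J_diff_commute[THEN iffD1, OF H_unit_right] first[of "pair T 0"]] by simp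
  from JD[OF this, of "uvec 1"] have "1 - cf H (uvec 0) \<in> I"
    by (simp add: cf_monom)
  then show "cf H (uvec 0) - 1 \<in> I"
    using I_diff_commute by blast
  have "T - const (cf H (uvec 1)) * T \<in> J 2"
    using J_diff_trans[OF J_diff_commute[THEN iffD1, OF H_unit_left] first[of "pair 0 T"]] by simp
  from JD[OF this, of "uvec 1"] have "1 - cf H (uvec 1) \<in> I"
    by (simp add: cf_monom)
  then show "cf H (uvec 1) - 1 \<in> I"
    using I_diff_commute by blast
qed

text \<open>The linear part of H is x + y modulo I, so perturbations of order m simply add, up to
  terms of order m + 1.\<close>

lemma fadd_first_order:
  assumes nc: "no_const s" "no_const s'" "no_const t" "no_const t'"
    and d: "s - s' \<in> J m" "t - t' \<in> J m" and "m \<ge> 1"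
  shows "(s \<boxplus> t) - (s' \<boxplus> t') - ((s - s') + (t - t')) \<in> J (m + 1)"
proof -
  have 1: "(s \<boxplus> t) - (s' \<boxplus> t') -
    (const (cf H (uvec 0)) * (s - s') + const (cf H (uvec 1)) * (t - t')) \<in> J (m + 1)"
    using J_msubst_first_order[of "pair s t" "pair s' t'" m H] assms
    by (simp add: no_const_J1 UNIV_type_2)
  have c: "const (c - 1) \<in> J 1" if "c - 1 \<in> I" for c
    using that by (intro JI) (auto simp: cf_monom)
  \<comment> \<open>A constant in I counts as order 1, so replacing the linear coefficients of H by
    1 changes terms of order m only in order m + 1.\<close>
  have 2: "const (cf H (uvec 0) - 1) * (s - s') + const (cf H (uvec 1) - 1) * (t - t') \<in> J (m + 1)"
    using J_mult[OF c[OF cf_H_linear(1)] d(1)] J_mult[OF c[OF cf_H_linear(2)] d(2)]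
    by (simp add: J_add)
  have e: "const (c - 1) = const c - 1" for c :: 'a
    by (rule mps_eqI) (simp add: cf_monom cf_one)
  from J_add[OF 1 2] show ?thesis
    unfolding e by (simp add: algebra_simps)
qed

lemma fadd_linear:
  assumes "no_const s" "no_const t"
  shows "(s \<boxplus> t) - (s + t) \<in> J 2"
proof -
  have "(s \<boxplus> t) - (0 \<boxplus> 0) - (s + t) \<in> J 2"
    using fadd_first_order[of s 0 t 0 1] assms by (simp add: no_const_J1 numeral_2_eq_2)
  from J_add[OF this fadd_zero_right[of 0]] show ?thesis
    by (simp add: algebra_simps)
qed

text \<open>The failure of f to be an endomorphism of H. The outer subtraction is the ordinary one,
  so that the lowest part can be read off from coefficients; \<open>fadd_first_order\<close> relates
  it to formal sums.\<close>

definition defect :: "(1, 'a) mps \<Rightarrow> (2, 'a) mps" where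
  "defect f = msubst f (uni H) - (msubst f (uni x\<^sub>1) \<boxplus> msubst f (uni x\<^sub>2))"

lemma defect_eq:
  assumes "no_const f" "no_const s" "no_const t"
  shows "msubst f (uni (s \<boxplus> t)) = (msubst f (uni s) \<boxplus> msubst f (uni t)) + msubst (defect f) (pair s t)"
proof -
  have "msubst (msubst f (uni x\<^sub>1) \<boxplus> msubst f (uni x\<^sub>2)) (pair s t) =
    msubst (msubst f (uni x\<^sub>1)) (pair s t) \<boxplus> msubst (msubst f (uni x\<^sub>2)) (pair s t)"
    using assms by (intro fadd_msubst) auto
  then show ?thesis
    using assms unfolding defect_def msubst_diff by (simp add: msubst_assoc)
qed

lemma no_const_defect [simp]: "no_const f \<Longrightarrow> no_const (defect f)"
  by (simp add: defect_def)

lemma defect_cong: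
  assumes "f - g \<in> J m" "no_const f" "no_const g"
  shows "defect f - defect g \<in> J m"
proof -
  have "msubst f (uni H) - msubst g (uni H) \<in> J m"
    by (intro J_diff_msubst_left assms)
  moreover have "(msubst f (uni x\<^sub>1) \<boxplus> msubst f (uni x\<^sub>2)) - (msubst g (uni x\<^sub>1) \<boxplus> msubst g (uni x\<^sub>2)) \<in> J m"
    using assms by (intro fadd_cong J_diff_msubst_left) auto
  ultimately show ?thesis
    unfolding defect_def by (rule J_diff_diff)
qed

lemma defect_T: "defect T = 0"
  by (simp add: defect_def fadd_x)

lemma defect_swap:
  assumes "no_const f"
  shows "msubst (defect f) (pair x\<^sub>2 x\<^sub>1) - defect f \<in> J m"
proof -
  have 1: "msubst f (uni (x\<^sub>2 \<boxplus> x\<^sub>1)) - msubst f (uni H) \<in> J m"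
    by (intro J_diff_msubst_right H_commute) (auto simp: no_const_J1)
  have 2: "(msubst f (uni x\<^sub>2) \<boxplus> msubst f (uni x\<^sub>1)) - (msubst f (uni x\<^sub>1) \<boxplus> msubst f (uni x\<^sub>2)) \<in> J m"
    using assms by (intro fadd_commute) auto
  have "msubst (defect f) (pair x\<^sub>2 x\<^sub>1) = msubst f (uni (x\<^sub>2 \<boxplus> x\<^sub>1)) - (msubst f (uni x\<^sub>2) \<boxplus> msubst f (uni x\<^sub>1))"
    using defect_eq[of f x\<^sub>2 x\<^sub>1] assms by simp
  note e = this
  from J_diff[OF 1 2] show ?thesis
    unfolding e unfolding defect_def by (simp add: algebra_simps)
qed

lemma defect_axis:
  assumes "no_const f"
  shows "msubst (defect f) (pair T 0) \<in> J m"
proof -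
  have 1: "msubst f (uni (T \<boxplus> 0)) - msubst f (uni T) \<in> J m"
    by (intro J_diff_msubst_right H_unit_right) (auto simp: no_const_J1)
  have 2: "(msubst f (uni T) \<boxplus> msubst f (uni 0)) - msubst f (uni T) \<in> J m"
    unfolding msubst_at_0[OF assms] using assms by (intro fadd_zero_right) auto
  have "msubst (defect f) (pair T 0) = msubst f (uni (T \<boxplus> 0)) - (msubst f (uni T) \<boxplus> msubst f (uni 0))"
    using defect_eq[of f T 0] assms by simp
  note e = this
  from J_diff[OF 1 2] show ?thesis
    unfolding e by (simp add: algebra_simps)
qed

text \<open>Expand f at the two bracketings of the formal sum of s, t, u by
  \<open>defect_eq\<close>. The lowest part of the defect sees formal sums inside it as ordinary
  ones, and the errors add by \<open>fadd_first_order\<close>. Associativity of H equates the two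
  expansions: this is the cocycle identity in degree m.\<close>

lemma defect_associator:
  fixes s t u :: "('w::finite, 'a) mps"
  assumes f: "no_const f" and D: "defect f \<in> J m" and "m \<ge> 1"
    and nc: "no_const s" "no_const t" "no_const u"
  shows "msubst (defect f) (pair s t) + msubst (defect f) (pair (s + t) u) -
    (msubst (defect f) (pair t u) + msubst (defect f) (pair s (t + u))) \<in> J (m + 1)"
proof -
  let ?D = "\<lambda>a b. msubst (defect f) (pair a b) :: ('w, 'a) mps"
  let ?f = "\<lambda>a. msubst f (uni a) :: ('w, 'a) mps"
  have DJ: "?D a b \<in> J m" for a b
    by (rule J_msubst[OF D])
  have L: "?D a b - ?D a' b' \<in> J (m + 1)"
    if "a - a' \<in> J 2" "b - b' \<in> J 2" "no_const a" "no_const b" "no_const a'" "no_const b'" for a b a' b'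
    using that by (intro J_msubst_lowest[OF D]) (auto simp: no_const_J1)
  note nc' [simp] = f nc
  have 1: "?f ((s \<boxplus> t) \<boxplus> u) - ((?f s \<boxplus> ?f t) \<boxplus> ?f u) - (?D s t + ?D (s + t) u) \<in> J (m + 1)"
  proof -
    have a: "?f ((s \<boxplus> t) \<boxplus> u) = (((?f s \<boxplus> ?f t) + ?D s t) \<boxplus> ?f u) + ?D (s \<boxplus> t) u"
      by (simp add: defect_eq)
    have b: "(((?f s \<boxplus> ?f t) + ?D s t) \<boxplus> ?f u) - ((?f s \<boxplus> ?f t) \<boxplus> ?f u) - ?D s t \<in> J (m + 1)"
      using fadd_first_order[of "(?f s \<boxplus> ?f t) + ?D s t" "?f s \<boxplus> ?f t" "?f u" "?f u" m] DJ \<open>m \<ge> 1\<close> by simp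
    have c: "?D (s \<boxplus> t) u - ?D (s + t) u \<in> J (m + 1)"
      by (rule L) (auto simp: fadd_linear)
    from J_add[OF b c] show ?thesis
      unfolding a by (simp add: algebra_simps)
  qed
  have 2: "?f (s \<boxplus> (t \<boxplus> u)) - (?f s \<boxplus> (?f t \<boxplus> ?f u)) - (?D t u + ?D s (t + u)) \<in> J (m + 1)"
  proof -
    have a: "?f (s \<boxplus> (t \<boxplus> u)) = (?f s \<boxplus> ((?f t \<boxplus> ?f u) + ?D t u)) + ?D s (t \<boxplus> u)"
      by (simp add: defect_eq)
    have b: "(?f s \<boxplus> ((?f t \<boxplus> ?f u) + ?D t u)) - (?f s \<boxplus> (?f t \<boxplus> ?f u)) - ?D t u \<in> J (m + 1)"
      using fadd_first_order[of "?f s" "?f s" "(?f t \<boxplus> ?f u) + ?D t u" "?f t \<boxplus> ?f u" m] DJ \<open>m \<ge> 1\<close> by simp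
    have c: "?D s (t \<boxplus> u) - ?D s (t + u) \<in> J (m + 1)"
      by (rule L) (auto simp: fadd_linear)
    from J_add[OF b c] show ?thesis
      unfolding a by (simp add: algebra_simps)
  qed
  have 3: "?f ((s \<boxplus> t) \<boxplus> u) - ?f (s \<boxplus> (t \<boxplus> u)) \<in> J (m + 1)"
    by (intro J_diff_msubst_right fadd_assoc) (auto simp: no_const_J1)
  have 4: "((?f s \<boxplus> ?f t) \<boxplus> ?f u) - (?f s \<boxplus> (?f t \<boxplus> ?f u)) \<in> J (m + 1)"
    by (intro fadd_assoc) auto
  from J_add[OF J_diff[OF 2 1] J_diff[OF 3 4]] show ?thesis
    by (simp add: algebra_simps)
qed

section \<open>The lowest part of the defect as a cocycle\<close>

definition dcoef :: "(1, 'a) mps \<Rightarrow> nat \<Rightarrow> nat \<Rightarrow> 'a" where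
  "dcoef f m i = cf (defect f) (pair i (m - i))"

text \<open>Pure powers drop out because f respects adding 0; the second end follows by
  symmetry.\<close>

lemma dcoef_ends:
  assumes "no_const f"
  shows "dcoef f m 0 \<in> I" "dcoef f m m \<in> I"
proof -
  have "cf (msubst (defect f) (pair T 0)) (\<lambda>_. m) \<in> I"
    by (rule JD[OF defect_axis[OF assms, of "m + 1"]]) (simp add: deg_exponent_1)
  then show m: "dcoef f m m \<in> I"
    by (simp add: cf_msubst_left_axis dcoef_def)
  have "cf (msubst (defect f) (pair x\<^sub>2 x\<^sub>1) - defect f) (pair m 0) \<in> I"
    by (rule JD[OF defect_swap[OF assms, of "m + 1"]]) (simp add: deg_exponent_2)
  with m show "dcoef f m 0 \<in> I"
    by (simp add: cf_msubst_swap dcoef_def) (metis I_diff_iff)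
qed

lemma cocycle_dcoef:
  assumes f: "no_const f" and D: "defect f \<in> J m" and "m \<ge> 1"
  shows "cocycle m (dcoef f m)"
  unfolding cocycle_def
proof (intro conjI allI impI)
  fix i j :: nat assume ij: "1 \<le> i" "1 \<le> j" "i + j < m"
  define k where "k = m - (i + j)"
  have k: "k \<ge> 1" "m - i = j + k" "m = i + j + k"
    using ij by (auto simp: k_def)
  \<comment> \<open>The coefficient of x^i y^j z^k. As i and k are positive, the two terms in only
    two variables do not contribute.\<close>
  have "cf (msubst (defect f) (pair (X 0) (X 1)) + msubst (defect f) (pair (X 0 + X 1) (X 2)) -
    (msubst (defect f) (pair (X 1) (X 2)) + msubst (defect f) (pair (X 0) (X 1 + X 2)))) (triple i j k) \<in> I"
    using k type_3_distinct
    by (intro JD[OF defect_associator[OF f D]]) (auto simp: deg_exponent_3)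
  then show "of_nat ((i + j) choose i) * dcoef f m (i + j) - of_nat ((m - i) choose j) * dcoef f m i \<in> I"
    using ij k by (simp add: cf_msubst_add_left cf_msubst_add_right cf_msubst_two_of_three dcoef_def)
next
  fix i assume i: "1 \<le> i" "i < m"
  have "cf (msubst (defect f) (pair x\<^sub>2 x\<^sub>1) - defect f) (pair (m - i) i) \<in> I"
    by (rule JD[OF defect_swap[OF f, of "m + 1"]]) (use i in \<open>simp add: deg_exponent_2\<close>)
  with i show "dcoef f m i - dcoef f m (m - i) \<in> I"
    by (simp add: cf_msubst_swap dcoef_def)
qed

lemma defect_SucI:
  assumes "no_const f" "defect f \<in> J m" "\<And>i. 1 \<le> i \<Longrightarrow> i < m \<Longrightarrow> dcoef f m i \<in> I"
  shows "defect f \<in> J (m + 1)"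
proof (rule J_2_SucI)
  fix i assume "i \<le> m"
  then consider "i = 0" | "i = m" | "1 \<le> i" "i < m" by linarith
  then have "dcoef f m i \<in> I"
    using dcoef_ends[OF assms(1), of m] assms(3) by cases auto
  then show "cf (defect f) (pair i (m - i)) \<in> I"
    by (simp add: dcoef_def)
qed (use assms in simp)

text \<open>In degree m the new term changes f(H(x,y)) by c (x+y)^m and the formal sum of f(x) and
  f(y) by c x^m + c y^m.\<close>

lemma defect_change:
  assumes f: "no_const f" and "m \<ge> 1"
  shows "defect (f + monom (\<lambda>_. m) c) - defect f -
    const c * ((x\<^sub>1 + x\<^sub>2) ^ m - x\<^sub>1 ^ m - x\<^sub>2 ^ m) \<in> J (m + 1)"
proof -
  define d where "d = (monom (\<lambda>_. m) c :: (1, 'a) mps)"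
  have d: "no_const d" "d \<in> J m"
    using \<open>m \<ge> 1\<close> by (auto simp: d_def J_1_iff cf_monom fun_eq_iff)
  have dm: "msubst d (uni s) = const c * s ^ m" if "no_const s" for s :: "('w::finite, 'a) mps"
    unfolding d_def using that by (simp add: msubst_monom mpow_1)
  have 1: "(msubst (f + d) (uni x\<^sub>1) \<boxplus> msubst (f + d) (uni x\<^sub>2)) - (msubst f (uni x\<^sub>1) \<boxplus> msubst f (uni x\<^sub>2))
    - ((msubst (f + d) (uni x\<^sub>1) - msubst f (uni x\<^sub>1)) + (msubst (f + d) (uni x\<^sub>2) - msubst f (uni x\<^sub>2))) \<in> J (m + 1)"
    using f d \<open>m \<ge> 1\<close> by (intro fadd_first_order) (auto simp: msubst_add J_msubst)
  have 2: "msubst d (uni H) - msubst d (uni (x\<^sub>1 + x\<^sub>2)) \<in> J (m + 1)"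
    using fadd_linear[of x\<^sub>1 x\<^sub>2] by (intro J_msubst_lowest d) (auto simp: no_const_J1 fadd_x)
  from J_diff[OF 2 1] show ?thesis
    unfolding d_def[symmetric]
    by (simp add: defect_def msubst_add dm algebra_simps)
qed

lemma cf_binomial_defect:
  assumes "m \<ge> 1"
  shows "cf ((x\<^sub>1 + x\<^sub>2) ^ m - x\<^sub>1 ^ m - x\<^sub>2 ^ m) (pair i j) =
    (if i + j = m \<and> 1 \<le> i \<and> 1 \<le> j then of_nat (m choose i) else (0 :: 'a))"
proof -
  have "pair i j = (\<lambda>v. m * uvec 0 v) \<longleftrightarrow> i = m \<and> j = 0" "pair i j = (\<lambda>v. m * uvec 1 v) \<longleftrightarrow> i = 0 \<and> j = m"
    by (simp_all add: eq_commute[of "pair i j"] exponent_2_eq_iff) (auto simp: uvec_def)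
  then show ?thesis
    using assms by (auto simp: cf_binomial_2 monom_power cf_monom)
qed

lemma defect_lift_not_power:
  assumes f: "no_const f" and D: "defect f \<in> J m" and "m \<ge> 2" and np: "\<forall>k. m \<noteq> p ^ k"
  shows "\<exists>c. defect (f + monom (\<lambda>_. m) c) \<in> J (m + 1)"
proof -
  obtain e where e: "\<And>i. 1 \<le> i \<Longrightarrow> i < m \<Longrightarrow> dcoef f m i - e * of_nat (m choose i) \<in> I"
    using cocycle_not_power[OF cocycle_dcoef[OF f D] _ np] \<open>m \<ge> 2\<close> by auto
  \<comment> \<open>By \<open>defect_change\<close> a coefficient c adds c times the binomial form
    to the degree-m part of the defect, so - e cancels the cocycle.\<close>
  define g where "g = f + monom (\<lambda>_. m) (- e)"
  define B where "B = ((x\<^sub>1 + x\<^sub>2) ^ m - x\<^sub>1 ^ m - x\<^sub>2 ^ m :: (2, 'a) mps)"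
  have g: "no_const g"
    using f \<open>m \<ge> 2\<close> by (auto simp: g_def cf_monom fun_eq_iff)
  have ch: "defect g - defect f - const (- e) * B \<in> J (m + 1)"
    unfolding g_def B_def using f \<open>m \<ge> 2\<close> by (intro defect_change) auto
  have BJ: "B \<in> J m"
  proof (rule JI)
    fix \<beta> :: "2 \<Rightarrow> nat" assume "deg \<beta> < m"
    moreover have "\<beta> = pair (\<beta> 0) (\<beta> 1)"
      by (simp add: exponent_2_eq_iff)
    moreover have "cf B (pair (\<beta> 0) (\<beta> 1)) = (if \<beta> 0 + \<beta> 1 = m \<and> 1 \<le> \<beta> 0 \<and> 1 \<le> \<beta> 1 then of_nat (m choose \<beta> 0) else (0 :: 'a))"
      unfolding B_def using \<open>m \<ge> 2\<close> by (intro cf_binomial_defect) auto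
    ultimately show "cf B \<beta> \<in> I"
      by (metis I0 deg_exponent_2 less_irrefl)
  qed
  have "defect g \<in> J (m + 1)"
  proof (rule defect_SucI[OF g])
    have "(defect g - defect f - const (- e) * B) + (defect f + const (- e) * B) \<in> J m"
      by (intro J_add J_mono[OF ch] D J_mult_left BJ) auto
    then show "defect g \<in> J m" by simp
    fix i assume i: "1 \<le> i" "i < m"
    have "cf (defect g - defect f - const (- e) * B) (pair i (m - i)) \<in> I"
      by (rule JD[OF ch]) (use i in \<open>simp add: deg_exponent_2\<close>)
    moreover have "cf B (pair i (m - i)) = of_nat (m choose i)"
      unfolding B_def using i by (subst cf_binomial_defect) auto
    ultimately have "dcoef g m i - dcoef f m i + e * of_nat (m choose i) \<in> I"
      by (simp add: dcoef_def)
    from I_add[OF this e[OF i]] show "dcoef g m i \<in> I"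
      by simp
  qed
  then show ?thesis unfolding g_def by blast
qed

text \<open>Uniqueness of the correction: up to degree m the series is T + c T^m, and T has no
  defect, so c times the binomial form must vanish modulo I. Some coefficient of that form is prime
  to p.\<close>

lemma coef_not_power:
  assumes f: "no_const f" and T: "f - T \<in> J m" and "m \<ge> 2" and np: "\<forall>k. m \<noteq> p ^ k"
    and D: "defect f \<in> J (m + 1)"
  shows "cf f (\<lambda>_. m) \<in> I"
proof -
  define c where "c = cf f (\<lambda>_. m)"
  define B where "B = ((x\<^sub>1 + x\<^sub>2) ^ m - x\<^sub>1 ^ m - x\<^sub>2 ^ m :: (2, 'a) mps)"
  have nc: "no_const (T + monom (\<lambda>_. m) c)"
    using \<open>m \<ge> 2\<close> by (simp add: cf_monom fun_eq_iff uvec_1)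
  have "f - (T + monom (\<lambda>_. m) c) \<in> J (m + 1)"
    unfolding J_1_iff
  proof (intro allI impI)
    fix k assume "k < m + 1"
    then consider "k < m" | "k = m" by linarith
    then show "cf (f - (T + monom (\<lambda>_. m) c)) (\<lambda>_. k) \<in> I"
    proof cases
      case 1
      with T have "cf (f - T) (\<lambda>_. k) \<in> I"
        by (auto simp: J_1_iff)
      with 1 show ?thesis by (simp add: cf_monom fun_eq_iff)
    next
      case 2
      with \<open>m \<ge> 2\<close> show ?thesis by (simp add: c_def cf_monom fun_eq_iff uvec_1)
    qed
  qed
  then have 1: "defect f - defect (T + monom (\<lambda>_. m) c) \<in> J (m + 1)"
    using f nc by (intro defect_cong)
  have 2: "defect (T + monom (\<lambda>_. m) c) - defect T - const c * B \<in> J (m + 1)"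
    unfolding B_def using \<open>m \<ge> 2\<close> by (intro defect_change) auto
  have "const c * B \<in> J (m + 1)"
    using J_diff[OF J_diff[OF D 1] 2] by (simp add: defect_T)
  then have *: "c * cf B (pair i (m - i)) \<in> I" if "i \<le> m" for i
    using that JD[of "const c * B" "m + 1" "pair i (m - i)"] by (simp add: deg_exponent_2)
  obtain i where i: "1 \<le> i" "i < m" "\<not> p dvd (m choose i)"
    using exists_choose_not_dvd[OF prime_p _ np] \<open>m \<ge> 2\<close> by auto
  have "cf B (pair i (m - i)) = of_nat (m choose i)"
    unfolding B_def using i by (subst cf_binomial_defect) auto
  with * i have "of_nat (m choose i) * c \<in> I"
    by (metis less_imp_le mult.commute)
  with i show ?thesis
    unfolding c_def using of_nat_cancel by blast
qed

section \<open>Comparison with multiplication by p\<close>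

lemma no_const_multiple [simp]: "no_const (multiple H j)"
  by (induction j) auto

lemma multiple_linear: "multiple H j - of_nat (Suc j) * T \<in> J 2"
proof (induction j)
  case (Suc j)
  have "(multiple H j \<boxplus> T) - (multiple H j + T) \<in> J 2"
    by (intro fadd_linear) auto
  from J_add[OF this Suc] show ?case
    by (simp add: algebra_simps)
qed simp

text \<open>Passing from [j+1] to [j+2] adds the value of the defect at ([j+1](T), T), whose lowest
  part only sees (j+1) T. The first conjunct provides the order m that
  \<open>fadd_first_order\<close> needs in the induction.\<close>

lemma defect_multiple:
  assumes f: "no_const f" and D: "defect f \<in> J m" and "m \<ge> 1"
  shows "msubst f (uni (multiple H j)) - msubst (multiple H j) (uni f) \<in> J m \<and>
    msubst f (uni (multiple H j)) - msubst (multiple H j) (uni f) -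
      (\<Sum>i = 1..j. msubst (defect f) (pair (of_nat i * T) T)) \<in> J (m + 1)"
proof (induction j)
  case 0
  then show ?case using f by simp
next
  case (Suc j)
  let ?E = "\<lambda>j. msubst f (uni (multiple H j)) - msubst (multiple H j) (uni f)"
  let ?D = "\<lambda>a b. msubst (defect f) (pair a b) :: (1, 'a) mps"
  have E: "?E (Suc j) = (msubst f (uni (multiple H j)) \<boxplus> f) - (msubst (multiple H j) (uni f) \<boxplus> f) + ?D (multiple H j) T"
    using f by (simp add: defect_eq fadd_msubst)
  have 1: "(msubst f (uni (multiple H j)) \<boxplus> f) - (msubst (multiple H j) (uni f) \<boxplus> f) - ?E j \<in> J (m + 1)"
    using fadd_first_order[of "msubst f (uni (multiple H j))" "msubst (multiple H j) (uni f)" f f m] f Suc \<open>m \<ge> 1\<close>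
    by simp
  have 2: "?D (multiple H j) T - ?D (of_nat (Suc j) * T) T \<in> J (m + 1)"
    using multiple_linear[of j] by (intro J_msubst_lowest[OF D]) (auto simp: no_const_J1)
  have "?E (Suc j) - ?E j - ?D (of_nat (Suc j) * T) T \<in> J (m + 1)"
    using J_add[OF 1 2] unfolding E by (simp add: algebra_simps)
  note * = this
  have "?E (Suc j) - (\<Sum>i = 1..Suc j. ?D (of_nat i * T) T) \<in> J (m + 1)"
  proof -
    have "?E j - (\<Sum>i = 1..j. ?D (of_nat i * T) T) \<in> J (m + 1)" using Suc by simp
    from J_add[OF * this] show ?thesis by (simp add: algebra_simps del: multiple.simps)
  qed
  moreover have "(?E (Suc j) - ?E j - ?D (of_nat (Suc j) * T) T) + (?E j + ?D (of_nat (Suc j) * T) T) \<in> J m"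
    using Suc by (intro J_add J_mono[OF *] J_msubst[OF D]) auto
  ultimately show ?case
    by (simp del: multiple.simps)
qed

text \<open>Replaces [p]_H by T^(p^h) in the difference bounded by
  \<open>defect_multiple\<close>.\<close>

lemma defect_frobenius:
  assumes f: "no_const f"
  shows "(msubst f (uni (multiple H (p - 1))) - msubst (multiple H (p - 1)) (uni f))
    - (msubst f (uni (T ^ (p ^ h))) - f ^ (p ^ h)) \<in> J m"
proof -
  have 1: "msubst f (uni (multiple H (p - 1))) - msubst f (uni (T ^ (p ^ h))) \<in> J m"
    by (intro J_diff_msubst_right H_mult_p) (auto simp: no_const_J1)
  have "msubst (multiple H (p - 1)) (uni f) - msubst (T ^ (p ^ h)) (uni f) \<in> J m"
    by (intro J_diff_msubst_left H_mult_p)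
  then have 2: "msubst (multiple H (p - 1)) (uni f) - f ^ (p ^ h) \<in> J m"
    using f by (simp add: msubst_power)
  from J_diff[OF 1 2] show ?thesis
    by (simp add: algebra_simps)
qed

text \<open>Commuting with [p]_H below degree m means f(T^q) = f(T)^q there modulo I, with q = p^h.
  In degree q k this compares the coefficient of T^k with its q-th power.\<close>

lemma coef_power:
  assumes f: "no_const f" and D: "defect f \<in> J m" and "p ^ h * k < m"
  shows "cf f (\<lambda>_. k) ^ (p ^ h) - cf f (\<lambda>_. k) \<in> I"
proof -
  have "m \<ge> 1" using assms(3) by simp
  have 1: "msubst f (uni (T ^ (p ^ h))) - f ^ (p ^ h) \<in> J m"
    using J_diff[OF conjunct1[OF defect_multiple[OF f D \<open>m \<ge> 1\<close>, of "p - 1"]] defect_frobenius[OF f]] by simp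
  have "cf (msubst f (uni (T ^ (p ^ h))) - f ^ (p ^ h)) (\<lambda>_. p ^ h * k) \<in> I"
    by (rule JD[OF 1]) (use assms in \<open>simp add: deg_exponent_1\<close>)
  then have "cf f (\<lambda>_. k) - cf (f ^ (p ^ h)) (\<lambda>_. p ^ h * k) \<in> I"
    using p_gt_0 by (simp add: cf_msubst_scale)
  moreover have "cf (f ^ (p ^ h)) (\<lambda>_. p ^ h * k) - cf f (\<lambda>_. k) ^ (p ^ h) \<in> I"
    using cf_frobenius[of f h "p ^ h * k"] by simp
  ultimately show ?thesis
    using I_diff_trans I_diff_commute by metis
qed

text \<open>The trace of the degree-m cocycle is the coefficient of T^m in f(T^q) - f(T)^q, with q =
  p^h. It is a - a^q for the coefficient a at m / q, or 0 if q does not divide m; once it lies in I,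
  \<open>cocycle_power\<close> removes the whole cocycle.\<close>

lemma defect_lift_power:
  assumes f: "no_const f" and D: "defect f \<in> J (p ^ Suc k)"
    and fr: "h \<le> Suc k \<Longrightarrow> cf f (\<lambda>_. p ^ (Suc k - h)) ^ (p ^ h) - cf f (\<lambda>_. p ^ (Suc k - h)) \<in> I"
  shows "defect f \<in> J (p ^ Suc k + 1)"
proof (rule defect_SucI[OF f D])
  define m where "m = p ^ Suc k"
  have m: "m \<ge> 1" by (simp add: m_def Suc_le_eq)
  have D: "defect f \<in> J m" using D by (simp add: m_def)
  let ?S = "\<Sum>j = 1..<p. msubst (defect f) (pair (of_nat j * T) T)"
  let ?F = "msubst f (uni (T ^ (p ^ h))) - f ^ (p ^ h)"
  have "{1..p - 1} = {1..<p}" using p_gt_0 by auto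
  then have "msubst f (uni (multiple H (p - 1))) - msubst (multiple H (p - 1)) (uni f) - ?S \<in> J (m + 1)"
    using defect_multiple[OF f D m, of "p - 1"] by simp
  from J_diff[OF this defect_frobenius[OF f]] have "?F - ?S \<in> J (m + 1)"
    by (simp add: algebra_simps)
  then have "cf (?F - ?S) (\<lambda>_. m) \<in> I"
    by (rule JD) (simp add: deg_exponent_1)
  moreover have "cf ?F (\<lambda>_. m) \<in> I"
  proof (cases "h \<le> Suc k")
    case True
    then have "m = p ^ h * p ^ (Suc k - h)"
      unfolding m_def by (metis le_add_diff_inverse power_add)
    then have q: "p ^ h dvd m" "m div p ^ h = p ^ (Suc k - h)"
      by auto
    have "cf (f ^ (p ^ h)) (\<lambda>_. m) - cf f (\<lambda>_. p ^ (Suc k - h)) ^ (p ^ h) \<in> I"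
      using cf_frobenius[of f h m] q by simp
    from I_diff_trans[OF this fr[OF True]] show ?thesis
      using q p_gt_0 by (simp add: cf_msubst_scale) (metis I_diff_commute)
  next
    case False
    have "\<not> p ^ h dvd m"
    proof
      assume "p ^ h dvd m"
      then have "p ^ h \<le> p ^ Suc k"
        unfolding m_def by (intro dvd_imp_le) auto
      with False show False
        using p_gt_1 by (metis not_less_eq_eq power_strict_increasing_iff leD not_le)
    qed
    then show ?thesis
      using cf_frobenius[of f h m] p_gt_0 by (simp add: cf_msubst_scale)
  qed
  ultimately have "cf ?S (\<lambda>_. m) \<in> I"
    using I_diff_iff by simp
  moreover have "cf ?S (\<lambda>_. m) - cocycle_trace m (dcoef f m) \<in> I"
  proof -
    \<comment> \<open>The diagonal value includes the end terms i = 0 and i = m, which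
      \<open>cocycle_trace\<close> omits; they lie in I by \<open>dcoef_ends\<close>.\<close>
    have "(\<Sum>i\<le>m. dcoef f m i * of_nat j ^ i) - (\<Sum>i = 1..<m. dcoef f m i * of_nat j ^ i) \<in> I" for j
    proof -
      have "{..m} = insert 0 (insert m {1..<m})" by auto
      then have "(\<Sum>i\<le>m. dcoef f m i * of_nat j ^ i) - (\<Sum>i = 1..<m. dcoef f m i * of_nat j ^ i) =
        dcoef f m 0 * of_nat j ^ 0 + dcoef f m m * of_nat j ^ m"
        using m by simp
      also have "\<dots> \<in> I"
        by (intro I_add I_mult_right dcoef_ends f)
      finally show ?thesis .
    qed
    then have "(\<Sum>j = 1..<p. (\<Sum>i\<le>m. dcoef f m i * of_nat j ^ i) - (\<Sum>i = 1..<m. dcoef f m i * of_nat j ^ i)) \<in> I"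
      by (rule I_sum)
    then show ?thesis
      unfolding cocycle_trace_def by (simp add: cf_msubst_diagonal dcoef_def sum_subtractf)
  qed
  ultimately have tr: "cocycle_trace m (dcoef f m) \<in> I"
    using I_diff_iff by blast
  show "dcoef f (p ^ Suc k) i \<in> I" if "1 \<le> i" "i < p ^ Suc k" for i
    using cocycle_power[of k "dcoef f (p ^ Suc k)" i] cocycle_dcoef[OF f D m] tr that
    unfolding m_def by blast
qed

end

end

subsection \<open>Lifting coefficient by coefficient\<close>

lemma monom_0_right [simp]: "monom \<beta> 0 = 0"
  by (rule mps_eqI) (simp add: cf_monom)

text \<open>Each step alters a single, ever higher coefficient, so the coefficients stabilise. P
  need not pass to the limit; instead the limit agrees below m with a series that satisfies
  \<open>P m\<close>.\<close>

lemma successive_limit: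
  fixes P :: "nat \<Rightarrow> (1, 'a::comm_ring_1) mps \<Rightarrow> bool"
  assumes "P m0 s0"
    and step: "\<And>m s. m0 \<le> m \<Longrightarrow> P m s \<Longrightarrow> \<exists>c. P (Suc m) (s + monom (\<lambda>_. m) c)"
  obtains s :: "(1, 'a) mps" where "\<And>k. k < m0 \<Longrightarrow> cf s (\<lambda>_. k) = cf s0 (\<lambda>_. k)"
    "\<And>m. m0 \<le> m \<Longrightarrow> \<exists>t. P m t \<and> (\<forall>k<m. cf s (\<lambda>_. k) = cf t (\<lambda>_. k))"
proof -
  have "\<exists>S. S 0 = s0 \<and> (\<forall>n. P (m0 + n) (S n)) \<and> (\<forall>n. \<exists>c. S (Suc n) = S n + monom (\<lambda>_. m0 + n) c)"
  proof -
    have "\<exists>S. \<forall>n. (P (m0 + n) (S n) \<and> (n = 0 \<longrightarrow> S n = s0)) \<and> (\<exists>c. S (Suc n) = S n + monom (\<lambda>_. m0 + n) c)"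
    proof (rule dependent_nat_choice)
      fix s n assume "P (m0 + n) s \<and> (n = 0 \<longrightarrow> s = s0)"
      then obtain c where "P (Suc (m0 + n)) (s + monom (\<lambda>_. m0 + n) c)"
        using step[of "m0 + n" s] by auto
      then show "\<exists>t. (P (m0 + Suc n) t \<and> (Suc n = 0 \<longrightarrow> t = s0)) \<and> (\<exists>c. t = s + monom (\<lambda>_. m0 + n) c)"
        by auto
    qed (use assms in auto)
    then show ?thesis by blast
  qed
  then obtain S where S0: "S 0 = s0" and SP: "\<And>n. P (m0 + n) (S n)"
    and SS: "\<And>n. \<exists>c. S (Suc n) = S n + monom (\<lambda>_. m0 + n) c"
    by blast
  have stable: "cf (S (n + j)) (\<lambda>_. k) = cf (S n) (\<lambda>_. k)" if "k < m0 + n" for n j k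
  proof (induction j)
    case (Suc j)
    obtain c where "S (Suc (n + j)) = S (n + j) + monom (\<lambda>_. m0 + (n + j)) c"
      using SS by blast
    with Suc that show ?case by (simp add: cf_monom fun_eq_iff)
  qed simp
  \<comment> \<open>Whatever \<open>m0\<close> is, coefficient k is final from stage k + 1
    on.\<close>
  define s where "s = Mps (\<lambda>\<beta> :: 1 \<Rightarrow> nat. cf (S (Suc (\<beta> 1))) \<beta>)"
  have s: "cf s (\<lambda>_. k) = cf (S n) (\<lambda>_. k)" if "k < m0 + n" for k n
  proof -
    have "cf (S (Suc k)) (\<lambda>_. k) = cf (S n) (\<lambda>_. k)"
      using stable[of k "Suc k" n] stable[of k n "Suc k"] that by (simp add: add.commute)
    then show ?thesis by (simp add: s_def)
  qed
  show ?thesis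
  proof (rule that[of s])
    show "cf s (\<lambda>_. k) = cf s0 (\<lambda>_. k)" if "k < m0" for k
      using s[of k 0] that S0 by simp
    show "\<exists>t. P m t \<and> (\<forall>k<m. cf s (\<lambda>_. k) = cf t (\<lambda>_. k))" if "m0 \<le> m" for m
      using SP[of "m - m0"] s[of _ "m - m0"] that by (intro exI[of _ "S (m - m0)"]) auto
  qed
qed

lemma (in modulus) J_eqI:
  "\<forall>k<m. cf s (\<lambda>_ :: 1. k) = cf t (\<lambda>_. k) \<Longrightarrow> s - t \<in> J m"
  by (simp add: J_1_iff)

text \<open>An error e in degree m is removed by adding - b e T^m, where b inverts the linear
  coefficient modulo I.\<close>

lemma (in modulus) right_inverse:
  fixes f :: "(1, 'a) mps"
  assumes f: "no_const f" and b: "cf f (\<lambda>_ :: 1. 1) * b - 1 \<in> I"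
  obtains g :: "(1, 'a) mps" where "no_const g" "\<And>m. msubst f (uni g) - T \<in> J m"
proof -
  define P where "P m g \<longleftrightarrow> no_const g \<and> msubst f (uni g) - T \<in> J m" for m and g :: "(1, 'a) mps"
  have base: "P 1 0"
    using f by (simp add: P_def msubst_at_0 no_const_J1')
  have step: "\<exists>c. P (Suc m) (g + monom (\<lambda>_. m) c)" if m: "1 \<le> m" and g: "P m g" for m g
  proof -
    define e where "e = cf (msubst f (uni g) - T) (\<lambda>_. m)"
    define d where "d = (monom (\<lambda>_. m) (- b * e) :: (1, 'a) mps)"
    have d: "no_const d" "d \<in> J m"
      using m by (auto simp: d_def J_1_iff cf_monom fun_eq_iff)
    have g': "no_const g" "msubst f (uni g) - T \<in> J m"
      using g by (auto simp: P_def)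
    have 1: "msubst f (uni (g + d)) - msubst f (uni g) - const (cf f (\<lambda>_. 1)) * d \<in> J (Suc m)"
      using J_msubst_first_order[of "uni (g + d)" "uni g" m f] g' d m
      by (simp add: no_const_J1' UNIV_type_1 uvec_1)
    have 2: "(msubst f (uni g) - T) + const (cf f (\<lambda>_. 1)) * d \<in> J (Suc m)"
      unfolding J_1_iff
    proof (intro allI impI)
      fix k assume "k < Suc m"
      then consider "k < m" | "k = m" by linarith
      then show "cf ((msubst f (uni g) - T) + const (cf f (\<lambda>_. 1)) * d) (\<lambda>_. k) \<in> I"
      proof cases
        case 1
        then have "cf (msubst f (uni g) - T) (\<lambda>_. k) \<in> I"
          using g'(2) by (auto simp: J_1_iff)
        with 1 show ?thesis by (simp add: d_def cf_monom fun_eq_iff)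
      next
        case 2
        have "cf ((msubst f (uni g) - T) + const (cf f (\<lambda>_. 1)) * d) (\<lambda>_. m) = e + cf f (\<lambda>_. 1) * (- b * e)"
          by (simp add: e_def d_def cf_monom del: cf_diff)
        also have "\<dots> = - e * (cf f (\<lambda>_. 1) * b - 1)"
          by (simp add: algebra_simps)
        also have "\<dots> \<in> I" by (rule I_mult[OF b])
        finally show ?thesis using 2 by simp
      qed
    qed
    from J_add[OF 1 2] have "P (Suc m) (g + d)"
      using g' d by (simp add: P_def algebra_simps)
    then show ?thesis unfolding d_def by blast
  qed
  obtain g :: "(1, 'a) mps" where g0: "\<And>k. k < 1 \<Longrightarrow> cf g (\<lambda>_. k) = cf 0 (\<lambda>_ :: 1. k)"
    and g: "\<And>m. 1 \<le> m \<Longrightarrow> \<exists>t. P m t \<and> (\<forall>k<m. cf g (\<lambda>_. k) = cf t (\<lambda>_. k))"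
    using successive_limit[of P 1 0, OF base step] by metis
  have nc: "no_const g" using g0[of 0] by simp
  have "msubst f (uni g) - T \<in> J m" if m: "1 \<le> m" for m
  proof -
    obtain t where t: "P m t" "\<forall>k<m. cf g (\<lambda>_. k) = cf t (\<lambda>_. k)"
      using g m by blast
    have "msubst f (uni g) - msubst f (uni t) \<in> J m"
      using t nc by (intro J_diff_msubst_right J_eqI) (auto simp: P_def no_const_J1')
    then show ?thesis
      using t J_diff_trans by (auto simp: P_def)
  qed
  then have "msubst f (uni g) - T \<in> J m" for m
    by (cases "1 \<le> m") (auto simp: not_le)
  with nc that show ?thesis by blast
qed

text \<open>The right inverse g has a right inverse k in turn, and associativity of substitution
  gives f = f(g(k)) = k modulo I.\<close>

lemma (in modulus) inverse_series:
  fixes f :: "(1, 'a) mps"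
  assumes f: "no_const f" and b: "cf f (\<lambda>_ :: 1. 1) * b - 1 \<in> I"
  obtains g :: "(1, 'a) mps" where "no_const g" "\<And>m. msubst f (uni g) - T \<in> J m"
    "\<And>m. msubst g (uni f) - T \<in> J m"
proof -
  obtain g where g: "no_const g" "\<And>m. msubst f (uni g) - T \<in> J m"
    using right_inverse[OF f b] by blast
  have "cf (msubst f (uni g) - T) (\<lambda>_. 1) \<in> I"
    by (rule JD[OF g(2)[of 2]]) (simp add: deg_exponent_1)
  then have "cf f (\<lambda>_. 1) * cf g (\<lambda>_. 1) - 1 \<in> I"
    using cf_msubst_linear[OF f g(1)] by (simp add: cf_monom uvec_1)
  then obtain k where k: "no_const k" "\<And>m. msubst g (uni k) - T \<in> J m"
    using right_inverse[of g "cf f (\<lambda>_. 1)"] g by (auto simp: mult.commute)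
  have fk: "f - k \<in> J m" for m
  proof -
    have 1: "msubst f (uni (msubst g (uni k))) - msubst f (uni T) \<in> J m"
      using g k by (intro J_diff_msubst_right) (auto simp: no_const_J1')
    have 2: "msubst (msubst f (uni g)) (uni k) - msubst T (uni k) \<in> J m"
      by (intro J_diff_msubst_left g)
    have e: "msubst (msubst f (uni g)) (uni k) = msubst f (uni (msubst g (uni k)))"
      using g k by (simp add: msubst_assoc)
    from J_diff[OF 2[unfolded e] 1] show ?thesis
      using k by simp
  qed
  have "msubst g (uni f) - T \<in> J m" for m
  proof -
    have "msubst g (uni f) - msubst g (uni k) \<in> J m"
      using f k by (intro J_diff_msubst_right fk) (auto simp: no_const_J1')
    then show ?thesis
      using k(2) J_diff_trans by blast
  qed
  with g that show ?thesis by blast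
qed

context fgl_modulus
begin

text \<open>N is the truncation degree, and \<open>eSuc N\<close> occurs because \<open>J m\<close>
  concerns degrees below m. Coefficients at powers of p are kept from \<open>f0\<close>, the others
  are corrected from degree \<open>m0\<close> on.\<close>

lemma defect_lift:
  fixes N :: enat
  assumes f0: "no_const f0" and D: "defect f0 \<in> J m0" and m0: "enat m0 \<le> eSuc N" "m0 \<ge> 2"
    and fr: "\<And>k. enat (p ^ k * p ^ h) \<le> N \<Longrightarrow> cf f0 (\<lambda>_. p ^ k) ^ (p ^ h) - cf f0 (\<lambda>_. p ^ k) \<in> I"
  obtains f where "no_const f" "\<And>k. k < m0 \<Longrightarrow> cf f (\<lambda>_. k) = cf f0 (\<lambda>_. k)"
    "\<And>m. enat m \<le> eSuc N \<Longrightarrow> defect f \<in> J m"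
proof -
  \<comment> \<open>The invariant fixes the coefficients at all powers of p, so that
    \<open>fr\<close> stays applicable. Beyond N it asks nothing of the defect.\<close>
  define P where "P m f \<longleftrightarrow> no_const f \<and> (\<forall>k. cf f (\<lambda>_. p ^ k) = cf f0 (\<lambda>_. p ^ k)) \<and>
    (enat m \<le> eSuc N \<longrightarrow> defect f \<in> J m)" for m f
  have base: "P m0 f0"
    using f0 D by (simp add: P_def)
  have step: "\<exists>c. P (Suc m) (f + monom (\<lambda>_. m) c)" if m: "m0 \<le> m" and P: "P m f" for m f
  proof (cases "enat m \<le> N")
    case False
    then have "\<not> enat (Suc m) \<le> eSuc N"
      by (metis eSuc_enat eSuc_ile_mono)
    with P have "P (Suc m) (f + monom (\<lambda>_. m) 0)"
      by (auto simp: P_def cf_monom fun_eq_iff)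
    then show ?thesis by blast
  next
    case True
    then have f: "no_const f" "defect f \<in> J m"
      using P order_trans[OF True] by (auto simp: P_def ile_eSuc)
    show ?thesis
    proof (cases "\<exists>k. m = p ^ k")
      case False
      then obtain c where "defect (f + monom (\<lambda>_. m) c) \<in> J (m + 1)"
        using defect_lift_not_power[OF f] m m0 by auto
      then have "P (Suc m) (f + monom (\<lambda>_. m) c)"
        using P False m m0 by (auto simp: P_def cf_monom fun_eq_iff)
      then show ?thesis by blast
    next
      case True
      then obtain k where k: "m = p ^ Suc k"
        using m m0 by (metis le_trans not_less_eq_eq numeral_2_eq_2 old.nat.exhaust power_0 le_refl One_nat_def)
      have "defect f \<in> J (p ^ Suc k + 1)"
      proof (rule defect_lift_power)
        show "cf f (\<lambda>_. p ^ (Suc k - h)) ^ (p ^ h) - cf f (\<lambda>_. p ^ (Suc k - h)) \<in> I" if "h \<le> Suc k"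
        proof -
          have "p ^ (Suc k - h) * p ^ h = m"
            unfolding k power_add[symmetric] using that by simp
          with \<open>enat m \<le> N\<close> fr[of "Suc k - h"] P show ?thesis
            by (simp add: P_def)
        qed
      qed (use f k in auto)
      then have "P (Suc m) (f + monom (\<lambda>_. m) 0)"
        using P unfolding k by (auto simp: P_def cf_monom fun_eq_iff)
      then show ?thesis by blast
    qed
  qed
  obtain f :: "(1, 'a) mps" where f0: "\<And>k. k < m0 \<Longrightarrow> cf f (\<lambda>_. k) = cf f0 (\<lambda>_. k)"
    and f: "\<And>m. m0 \<le> m \<Longrightarrow> \<exists>t. P m t \<and> (\<forall>k<m. cf f (\<lambda>_. k) = cf t (\<lambda>_. k))"
    using successive_limit[of P m0 f0, OF base step] by metis
  have nc: "no_const f"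
    using f0[of 0] assms by simp
  have big: "defect f \<in> J m" if m: "m0 \<le> m" "enat m \<le> eSuc N" for m
  proof -
    obtain t where t: "P m t" "\<forall>k<m. cf f (\<lambda>_. k) = cf t (\<lambda>_. k)"
      using f m by blast
    have "defect f - defect t \<in> J m"
      using t nc by (intro defect_cong J_eqI) (auto simp: P_def)
    moreover have "defect t \<in> J m"
      using t m by (simp add: P_def)
    ultimately show ?thesis
      using J_add by fastforce
  qed
  have Df: "defect f \<in> J m" if m: "enat m \<le> eSuc N" for m
  proof -
    have "enat (max m m0) \<le> eSuc N"
      using m m0 by (simp add: max_def)
    then have "defect f \<in> J (max m m0)"
      by (intro big) auto
    then show ?thesis
      by (rule J_mono) simp
  qed
  show ?thesis
    by (rule that[of f], rule nc, erule f0, erule Df)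
qed

end

section \<open>Rings with explicit carriers\<close>

text \<open>Every commutative ring with a carrier is the image of a polynomial ring over the integers.
  Identities between power series are therefore proved over a type, modulo the kernel.\<close>

lemma zero_type_1: "(0 :: 1) = 1"
  by (rule num1_eqI)

locale cring_map = cring R for R :: "('b, 'm) ring_scheme" (structure) +
  fixes \<phi> :: "'a::comm_ring_1 \<Rightarrow> 'b"
  assumes map_closed [simp, intro]: "\<phi> a \<in> carrier R"
    and map_add: "\<phi> (a + b) = \<phi> a \<oplus> \<phi> b"
    and map_mult: "\<phi> (a * b) = \<phi> a \<otimes> \<phi> b"
    and map_one [simp]: "\<phi> 1 = \<one>"
begin

lemma map_zero [simp]: "\<phi> 0 = \<zero>"
  using map_add[of 0 0] by (metis add.l_cancel_one' add_0 map_closed)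

lemma map_diff: "\<phi> (a - b) = \<phi> a \<ominus> \<phi> b"
proof -
  have "\<phi> (a - b) \<oplus> \<phi> b = \<phi> a"
    by (simp flip: map_add)
  then show ?thesis
    by (metis add.inv_solve_right' map_closed minus_eq)
qed

lemma map_power: "\<phi> (a ^ k) = \<phi> a [^] k"
  by (induction k) (simp_all add: map_mult m_comm)

lemma map_sum: "\<phi> (sum f A) = (\<Oplus>x\<in>A. \<phi> (f x))"
  by (induction A rule: infinite_finite_induct) (simp_all add: map_add finsum_insert)

definition ker :: "'a set" where "ker = {a. \<phi> a = \<zero>}"

lemma map_eq_iff: "\<phi> a = \<phi> b \<longleftrightarrow> a - b \<in> ker"
  by (simp add: ker_def map_diff r_right_minus_eq)

sublocale modulus ker
  by unfold_locales (simp_all add: ker_def map_add map_mult)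

definition Phi :: "('v, 'a) mps \<Rightarrow> ('v, 'b) pser" where
  "Phi s = (\<lambda>\<beta>. \<phi> (cf s \<beta>))"

lemma Phi_closed [simp]: "Phi s \<in> carrier (PS R)"
  by (simp add: Phi_def PS_def)

lemma Phi_add: "Phi (s + t) = Phi s \<oplus>\<^bsub>PS R\<^esub> Phi t"
  by (simp add: Phi_def PS_def map_add)

lemma Phi_zero: "Phi 0 = \<zero>\<^bsub>PS R\<^esub>"
  by (simp add: Phi_def PS_def)

lemma Phi_one: "Phi 1 = \<one>\<^bsub>PS R\<^esub>"
  by (auto simp: Phi_def PS_def cf_one)

lemma Phi_mult: "Phi (s * t) = Phi s \<otimes>\<^bsub>PS R\<^esub> Phi t"
  by (simp add: Phi_def PS_def cf_mult sum_splits map_sum map_mult)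

lemma Phi_X: "Phi (X v) = var R v"
  by (auto simp: Phi_def var_def cf_monom uvec_def)

end

text \<open>Surjectivity is needed to lift elements of the ring. A mere \<open>cring_map\<close>
  arises when such a cover is followed by the restriction to another scheme.\<close>

locale cring_cover = cring_map +
  assumes map_surj: "b \<in> carrier R \<Longrightarrow> \<exists>a. \<phi> a = b"
begin

text \<open>Zero coefficients are lifted to 0, because \<open>no_const\<close> demands a vanishing
  constant term and not only one in the kernel.\<close>

lemma Phi_surj:
  assumes "f \<in> carrier (PS R)"
  obtains s where "f = Phi s" "f zv = \<zero> \<Longrightarrow> no_const s"
proof -
  have "\<forall>\<beta>. \<exists>a. \<phi> a = f \<beta> \<and> (f \<beta> = \<zero> \<longrightarrow> a = 0)"
    using assms map_surj map_zero by (metis (no_types, lifting) PS_def mem_Collect_eq partial_object.select_convs(1))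
  then obtain a where "\<And>\<beta>. \<phi> (a \<beta>) = f \<beta> \<and> (f \<beta> = \<zero> \<longrightarrow> a \<beta> = 0)"
    by metis
  then have "f = Phi (Mps a)" "f zv = \<zero> \<Longrightarrow> no_const (Mps a)"
    by (auto simp: Phi_def)
  then show ?thesis using that by blast
qed

text \<open>The axioms are carried from the ring type to \<open>PS R\<close> along the surjection
  \<open>Phi\<close>.\<close>

lemma cring_PS_cover: "cring (PS R :: ('v::finite, _) pser ring)"
proof (rule cringI)
  note flip = Phi_add[symmetric] Phi_mult[symmetric] Phi_zero[symmetric] Phi_one[symmetric]
  show "abelian_group (PS R :: ('v, _) pser ring)"
  proof (rule abelian_groupI)
    fix f g k :: "('v, _) pser"
    assume "f \<in> carrier (PS R)" "g \<in> carrier (PS R)" "k \<in> carrier (PS R)"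
    then obtain s t u where "f = Phi s" "g = Phi t" "k = Phi u"
      by (metis Phi_surj)
    then show "f \<oplus>\<^bsub>PS R\<^esub> g \<oplus>\<^bsub>PS R\<^esub> k = f \<oplus>\<^bsub>PS R\<^esub> (g \<oplus>\<^bsub>PS R\<^esub> k)"
      by (simp add: flip add_ac)
  next
    fix f g :: "('v, _) pser"
    assume "f \<in> carrier (PS R)" "g \<in> carrier (PS R)"
    then obtain s t where "f = Phi s" "g = Phi t"
      by (metis Phi_surj)
    then show "f \<oplus>\<^bsub>PS R\<^esub> g = g \<oplus>\<^bsub>PS R\<^esub> f" "f \<oplus>\<^bsub>PS R\<^esub> g \<in> carrier (PS R)"
      by (simp_all add: flip add_ac)
  next
    fix f :: "('v, _) pser"
    assume "f \<in> carrier (PS R)"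
    then obtain s where s: "f = Phi s"
      by (metis Phi_surj)
    then show "\<zero>\<^bsub>PS R\<^esub> \<oplus>\<^bsub>PS R\<^esub> f = f"
      by (simp add: flip)
    have "Phi (- s) \<oplus>\<^bsub>PS R\<^esub> f = \<zero>\<^bsub>PS R\<^esub>"
      by (simp add: flip s)
    then show "\<exists>g\<in>carrier (PS R). g \<oplus>\<^bsub>PS R\<^esub> f = \<zero>\<^bsub>PS R\<^esub>"
      by (intro bexI[of _ "Phi (- s)"]) auto
  next
    show "\<zero>\<^bsub>PS R\<^esub> \<in> carrier (PS R :: ('v, _) pser ring)"
      by (simp flip: Phi_zero)
  qed
  show "comm_monoid (PS R :: ('v, _) pser ring)"
  proof (rule comm_monoidI)
    fix f g k :: "('v, _) pser"
    assume "f \<in> carrier (PS R)" "g \<in> carrier (PS R)" "k \<in> carrier (PS R)"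
    then obtain s t u where "f = Phi s" "g = Phi t" "k = Phi u"
      by (metis Phi_surj)
    then show "f \<otimes>\<^bsub>PS R\<^esub> g \<otimes>\<^bsub>PS R\<^esub> k = f \<otimes>\<^bsub>PS R\<^esub> (g \<otimes>\<^bsub>PS R\<^esub> k)"
      by (simp add: flip mult_ac)
  next
    fix f g :: "('v, _) pser"
    assume "f \<in> carrier (PS R)" "g \<in> carrier (PS R)"
    then obtain s t where "f = Phi s" "g = Phi t"
      by (metis Phi_surj)
    then show "f \<otimes>\<^bsub>PS R\<^esub> g = g \<otimes>\<^bsub>PS R\<^esub> f" "f \<otimes>\<^bsub>PS R\<^esub> g \<in> carrier (PS R)"
      by (simp_all add: flip mult_ac)
  next
    fix f :: "('v, _) pser"
    assume "f \<in> carrier (PS R)"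
    then obtain s where "f = Phi s"
      by (metis Phi_surj)
    then show "\<one>\<^bsub>PS R\<^esub> \<otimes>\<^bsub>PS R\<^esub> f = f"
      by (simp add: flip)
  next
    show "\<one>\<^bsub>PS R\<^esub> \<in> carrier (PS R :: ('v, _) pser ring)"
      by (simp flip: Phi_one)
  qed
  fix f g k :: "('v, _) pser"
  assume "f \<in> carrier (PS R)" "g \<in> carrier (PS R)" "k \<in> carrier (PS R)"
  then obtain s t u where "f = Phi s" "g = Phi t" "k = Phi u"
    by (metis Phi_surj)
  then show "(f \<oplus>\<^bsub>PS R\<^esub> g) \<otimes>\<^bsub>PS R\<^esub> k = f \<otimes>\<^bsub>PS R\<^esub> k \<oplus>\<^bsub>PS R\<^esub> g \<otimes>\<^bsub>PS R\<^esub> k"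
    by (simp add: flip algebra_simps)
qed

end

subsection \<open>The polynomial ring on the elements of a ring\<close>

context cring
begin

text \<open>A monomial is a multiset of elements of the type. Elements outside the carrier are
  evaluated as 1, so that every monomial has a value in R.\<close>

definition ev_monom :: "'a multiset \<Rightarrow> 'a" where
  "ev_monom M = (\<Otimes>b\<in>set_mset M \<inter> carrier R. b [^] count M b)"

lemma ev_monom_closed [simp]: "ev_monom M \<in> carrier R"
  unfolding ev_monom_def by (intro finprod_closed) auto

lemma ev_monom_superset:
  assumes "finite A" "set_mset M \<inter> carrier R \<subseteq> A" "A \<subseteq> carrier R"
  shows "ev_monom M = (\<Otimes>b\<in>A. b [^] count M b)"
  unfolding ev_monom_def
proof (rule finprod_mono_neutral_cong_left)
  show "\<And>i. i \<in> A - set_mset M \<inter> carrier R \<Longrightarrow> i [^] count M i = \<one>"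
    using assms by (auto simp: not_in_iff)
qed (use assms in auto)

lemma ev_monom_add: "ev_monom (M + N) = ev_monom M \<otimes> ev_monom N"
proof -
  define A where "A = (set_mset M \<union> set_mset N) \<inter> carrier R"
  have A: "finite A" "A \<subseteq> carrier R" by (auto simp: A_def)
  have "ev_monom (M + N) = (\<Otimes>b\<in>A. b [^] (count M b + count N b))"
    using A by (subst ev_monom_superset[of A]) (auto simp: A_def)
  also have "\<dots> = (\<Otimes>b\<in>A. b [^] count M b \<otimes> b [^] count N b)"
    using A by (intro finprod_cong') (auto simp: nat_pow_mult)
  also have "\<dots> = (\<Otimes>b\<in>A. b [^] count M b) \<otimes> (\<Otimes>b\<in>A. b [^] count N b)"
    using A by (intro finprod_multf) auto
  also have "(\<Otimes>b\<in>A. b [^] count M b) = ev_monom M"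
    using A by (intro ev_monom_superset[symmetric]) (auto simp: A_def)
  also have "(\<Otimes>b\<in>A. b [^] count N b) = ev_monom N"
    using A by (intro ev_monom_superset[symmetric]) (auto simp: A_def)
  finally show ?thesis .
qed

text \<open>The domain is the integral polynomial ring with one variable for each element of the
  type; the variable of an element b of the carrier is sent to b.\<close>

definition ev :: "('a multiset \<Rightarrow>\<^sub>0 int) \<Rightarrow> 'a" where
  "ev P = (\<Oplus>M\<in>Poly_Mapping.keys P. [Poly_Mapping.lookup P M] \<cdot> ev_monom M)"

lemma ev_superset:
  assumes "finite A" "Poly_Mapping.keys P \<subseteq> A"
  shows "ev P = (\<Oplus>M\<in>A. [Poly_Mapping.lookup P M] \<cdot> ev_monom M)"
  unfolding ev_def
proof (rule add.finprod_mono_neutral_cong_left)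
  show "\<And>i. i \<in> A - Poly_Mapping.keys P \<Longrightarrow> [Poly_Mapping.lookup P i] \<cdot> ev_monom i = \<zero>"
    by (auto simp: in_keys_iff add_pow_def)
qed (use assms in \<open>auto simp: add.int_pow_closed\<close>)

lemma ev_closed [simp]: "ev P \<in> carrier R"
  unfolding ev_def by (intro finsum_closed) (auto simp: add.int_pow_closed)

lemma ev_add: "ev (P + Q) = ev P \<oplus> ev Q"
proof -
  define A where "A = Poly_Mapping.keys P \<union> Poly_Mapping.keys Q"
  have A: "finite A" "Poly_Mapping.keys (P + Q) \<subseteq> A"
    by (auto simp: A_def keys_add)
  have "ev (P + Q) = (\<Oplus>M\<in>A. [Poly_Mapping.lookup P M] \<cdot> ev_monom M \<oplus> [Poly_Mapping.lookup Q M] \<cdot> ev_monom M)"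
    using A by (simp add: ev_superset[of A] lookup_add add.int_pow_mult)
  also have "\<dots> = (\<Oplus>M\<in>A. [Poly_Mapping.lookup P M] \<cdot> ev_monom M) \<oplus> (\<Oplus>M\<in>A. [Poly_Mapping.lookup Q M] \<cdot> ev_monom M)"
    by (intro finsum_addf) (auto simp: add.int_pow_closed)
  also have "\<dots> = ev P \<oplus> ev Q"
    using A by (simp add: ev_superset[of A] A_def)
  finally show ?thesis .
qed

lemma ev_single: "ev (Poly_Mapping.single M c) = [c] \<cdot> ev_monom M"
  by (subst ev_superset[of "{M}"]) (auto simp: add.int_pow_closed)

lemma ev_mult_single: "ev (Poly_Mapping.single M c * Poly_Mapping.single N d) =
  ev (Poly_Mapping.single M c) \<otimes> ev (Poly_Mapping.single N d)"
  by (simp add: mult_single ev_single ev_monom_add add_pow_ldistr_int add_pow_rdistr_int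
      add.int_pow_closed add.int_pow_pow mult.commute)

lemma poly_mapping_single_induct:
  fixes P :: "('k \<Rightarrow>\<^sub>0 int) \<Rightarrow> bool"
  assumes "P 0" "\<And>f k c. P f \<Longrightarrow> P (f + Poly_Mapping.single k c)"
  shows "P f"
proof (induction f rule: update_induct)
  case (update f k c)
  have "Poly_Mapping.update k c f = f + Poly_Mapping.single k c"
    using update(1) by (intro poly_mapping_eqI)
      (auto simp: lookup_update lookup_add lookup_single when_def in_keys_iff)
  with assms(2)[OF update(3)] show ?case by simp
qed (rule assms)

lemma ev_zero [simp]: "ev 0 = \<zero>"
  by (simp add: ev_def)

lemma ev_mult: "ev (P * Q) = ev P \<otimes> ev Q"
proof (induction P rule: poly_mapping_single_induct)
  case (2 P M c)
  have "ev (Poly_Mapping.single M c * Q) = ev (Poly_Mapping.single M c) \<otimes> ev Q"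
    by (induction Q rule: poly_mapping_single_induct)
      (simp_all add: distrib_left ev_add ev_mult_single r_distr)
  with 2 show ?case
    by (simp add: distrib_right ev_add l_distr)
qed simp

lemma cring_cover_ev: "cring_cover R ev"
proof
  show "ev 1 = \<one>"
  proof -
    have "ev (Poly_Mapping.single {#} 1) = \<one>"
      by (simp only: ev_single) (simp add: ev_monom_def)
    then show ?thesis by (simp add: zero_multiset_def[symmetric] flip: single_one)
  qed
  show "\<exists>P. ev P = b" if "b \<in> carrier R" for b
  proof -
    have "ev (Poly_Mapping.single {#b#} 1) = b"
      using that by (simp only: ev_single) (simp add: ev_monom_def)
    then show ?thesis by blast
  qed
qed (simp_all add: ev_add ev_mult)

lemma cring_PS: "cring (PS R :: ('v::finite, 'a) pser ring)"
  by (rule cring_cover.cring_PS_cover[OF cring_cover_ev])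

end

subsection \<open>Transfer of substitutions\<close>

context cring_map
begin

lemma Phi_power: "Phi (s ^ k) = Phi s [^]\<^bsub>PS R\<^esub> k"
proof -
  interpret PS: cring "PS R" by (rule cring_PS)
  show ?thesis
    by (induction k) (simp_all add: Phi_one Phi_mult PS.m_comm)
qed

lemma Phi_prod: "Phi (prod f A) = (\<Otimes>\<^bsub>PS R\<^esub>x\<in>A. Phi (f x))"
proof -
  interpret PS: cring "PS R" by (rule cring_PS)
  show ?thesis
    by (induction A rule: infinite_finite_induct) (simp_all add: Phi_one Phi_mult)
qed

lemma Phi_msubst: "Phi (msubst s g) = subst R (Phi s) (\<lambda>v. Phi (g v))"
proof -
  have "(\<Otimes>\<^bsub>PS R\<^esub>v\<in>UNIV. Phi (g v) [^]\<^bsub>PS R\<^esub> \<beta> v) \<alpha> = \<phi> (cf (mpow g \<beta>) \<alpha>)" for \<alpha> \<beta>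
    by (simp add: mpow_def flip: Phi_prod Phi_power) (simp add: Phi_def)
  then show ?thesis
    by (simp add: Phi_def[of "msubst s g"] Phi_def[of s] subst_def cf_msubst map_sum map_mult)
qed

lemma Phi_msubst_pair: "Phi (msubst s (pair t u)) = subst R (Phi s) (pair (Phi t) (Phi u))"
proof -
  have "(\<lambda>v :: 2. Phi (pair t u v)) = pair (Phi t) (Phi u)" by auto
  then show ?thesis by (simp add: Phi_msubst)
qed

lemma Phi_eq_iff: "Phi s = Phi t \<longleftrightarrow> (\<forall>m. s - t \<in> J m)"
proof -
  have "Phi s = Phi t \<longleftrightarrow> (\<forall>\<beta>. cf s \<beta> - cf t \<beta> \<in> ker)"
    by (simp add: Phi_def fun_eq_iff map_eq_iff)
  also have "\<dots> \<longleftrightarrow> (\<forall>m. s - t \<in> J m)"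
    by (auto simp: J_def)
  finally show ?thesis .
qed

end

subsection \<open>Formal group laws over the prime field\<close>

lemma cf_msubst_zv: "cf (msubst s g) zv = cf s zv"
  by (simp add: cf_msubst cf_one)

text \<open>Carries an integral lift of the law to any commutative ring type. There it is a formal
  group law modulo every ideal that contains p.\<close>

definition mps_of_int :: "('v, int) mps \<Rightarrow> ('v, 'a::comm_ring_1) mps" where
  "mps_of_int s = Mps (\<lambda>\<beta>. of_int (cf s \<beta>))"

lemma cf_mps_of_int [simp]: "cf (mps_of_int s) \<beta> = of_int (cf s \<beta>)"
  by (simp add: mps_of_int_def)

lemma mps_of_int_mult: "mps_of_int (s * t) = mps_of_int s * mps_of_int t"
  by (rule mps_eqI) (simp add: cf_mult split_def)

lemma mps_of_int_1 [simp]: "mps_of_int 1 = 1"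
  by (rule mps_eqI) (simp add: cf_one)

lemma mps_of_int_0 [simp]: "mps_of_int 0 = 0"
  by (rule mps_eqI) simp

lemma mps_of_int_diff: "mps_of_int (s - t) = mps_of_int s - mps_of_int t"
  by (rule mps_eqI) simp

lemma mps_of_int_power: "mps_of_int (s ^ k) = mps_of_int s ^ k"
  by (induction k) (simp_all add: mps_of_int_mult)

lemma mps_of_int_prod: "mps_of_int (prod f A) = (\<Prod>x\<in>A. mps_of_int (f x))"
  by (induction A rule: infinite_finite_induct) (simp_all add: mps_of_int_mult)

lemma mps_of_int_X [simp]: "mps_of_int (X v) = X v"
  by (rule mps_eqI) (simp add: cf_monom)

lemma mps_of_int_mpow: "mps_of_int (mpow g \<beta>) = mpow (\<lambda>v. mps_of_int (g v)) \<beta>"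
  by (simp add: mpow_def mps_of_int_prod mps_of_int_power)

lemma mps_of_int_msubst: "mps_of_int (msubst s g) = msubst (mps_of_int s) (\<lambda>v. mps_of_int (g v))"
  by (rule mps_eqI) (simp add: cf_msubst flip: mps_of_int_mpow)

lemma mps_of_int_msubst_pair:
  "mps_of_int (msubst s (pair t u)) = msubst (mps_of_int s) (pair (mps_of_int t) (mps_of_int u))"
proof -
  have e: "(\<lambda>v :: 2. mps_of_int (pair t u v)) = pair (mps_of_int t) (mps_of_int u)" by auto
  show ?thesis unfolding mps_of_int_msubst e ..
qed

lemma mps_of_int_multiple: "mps_of_int (multiple H k) = multiple (mps_of_int H) k"
  by (induction k) (simp_all add: mps_of_int_msubst_pair cong: if_cong)

lemma modulus_int: "modulus {c :: int. int p dvd c}"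
  by unfold_locales auto

lemma (in charp_modulus) J_mps_of_int:
  assumes "s \<in> modulus.J {c :: int. int p dvd c} m"
  shows "mps_of_int s \<in> J m"
proof (rule JI)
  fix \<beta> :: "'b \<Rightarrow> nat" assume "deg \<beta> < m"
  then have "int p dvd cf s \<beta>"
    using modulus.JD[OF modulus_int assms] by auto
  then obtain c where "cf s \<beta> = int p * c" by auto
  then show "cf (mps_of_int s) \<beta> \<in> I"
    using p_in_I by (auto intro: I_mult_right)
qed

lemma (in charp_modulus) fgl_modulus_mps_of_int:
  assumes "fgl_modulus {c :: int. int p dvd c} p H h"
  shows "fgl_modulus I p (mps_of_int H) h"
proof -
  interpret Z: fgl_modulus "{c :: int. int p dvd c}" p H h by fact
  note * = mps_of_int_msubst_pair mps_of_int_diff mps_of_int_multiple mps_of_int_power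
  show ?thesis
  proof
    fix m
    show "msubst (mps_of_int H) (pair T 0) - T \<in> J m"
      using J_mps_of_int[OF Z.H_unit_right] by (simp add: * cong: if_cong)
    show "msubst (mps_of_int H) (pair 0 T) - T \<in> J m"
      using J_mps_of_int[OF Z.H_unit_left] by (simp add: * cong: if_cong)
    show "msubst (mps_of_int H) (pair x\<^sub>2 x\<^sub>1) - mps_of_int H \<in> J m"
      using J_mps_of_int[OF Z.H_commute] by (simp add: * cong: if_cong)
    show "msubst (mps_of_int H) (pair (msubst (mps_of_int H) (pair (X (0 :: 3)) (X 1))) (X 2)) -
      msubst (mps_of_int H) (pair (X 0) (msubst (mps_of_int H) (pair (X 1) (X 2)))) \<in> J m"
      using J_mps_of_int[OF Z.H_assoc] by (simp add: * cong: if_cong)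
    show "multiple (mps_of_int H) (p - 1) - T ^ (p ^ h) \<in> J m"
      using J_mps_of_int[OF Z.H_mult_p] by (simp add: * cong: if_cong)
  qed (use Z.no_const_H Z.h_pos in auto)
qed

lemma cring_cover_prime_field:
  assumes "prime p"
  shows "cring_cover (prime_field p) (\<lambda>c. c mod int p)"
proof -
  have p: "int p > 1" using assms prime_gt_1_nat by auto
  interpret residues "int p" "prime_field p"
    by unfold_locales (use p in auto)
  show ?thesis
  proof
    show "\<exists>a. a mod int p = b" if "b \<in> carrier (prime_field p)" for b
      using that by (intro exI[of _ b]) (auto simp: res_carrier_eq)
  qed (use p in \<open>auto simp: res_carrier_eq res_add_eq res_mult_eq res_one_eq mod_simps\<close>)
qed

lemma fgl_modulus_prime_field:
  assumes "prime p" "h \<ge> 1" and H: "formal_group_law (prime_field p) H"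
    and mult: "fgl_mult (prime_field p) H p = var (prime_field p) 0 [^]\<^bsub>PS (prime_field p)\<^esub> (p ^ h)"
  shows "fgl_modulus {c :: int. int p dvd c} p (Mps H) h"
proof -
  let ?R = "prime_field p"
  interpret C: cring_cover ?R "\<lambda>c. c mod int p"
    by (rule cring_cover_prime_field[OF assms(1)])
  have p: "p > 1" using assms prime_gt_1_nat by auto
  interpret residues "int p" ?R
    by unfold_locales (use p in auto)
  have ker: "C.ker = {c. int p dvd c}"
    by (auto simp: C.ker_def res_zero_eq)
  define H' where "H' = Mps H"
  \<comment> \<open>The coefficients of H are the representatives 0, ..., p - 1, so H read over the
    integers is a lift of itself.\<close>
  have HP: "C.Phi H' = H"
  proof -
    have "H \<beta> \<in> {0..int p - 1}" for \<beta>
      using H by (auto simp: formal_group_law_def PS_def res_carrier_eq)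
    then have "H \<beta> mod int p = H \<beta>" for \<beta>
      by (metis atLeastAtMost_iff mod_pos_pos_trivial zle_diff1_eq)
    then show ?thesis by (simp add: C.Phi_def H'_def)
  qed
  have J: "s - t \<in> modulus.J {c. int p dvd c} m" if "C.Phi s = C.Phi t" for s t m
    using that C.Phi_eq_iff[unfolded ker] by blast
  note ax = H[unfolded formal_group_law_def]
  note * = C.Phi_msubst_pair C.Phi_X C.Phi_zero HP
  have unit: "subst ?R H (pair (var ?R (0 :: 1)) \<zero>\<^bsub>PS ?R\<^esub>) = var ?R 0"
    using ax by blast
  have m: "C.Phi (multiple H' k) = fgl_mult ?R H (Suc k)" for k
    by (induction k) (simp_all add: * zero_type_1 cong: if_cong)
  interpret M: modulus "{c :: int. int p dvd c}" by (rule modulus_int)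
  show ?thesis
    unfolding H'_def[symmetric]
  proof
    show "prime p" by fact
    show "of_nat p \<in> {c. int p dvd c}" by simp
    show "h \<ge> 1" by fact
    fix m
    show "msubst H' (pair T 0) - T \<in> M.J m"
      by (rule J) (use ax in \<open>simp add: * zero_type_1 cong: if_cong\<close>)
    show "msubst H' (pair 0 T) - T \<in> M.J m"
      by (rule J) (use ax in \<open>simp add: * zero_type_1 cong: if_cong\<close>)
    show "msubst H' (pair x\<^sub>2 x\<^sub>1) - H' \<in> M.J m"
      by (rule J) (use ax in \<open>simp add: * zero_type_1 cong: if_cong\<close>)
    show "msubst H' (pair (msubst H' (pair (X (0 :: 3)) (X 1))) (X 2)) -
      msubst H' (pair (X 0) (msubst H' (pair (X 1) (X 2)))) \<in> M.J m"
      by (rule J) (use ax in \<open>simp add: * zero_type_1 cong: if_cong\<close>)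
    show "multiple H' (p - 1) - T ^ (p ^ h) \<in> M.J m"
      by (rule J) (use m[of "p - 1"] mult p in \<open>simp add: C.Phi_power C.Phi_X zero_type_1\<close>)
  next
    \<comment> \<open>H(T, 0) and H have the same constant term. The unit law makes it the residue
      0, whose representative is the integer 0.\<close>
    have "C.Phi (msubst H' (pair T 0)) zv = C.Phi H' zv"
      by (simp add: C.Phi_def cf_msubst_zv)
    then have "H zv = subst ?R H (pair (var ?R (0 :: 1)) \<zero>\<^bsub>PS ?R\<^esub>) zv"
      by (simp add: * zero_type_1 cong: if_cong)
    also have "\<dots> = 0"
      unfolding unit by (simp add: var_def fun_eq_iff res_zero_eq zero_type_1)
    finally show "no_const H'" by (simp add: H'_def)
  qed
qed

section \<open>Automorphisms modulo a degree\<close>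

definition gtrunc :: "('b, 'm) ring_scheme \<Rightarrow> enat \<Rightarrow> ('v::finite, 'b) pser \<Rightarrow> ('v, 'b) pser" where
  "gtrunc R N f = (\<lambda>\<beta>. if enat (deg \<beta>) \<le> N then f \<beta> else \<zero>\<^bsub>R\<^esub>)"

text \<open>One group for both halves of the theorem: N = \<infinity> gives \<open>Aut\<close>, a
  finite N gives \<open>Aut_bud\<close>.\<close>

definition gAut :: "('b, 'm) ring_scheme \<Rightarrow> enat \<Rightarrow> (2, 'b) pser \<Rightarrow> (1, 'b) pser monoid" where
  "gAut R N F =
    \<lparr>carrier = {f \<in> carrier (PS R). gtrunc R N f = f \<and> coef f 0 = \<zero>\<^bsub>R\<^esub> \<and>
       (\<exists>g\<in>carrier (PS R). gtrunc R N g = g \<and> coef g 0 = \<zero>\<^bsub>R\<^esub> \<and>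
         gtrunc R N (subst R f (\<lambda>_. g)) = gtrunc R N (var R 0) \<and>
         gtrunc R N (subst R g (\<lambda>_. f)) = gtrunc R N (var R 0)) \<and>
       gtrunc R N (subst R f (\<lambda>_. F)) = gtrunc R N (subst R F (\<lambda>v. subst R f (\<lambda>_. var R v)))},
     monoid.mult = (\<lambda>f g. gtrunc R N (subst R f (\<lambda>_. g))),
     one = gtrunc R N (var R 0)\<rparr>"

lemma gtrunc_infinity [simp]: "gtrunc R \<infinity> f = f"
  by (simp add: gtrunc_def)

lemma gtrunc_enat: "gtrunc R (enat n) = trunc R n"
  by (simp add: gtrunc_def trunc_def fun_eq_iff)

lemma gAut_infinity: "gAut R \<infinity> F = Aut R F"
  by (simp add: gAut_def Aut_def)

lemma gAut_enat: "gAut R (enat n) F = Aut_bud R n F"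
  by (simp add: gAut_def Aut_bud_def gtrunc_enat)

lemma gtrunc_gtrunc [simp]: "gtrunc R N (gtrunc R N f) = gtrunc R N f"
  by (auto simp: gtrunc_def)

text \<open>H has integer coefficients, so one lift serves all rings. The bound on N keeps the
  linear coefficient, and with it invertibility, visible after truncation.\<close>

locale fgl_map = cring_map R \<phi>
  for R :: "('a, 'm) ring_scheme" (structure) and \<phi> :: "'b::comm_ring_1 \<Rightarrow> 'a" +
  fixes p h :: nat and H :: "(2, int) pser" and N :: enat
  assumes fgl: "fgl_modulus {c :: int. int p dvd c} p (Mps H) h"
    and map_p: "\<phi> (of_nat p) = \<zero>"
    and N_ge_1: "1 \<le> N"
begin

abbreviation HA :: "(2, 'b) mps" where "HA \<equiv> mps_of_int (Mps H)"

sublocale charp_modulus ker p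
proof
  interpret Z: fgl_modulus "{c :: int. int p dvd c}" p "Mps H" h by (rule fgl)
  show "prime p" by (rule Z.prime_p)
  show "of_nat p \<in> ker" by (simp add: ker_def map_p)
qed

sublocale fgl_modulus ker p HA h
  by (rule fgl_modulus_mps_of_int[OF fgl])

lemma H_zv [simp]: "H zv = 0"
  using fgl_modulus.no_const_H[OF fgl] by simp

abbreviation K :: "('v::finite, 'b) mps \<Rightarrow> ('v, 'a) pser" where
  "K s \<equiv> gtrunc R N (Phi s)"

text \<open>For finite N the case m = N + 1 carries all the information; quantifying over m also
  covers N = \<infinity>, where no largest m exists.\<close>

lemma degree_bound_iff:
  fixes s t :: "('v::finite, 'b) mps"
  shows "(\<forall>m. enat m \<le> eSuc N \<longrightarrow> s - t \<in> J m) \<longleftrightarrow>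
  (\<forall>\<beta>. enat (deg \<beta>) \<le> N \<longrightarrow> cf s \<beta> - cf t \<beta> \<in> ker)"
proof (intro iffI allI impI)
  fix \<beta> :: "'v \<Rightarrow> nat" assume *: "\<forall>m. enat m \<le> eSuc N \<longrightarrow> s - t \<in> J m" and "enat (deg \<beta>) \<le> N"
  then have "enat (Suc (deg \<beta>)) \<le> eSuc N"
    by (simp flip: eSuc_enat)
  with * have "s - t \<in> J (Suc (deg \<beta>))"
    by blast
  then show "cf s \<beta> - cf t \<beta> \<in> ker"
    using JD[of "s - t" "Suc (deg \<beta>)" \<beta>] by simp
next
  fix m assume *: "\<forall>\<beta>. enat (deg \<beta>) \<le> N \<longrightarrow> cf s \<beta> - cf t \<beta> \<in> ker" and m: "enat m \<le> eSuc N"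
  show "s - t \<in> J m"
  proof (rule JI)
    fix \<beta> :: "'v \<Rightarrow> nat" assume "deg \<beta> < m"
    then have "eSuc (enat (deg \<beta>)) \<le> enat m"
      by (simp add: eSuc_enat)
    then have "enat (deg \<beta>) \<le> N"
      using m by (metis eSuc_ile_mono order_trans)
    with * show "cf (s - t) \<beta> \<in> ker" by simp
  qed
qed

lemma K_eq_iff: "K s = K t \<longleftrightarrow> (\<forall>m. enat m \<le> eSuc N \<longrightarrow> s - t \<in> J m)"
  unfolding degree_bound_iff by (auto simp: gtrunc_def Phi_def fun_eq_iff map_eq_iff)

definition mtrunc :: "('v::finite, 'b) mps \<Rightarrow> ('v, 'b) mps" where
  "mtrunc s = Mps (\<lambda>\<beta>. if enat (deg \<beta>) \<le> N then cf s \<beta> else 0)"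

lemma K_mtrunc: "K s = Phi (mtrunc s)"
  by (auto simp: gtrunc_def Phi_def mtrunc_def fun_eq_iff)

lemma K_closed [simp]: "K s \<in> carrier (PS R)"
  by (simp add: K_mtrunc)

lemma no_const_mtrunc [simp]: "no_const s \<Longrightarrow> no_const (mtrunc s)"
  by (simp add: mtrunc_def)

lemma mtrunc_cong: "enat m \<le> eSuc N \<Longrightarrow> mtrunc s - s \<in> J m"
proof -
  have "\<forall>m. enat m \<le> eSuc N \<longrightarrow> mtrunc s - s \<in> J m"
    unfolding degree_bound_iff by (simp add: mtrunc_def)
  then show "enat m \<le> eSuc N \<Longrightarrow> mtrunc s - s \<in> J m" by blast
qed

text \<open>Without constant terms, the coefficients of a composite up to degree N depend only on
  those of its constituents.\<close>

lemma gtrunc_subst: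
  assumes "\<And>v. no_const (t v)"
  shows "gtrunc R N (subst R (K s) (\<lambda>v. K (t v))) = K (msubst s t)"
proof -
  have "K (msubst (mtrunc s) (\<lambda>v. mtrunc (t v))) = K (msubst s t)"
    unfolding K_eq_iff using assms
    by (auto intro!: J_diff_msubst mtrunc_cong no_const_J1)
  then show ?thesis
    by (simp add: Phi_msubst flip: K_mtrunc)
qed

lemma K_T: "K T = gtrunc R N (var R (0 :: 1))"
  by (simp add: Phi_X zero_type_1)

text \<open>Not an instance of \<open>gtrunc_subst\<close>: in the definition of the group the inner
  series f(x_v) are not truncated.\<close>

lemma gtrunc_subst_law:
  assumes "no_const s"
  shows "gtrunc R N (subst R (K HA) (\<lambda>v. subst R (K s) (\<lambda>_. var R v))) =
    K (msubst HA (pair (msubst s (uni x\<^sub>1)) (msubst s (uni x\<^sub>2))))"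
proof -
  have e: "subst R (K s) (\<lambda>_. var R v) = Phi (msubst (mtrunc s) (uni (X v)))" for v :: 2
    by (simp add: Phi_msubst K_mtrunc Phi_X)
  have "gtrunc R N (subst R (K HA) (\<lambda>v. subst R (K s) (\<lambda>_. var R v))) =
    K (msubst (mtrunc HA) (\<lambda>v. msubst (mtrunc s) (uni (X v))))"
    by (simp only: e K_mtrunc[of HA] Phi_msubst)
  also have "\<dots> = K (msubst HA (\<lambda>v. msubst s (uni (X v))))"
    unfolding K_eq_iff using assms
    by (auto intro!: J_diff_msubst mtrunc_cong no_const_J1 J_diff_msubst_left)
  also have "(\<lambda>v. msubst s (uni (X v))) = pair (msubst s (uni x\<^sub>1)) (msubst s (uni x\<^sub>2))"
    using UNIV_type_2 by (auto simp: fun_eq_iff)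
  finally show ?thesis .
qed

text \<open>Lifts of automorphisms. Invertibility is reduced to the linear coefficient;
  \<open>inverse_series\<close> recovers the inverse.\<close>

definition autos :: "(1, 'b) mps set" where
  "autos = {s. no_const s \<and> (\<exists>b. cf s (\<lambda>_. 1) * b - 1 \<in> ker) \<and>
    (\<forall>m. enat m \<le> eSuc N \<longrightarrow> defect s \<in> J m)}"

lemma no_const_autos: "s \<in> autos \<Longrightarrow> no_const s"
  by (simp add: autos_def)

lemma T_autos [simp]: "T \<in> autos"
proof -
  have "cf T (\<lambda>_. 1) = (1 :: 'b)"
    by (simp add: cf_monom uvec_1)
  then show ?thesis
    unfolding autos_def mem_Collect_eq defect_T by (auto intro!: exI[of _ 1])
qed

lemma autos_comp:
  assumes "s \<in> autos" "t \<in> autos"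
  shows "msubst s (uni t) \<in> autos"
proof -
  have nc: "no_const s" "no_const t" using assms by (auto intro: no_const_autos)
  obtain b c where b: "cf s (\<lambda>_. 1) * b - 1 \<in> ker" and c: "cf t (\<lambda>_. 1) * c - 1 \<in> ker"
    using assms by (auto simp: autos_def)
  have "(cf s (\<lambda>_. 1) * b - 1) * (cf t (\<lambda>_. 1) * c) + (cf t (\<lambda>_. 1) * c - 1) \<in> ker"
    by (intro I_add I_mult_right b c)
  then have "cf (msubst s (uni t)) (\<lambda>_. 1) * (b * c) - 1 \<in> ker"
    using cf_msubst_linear[OF nc] by (simp add: algebra_simps)
  moreover have "defect (msubst s (uni t)) \<in> J m" if m: "enat m \<le> eSuc N" for m
  proof -
    let ?t1 = "msubst t (uni x\<^sub>1)" and ?t2 = "msubst t (uni x\<^sub>2)"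
    have D: "defect s \<in> J m" "defect t \<in> J m"
      using assms m by (auto simp: autos_def)
    have "msubst s (uni (msubst t (uni HA))) - msubst s (uni (msubst HA (pair ?t1 ?t2))) \<in> J m"
      using D(2) nc by (intro J_diff_msubst_right) (auto simp: defect_def no_const_J1')
    moreover have "msubst s (uni (msubst HA (pair ?t1 ?t2))) - msubst HA (pair (msubst s (uni ?t1)) (msubst s (uni ?t2))) \<in> J m"
      using defect_eq[OF nc(1), of ?t1 ?t2] nc J_msubst[OF D(1), of "pair ?t1 ?t2"] by simp
    ultimately have "msubst s (uni (msubst t (uni HA))) - msubst HA (pair (msubst s (uni ?t1)) (msubst s (uni ?t2))) \<in> J m"
      by (rule J_diff_trans)
    then show ?thesis
      using nc by (simp add: defect_def msubst_assoc cong: if_cong)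
  qed
  ultimately show ?thesis
    using nc by (auto simp: autos_def)
qed

text \<open>For the inverse series t, applying s to the formal sum of t(x) and t(y) gives H to the
  required order; applying t to both sides shows that t respects H.\<close>

lemma autos_inverse:
  assumes "s \<in> autos"
  obtains t where "t \<in> autos" "\<And>m. msubst s (uni t) - T \<in> J m" "\<And>m. msubst t (uni s) - T \<in> J m"
proof -
  have nc: "no_const s" using assms by (rule no_const_autos)
  obtain b where b: "cf s (\<lambda>_. 1) * b - 1 \<in> ker"
    using assms by (auto simp: autos_def)
  obtain t :: "(1, 'b) mps" where t: "no_const t" "\<And>m. msubst s (uni t) - T \<in> J m" "\<And>m. msubst t (uni s) - T \<in> J m"
    by (rule inverse_series[OF nc b]) (rule that; assumption)
  have "cf (msubst t (uni s) - T) (\<lambda>_. 1) \<in> ker"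
    by (rule JD[OF t(3)[of 2]]) (simp add: deg_exponent_1)
  then have "cf t (\<lambda>_. 1) * cf s (\<lambda>_. 1) - 1 \<in> ker"
    using cf_msubst_linear[OF t(1) nc] by (simp add: cf_monom uvec_1)
  moreover have "defect t \<in> J m" if m: "enat m \<le> eSuc N" for m
  proof -
    let ?t1 = "msubst t (uni x\<^sub>1)" and ?t2 = "msubst t (uni x\<^sub>2)"
    have D: "defect s \<in> J m"
      using assms m by (auto simp: autos_def)
    have st: "msubst s (uni (msubst t (uni x))) - x \<in> J m" if "no_const x" for x :: "(2, 'b) mps"
    proof -
      have "msubst (msubst s (uni t)) (uni x) - msubst T (uni x) \<in> J m"
        by (intro J_diff_msubst_left t)
      then show ?thesis using that t by (simp add: msubst_assoc)
    qed
    have ts: "msubst t (uni (msubst s (uni x))) - x \<in> J m" if "no_const x" for x :: "(2, 'b) mps"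
    proof -
      have "msubst (msubst t (uni s)) (uni x) - msubst T (uni x) \<in> J m"
        by (intro J_diff_msubst_left t)
      then show ?thesis using that nc by (simp add: msubst_assoc)
    qed
    have "msubst HA (pair (msubst s (uni ?t1)) (msubst s (uni ?t2))) - msubst HA (pair x\<^sub>1 x\<^sub>2) \<in> J m"
      using nc t by (intro fadd_cong st) auto
    moreover have "msubst s (uni (msubst HA (pair ?t1 ?t2))) - msubst HA (pair (msubst s (uni ?t1)) (msubst s (uni ?t2))) \<in> J m"
      using defect_eq[OF nc, of ?t1 ?t2] t J_msubst[OF D, of "pair ?t1 ?t2"] by simp
    ultimately have "msubst s (uni (msubst HA (pair ?t1 ?t2))) - HA \<in> J m"
      using J_diff_trans unfolding fadd_x by blast
    then have "msubst t (uni (msubst s (uni (msubst HA (pair ?t1 ?t2))))) - msubst t (uni HA) \<in> J m"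
      using nc by (intro J_diff_msubst_right) (auto simp: no_const_J1')
    moreover have "msubst t (uni (msubst s (uni (msubst HA (pair ?t1 ?t2))))) - msubst HA (pair ?t1 ?t2) \<in> J m"
      by (rule ts) simp
    ultimately have "msubst t (uni HA) - msubst HA (pair ?t1 ?t2) \<in> J m"
      using J_diff_trans J_diff_commute by blast
    then show ?thesis by (simp add: defect_def)
  qed
  ultimately have "t \<in> autos"
    using t by (auto simp: autos_def)
  with t that show ?thesis by blast
qed

lemma coef_K: "enat k \<le> N \<Longrightarrow> coef (K s) k = \<phi> (cf s (\<lambda>_. k))"
  by (simp add: gtrunc_def Phi_def deg_exponent_1)

abbreviation G :: "(1, 'a) pser monoid" where
  "G \<equiv> gAut R N (K HA)"

lemma mult_G: "no_const t \<Longrightarrow> K s \<otimes>\<^bsub>G\<^esub> K t = K (msubst s (uni t))"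
  by (simp add: gAut_def gtrunc_subst)

lemma one_G: "\<one>\<^bsub>G\<^esub> = K T"
  by (simp add: gAut_def K_T)

lemma K_autos:
  assumes s: "s \<in> autos"
  shows "K s \<in> carrier G"
proof -
  obtain t where t: "t \<in> autos" "\<And>m. msubst s (uni t) - T \<in> J m" "\<And>m. msubst t (uni s) - T \<in> J m"
    using autos_inverse[OF s] by blast
  have "gtrunc R N (subst R (K s) (\<lambda>_. K t)) = gtrunc R N (var R 0)"
    "gtrunc R N (subst R (K t) (\<lambda>_. K s)) = gtrunc R N (var R 0)"
    using s t by (simp_all only: gtrunc_subst no_const_autos flip: K_T) (simp_all add: K_eq_iff)
  moreover have "gtrunc R N (subst R (K s) (\<lambda>_. K HA)) =
    gtrunc R N (subst R (K HA) (\<lambda>v. subst R (K s) (\<lambda>_. var R v)))"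
  proof -
    have "K (msubst s (uni HA)) = K (msubst HA (pair (msubst s (uni x\<^sub>1)) (msubst s (uni x\<^sub>2))))"
      using s by (simp add: K_eq_iff autos_def defect_def)
    then show ?thesis
      using s by (simp only: gtrunc_subst_law gtrunc_subst no_const_autos no_const_H)
  qed
  moreover have "coef (K s) 0 = \<zero>" "coef (K t) 0 = \<zero>"
    using s t by (simp_all add: coef_K zero_enat_def[symmetric] no_const_autos)
  ultimately show ?thesis
    unfolding gAut_def using K_closed[of t] by (auto intro!: bexI[of _ "K t"])
qed

end

locale fgl_cover = fgl_map R \<phi> p h H N + cring_cover R \<phi>
  for R :: "('a, 'm) ring_scheme" (structure) and \<phi> :: "'b::comm_ring_1 \<Rightarrow> 'a"
    and p h :: nat and H :: "(2, int) pser" and N :: enat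
begin

lemma carrier_G: "carrier G = K ` autos"
proof (intro equalityI subsetI)
  fix f assume f: "f \<in> carrier G"
  then obtain g :: "(1, 'a) pser" where f': "f \<in> carrier (PS R)" "gtrunc R N f = f" "f zv = \<zero>"
    and g': "g \<in> carrier (PS R)" "gtrunc R N g = g" "g zv = \<zero>"
    and fg: "gtrunc R N (subst R f (\<lambda>_. g)) = gtrunc R N (var R 0)"
    and law: "gtrunc R N (subst R f (\<lambda>_. K HA)) = gtrunc R N (subst R (K HA) (\<lambda>v. subst R f (\<lambda>_. var R v)))"
    by (auto simp: gAut_def)
  obtain s where s: "f = Phi s" "no_const s"
    using Phi_surj[OF f'(1)] f'(3) by metis
  obtain t where t: "g = Phi t" "no_const t"
    using Phi_surj[OF g'(1)] g'(3) by metis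
  have fs: "f = K s" and gt: "g = K t"
    using f' g' s t by auto
  have "K (msubst s (uni t)) = K T"
    using fg t(2) unfolding fs gt by (simp only: gtrunc_subst K_T)
  \<comment> \<open>Degree 1 is not truncated, so the linear coefficient of the composite shows that
    the linear coefficient of s is a unit modulo the kernel.\<close>
  moreover have "enat 2 \<le> eSuc N"
    using N_ge_1 by (metis eSuc_ile_mono eSuc_enat numeral_2_eq_2 one_enat_def One_nat_def)
  ultimately have "msubst s (uni t) - T \<in> J 2"
    unfolding K_eq_iff by blast
  then have "cf (msubst s (uni t) - T) (\<lambda>_. 1) \<in> ker"
    by (rule JD) (simp add: deg_exponent_1)
  then have "cf s (\<lambda>_. 1) * cf t (\<lambda>_. 1) - 1 \<in> ker"
    using cf_msubst_linear[OF s(2) t(2)] by (simp add: cf_monom uvec_1)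
  moreover have "K (msubst s (uni HA)) = K (msubst HA (pair (msubst s (uni x\<^sub>1)) (msubst s (uni x\<^sub>2))))"
    using law s(2) unfolding fs by (simp only: gtrunc_subst_law gtrunc_subst no_const_H)
  ultimately have "s \<in> autos"
    using s by (auto simp: autos_def K_eq_iff defect_def)
  with fs show "f \<in> K ` autos" by blast
qed (use K_autos in auto)

lemma group_G: "group G"
proof (rule groupI)
  fix f g k assume "f \<in> carrier G" "g \<in> carrier G" "k \<in> carrier G"
  then obtain s t u where "f = K s" "g = K t" "k = K u" "s \<in> autos" "t \<in> autos" "u \<in> autos"
    by (auto simp: carrier_G)
  then show "f \<otimes>\<^bsub>G\<^esub> g \<otimes>\<^bsub>G\<^esub> k = f \<otimes>\<^bsub>G\<^esub> (g \<otimes>\<^bsub>G\<^esub> k)"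
    by (simp add: mult_G msubst_assoc no_const_autos)
next
  fix f g assume "f \<in> carrier G" "g \<in> carrier G"
  then obtain s t where "f = K s" "g = K t" "s \<in> autos" "t \<in> autos"
    by (auto simp: carrier_G)
  then show "f \<otimes>\<^bsub>G\<^esub> g \<in> carrier G"
    by (simp add: mult_G K_autos autos_comp no_const_autos)
next
  show "\<one>\<^bsub>G\<^esub> \<in> carrier G"
    by (simp add: one_G K_autos)
next
  fix f assume "f \<in> carrier G"
  then obtain s where s: "f = K s" "s \<in> autos"
    by (auto simp: carrier_G)
  then show "\<one>\<^bsub>G\<^esub> \<otimes>\<^bsub>G\<^esub> f = f"
    by (simp only: one_G mult_G no_const_autos) (simp add: no_const_autos)
  obtain t where t: "t \<in> autos" "\<And>m. msubst t (uni s) - T \<in> J m"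
    using autos_inverse[OF s(2)] by metis
  have "K t \<otimes>\<^bsub>G\<^esub> f = \<one>\<^bsub>G\<^esub>"
    using s t by (simp only: one_G mult_G no_const_autos) (simp add: K_eq_iff)
  with t show "\<exists>g\<in>carrier G. g \<otimes>\<^bsub>G\<^esub> f = \<one>\<^bsub>G\<^esub>"
    using K_autos by blast
qed

end

section \<open>The steps of the filtration\<close>

text \<open>Otherwise p^k, which divides i times the binomial coefficient, would divide i.\<close>

lemma prime_dvd_choose_prime_power:
  fixes p i k :: nat
  assumes "prime p" "0 < i" "i < p ^ k"
  shows "p dvd (p ^ k choose i)"
proof (rule ccontr)
  assume "\<not> p dvd (p ^ k choose i)"
  then have "coprime (p ^ k) (p ^ k choose i)"
    using assms(1) by (simp add: prime_imp_coprime)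
  moreover have "i * (p ^ k choose i) = p ^ k * ((p ^ k - 1) choose (i - 1))"
    using assms by (intro times_binomial_minus1_eq)
  then have "p ^ k dvd i * (p ^ k choose i)"
    by simp
  ultimately have "p ^ k dvd i"
    using coprime_dvd_mult_left_iff by blast
  with assms show False
    using nat_dvd_not_less by blast
qed

text \<open>The new condition says that the coefficient is the neutral element of
  \<open>step_base\<close>, so each step is the kernel of the coefficient map on the preceding
  one.\<close>

lemma filt_step_Suc:
  "f \<in> filt_step R (Suc i) \<longleftrightarrow>
    f \<in> filt_step R i \<and> coef f (Suc i) = (if i = 0 then \<one>\<^bsub>R\<^esub> else \<zero>\<^bsub>R\<^esub>)"
proof (cases "i = 0")
  case False
  then have "2 \<le> Suc i"
    by simp
  then have *: "(\<forall>k. 2 \<le> k \<and> k \<le> Suc i \<longrightarrow> Q k) \<longleftrightarrow> (\<forall>k. 2 \<le> k \<and> k \<le> i \<longrightarrow> Q k) \<and> Q (Suc i)" for Q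
    by (metis le_Suc_eq le_refl)
  from False show ?thesis
    unfolding filt_step_def mem_Collect_eq * by auto
qed (auto simp: filt_step_def le_Suc_eq)

definition step_base :: "('b, 'm) ring_scheme \<Rightarrow> nat \<Rightarrow> 'b monoid" where
  "step_base R i =
    (if i = 0 then units_of R else \<lparr>carrier = carrier R, monoid.mult = add R, one = \<zero>\<^bsub>R\<^esub>\<rparr>)"

text \<open>With q = p^h, the coefficient at i + 1 is constrained by an equation in degree q (i +
  1), which is only imposed when that degree is at most N.\<close>

definition step_image :: "('b, 'm) ring_scheme \<Rightarrow> nat \<Rightarrow> nat \<Rightarrow> enat \<Rightarrow> nat \<Rightarrow> 'b set" where
  "step_image R p q N i =
    (if i = 0 then {a \<in> Units R. a [^]\<^bsub>R\<^esub> (q - 1) = \<one>\<^bsub>R\<^esub>}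
     else if \<exists>k. Suc i = p ^ k
     then if enat (q * Suc i) \<le> N then {a \<in> carrier R. a [^]\<^bsub>R\<^esub> q = a} else carrier R
     else {\<zero>\<^bsub>R\<^esub>})"

lemma (in cring) group_step_base: "group (step_base R i)"
proof (cases "i = 0")
  case True
  then show ?thesis by (simp add: step_base_def units_group)
next
  case False
  have "group \<lparr>carrier = carrier R, monoid.mult = add R, one = \<zero>\<rparr>"
  proof (rule groupI)
    fix x assume "x \<in> carrier \<lparr>carrier = carrier R, monoid.mult = add R, one = \<zero>\<rparr>"
    then show "\<exists>y\<in>carrier \<lparr>carrier = carrier R, monoid.mult = add R, one = \<zero>\<rparr>.
      y \<otimes>\<^bsub>\<lparr>carrier = carrier R, monoid.mult = add R, one = \<zero>\<rparr>\<^esub> x =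
      \<one>\<^bsub>\<lparr>carrier = carrier R, monoid.mult = add R, one = \<zero>\<rparr>\<^esub>"
      by (auto intro!: bexI[of _ "\<ominus> x"] simp: l_neg)
  qed (auto simp: a_assoc)
  with False show ?thesis by (simp add: step_base_def)
qed

context fgl_map
begin

lemma unit_map: "a * b - 1 \<in> ker \<Longrightarrow> \<phi> a \<in> Units R"
proof -
  assume "a * b - 1 \<in> ker"
  then have "\<phi> (a * b) = \<phi> 1"
    by (simp only: map_eq_iff)
  then have "\<phi> a \<otimes> \<phi> b = \<one>"
    by (simp add: map_mult)
  then show ?thesis
    by (auto simp: Units_def m_comm intro!: bexI[of _ "\<phi> b"])
qed

lemma filt_K:
  assumes "no_const s" "enat i \<le> N"
  shows "K s \<in> filt_step R i \<longleftrightarrow> i = 0 \<or> s - T \<in> J (Suc i)"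
proof -
  have cf_T: "cf T (\<lambda>_. k) = (if k = 1 then 1 else (0 :: 'b))" for k
    by (auto simp: cf_monom uvec_1 fun_eq_iff)
  have zero: "\<phi> a = \<zero> \<longleftrightarrow> a \<in> ker" and one: "\<phi> a = \<one> \<longleftrightarrow> a - 1 \<in> ker" for a
    using map_eq_iff[of a 0] map_eq_iff[of a 1] by auto
  show ?thesis
  proof (cases "i = 0")
    case False
    have le: "enat k \<le> N" if "k \<le> i" for k
      using assms(2) that by (meson enat_ord_simps(1) order_trans)
    have "s - T \<in> J (Suc i) \<longleftrightarrow> cf s (\<lambda>_. 1) - 1 \<in> ker \<and> (\<forall>k. 2 \<le> k \<and> k \<le> i \<longrightarrow> cf s (\<lambda>_. k) \<in> ker)"
      unfolding J_1_iff
    proof (intro iffI conjI allI impI)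
      assume *: "\<forall>k<Suc i. cf (s - T) (\<lambda>_. k) \<in> ker"
      show "cf s (\<lambda>_. 1) - 1 \<in> ker"
        using *[rule_format, of 1] False by (simp add: cf_T)
      show "cf s (\<lambda>_. k) \<in> ker" if "2 \<le> k \<and> k \<le> i" for k
        using *[rule_format, of k] that by (simp add: cf_T)
    next
      fix k assume *: "cf s (\<lambda>_. 1) - 1 \<in> ker \<and> (\<forall>k. 2 \<le> k \<and> k \<le> i \<longrightarrow> cf s (\<lambda>_. k) \<in> ker)" and "k < Suc i"
      then consider "k = 0" | "k = 1" | "2 \<le> k" "k \<le> i" by linarith
      then show "cf (s - T) (\<lambda>_. k) \<in> ker"
        using * assms(1) by cases (auto simp: cf_T)
    qed
    moreover have "K s \<in> filt_step R i \<longleftrightarrow>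
      \<phi> (cf s (\<lambda>_. 1)) = \<one> \<and> (\<forall>k. 2 \<le> k \<and> k \<le> i \<longrightarrow> \<phi> (cf s (\<lambda>_. k)) = \<zero>)"
      using False le by (auto simp: filt_step_def coef_K)
    ultimately show ?thesis
      using False by (simp add: zero one)
  qed (simp add: filt_step_def)
qed

text \<open>To first order, replacing T by t in s adds (t - T) times the linear coefficient of s,
  which is 1 modulo the kernel.\<close>

lemma coef_comp:
  assumes nc: "no_const s" "no_const t" and i: "i \<ge> 1" and s: "s - T \<in> J (Suc i)" and t: "t - T \<in> J (Suc i)"
  shows "cf (msubst s (uni t)) (\<lambda>_. Suc i) - (cf s (\<lambda>_. Suc i) + cf t (\<lambda>_. Suc i)) \<in> ker"
proof -
  have "monom (\<lambda>_. Suc 0) 1 \<in> J (Suc 0)"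
    by (rule no_const_J1') (simp add: cf_monom fun_eq_iff)
  then have "msubst s (uni t) - msubst s (uni T) - const (cf s (\<lambda>_. 1)) * (t - T) \<in> J (Suc i + 1)"
    using J_msubst_first_order[of "uni t" "uni T" "Suc i" s] nc t
    by (simp add: no_const_J1' UNIV_type_1 uvec_1)
  then have "cf (msubst s (uni t) - msubst s (uni T) - const (cf s (\<lambda>_. 1)) * (t - T)) (\<lambda>_. Suc i) \<in> ker"
    by (rule JD) (simp add: deg_exponent_1)
  then have 1: "cf (msubst s (uni t)) (\<lambda>_. Suc i) - cf s (\<lambda>_. Suc i) - cf s (\<lambda>_. 1) * cf t (\<lambda>_. Suc i) \<in> ker"
    using i by (simp only: msubst_T) (simp add: cf_monom uvec_1 fun_eq_iff)
  have "cf (s - T) (\<lambda>_. 1) \<in> ker"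
    by (rule JD[OF s]) (use i in \<open>simp add: deg_exponent_1\<close>)
  then have "cf s (\<lambda>_. 1) - 1 \<in> ker"
    by (simp add: cf_monom uvec_1)
  then have 2: "(cf s (\<lambda>_. 1) - 1) * cf t (\<lambda>_. Suc i) \<in> ker"
    by (rule I_mult_right)
  from I_add[OF 1 2] show ?thesis
    by (simp add: algebra_simps)
qed

text \<open>In degree 1 both H and f are linear, so they commute. This starts the lifting for i =
  0.\<close>

lemma defect_linear:
  assumes "no_const f"
  shows "defect f \<in> J 2"
proof -
  have "msubst f (uni HA) - msubst f (uni (x\<^sub>1 + x\<^sub>2)) \<in> J 2"
    using fadd_linear[of x\<^sub>1 x\<^sub>2] by (intro J_diff_msubst_right) (auto simp: fadd_x no_const_J1')
  moreover have lin: "msubst f (uni s) - const (cf f (\<lambda>_. 1)) * s \<in> J 2" if "no_const s" for s :: "(2, 'b) mps"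
  proof -
    have "msubst f (uni s) - msubst f (uni 0) - const (cf f (\<lambda>_. 1)) * (s - 0) \<in> J (1 + 1)"
      using J_msubst_first_order[of "uni s" "uni (0 :: (2, 'b) mps)" 1 f] that
      by (simp add: no_const_J1' UNIV_type_1 uvec_1)
    then show ?thesis
      using assms by (simp add: msubst_at_0 numeral_2_eq_2)
  qed
  ultimately have 1: "msubst f (uni HA) - const (cf f (\<lambda>_. 1)) * (x\<^sub>1 + x\<^sub>2) \<in> J 2"
    using J_diff_trans lin[of "x\<^sub>1 + x\<^sub>2"] by fastforce
  have 2: "msubst HA (pair (msubst f (uni x\<^sub>1)) (msubst f (uni x\<^sub>2))) - (msubst f (uni x\<^sub>1) + msubst f (uni x\<^sub>2)) \<in> J 2"
    using assms by (intro fadd_linear) auto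
  have 3: "msubst f (uni x\<^sub>1) - const (cf f (\<lambda>_. 1)) * x\<^sub>1 \<in> J 2" "msubst f (uni x\<^sub>2) - const (cf f (\<lambda>_. 1)) * x\<^sub>2 \<in> J 2"
    by (rule lin; simp)+
  from J_diff[OF 1 J_add[OF 2 J_add[OF 3]]] show ?thesis
    by (simp add: defect_def algebra_simps)
qed

text \<open>The middle binomial coefficients of p^k vanish modulo p, so the new term leaves the
  degree p^k of the defect unchanged. This starts the lifting for i = p^k - 1.\<close>

lemma defect_T_plus_power:
  assumes "k \<ge> 1"
  shows "defect (T + monom (\<lambda>_. p ^ k) c) \<in> J (Suc (p ^ k))"
proof -
  define m where "m = p ^ k"
  have m: "m \<ge> 1" by (simp add: m_def Suc_le_eq)
  let ?B = "(x\<^sub>1 + x\<^sub>2) ^ m - x\<^sub>1 ^ m - x\<^sub>2 ^ m :: (2, 'b) mps"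
  have "?B \<in> J (m + 1)"
  proof (rule JI)
    fix \<beta> :: "2 \<Rightarrow> nat"
    have \<beta>: "\<beta> = pair (\<beta> 0) (\<beta> 1)"
      by (simp add: exponent_2_eq_iff)
    have "of_nat (m choose \<beta> 0) \<in> ker" if "1 \<le> \<beta> 0" "\<beta> 0 < m"
    proof (rule of_nat_dvd_I)
      show "p dvd (m choose \<beta> 0)"
        unfolding m_def using prime_dvd_choose_prime_power[OF prime_p, of "\<beta> 0" k] that by (simp add: m_def)
    qed
    moreover have "cf ?B \<beta> = (if \<beta> 0 + \<beta> 1 = m \<and> 1 \<le> \<beta> 0 \<and> 1 \<le> \<beta> 1 then of_nat (m choose \<beta> 0) else 0)"
      by (subst \<beta>) (rule cf_binomial_defect[OF m])
    ultimately show "cf ?B \<beta> \<in> ker" by auto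
  qed
  then have "const c * ?B \<in> J (m + 1)"
    by (rule J_mult_left)
  from J_add[OF defect_change[of T m c] this] m show ?thesis
    by (simp add: defect_T m_def)
qed

end

context fgl_cover
begin

lemma G_hom_step:
  assumes i: "enat (Suc i) \<le> N" and f: "f \<in> carrier G \<inter> filt_step R i" and g: "g \<in> carrier G \<inter> filt_step R i"
  shows "coef (f \<otimes>\<^bsub>G\<^esub> g) (Suc i) = coef f (Suc i) \<otimes>\<^bsub>step_base R i\<^esub> coef g (Suc i)"
    and "coef f (Suc i) \<in> carrier (step_base R i)"
proof -
  obtain s t where s: "f = K s" "s \<in> autos" and t: "g = K t" "t \<in> autos"
    using f g by (auto simp: carrier_G)
  have i': "enat i \<le> N"
    using i by (meson enat_ord_simps(1) order_trans le_SucI order_refl)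
  have fg: "coef (f \<otimes>\<^bsub>G\<^esub> g) (Suc i) = \<phi> (cf (msubst s (uni t)) (\<lambda>_. Suc i))"
    using s t i by (simp add: mult_G coef_K no_const_autos)
  have cf: "coef f (Suc i) = \<phi> (cf s (\<lambda>_. Suc i))" "coef g (Suc i) = \<phi> (cf t (\<lambda>_. Suc i))"
    using s t i by (simp_all add: coef_K)
  show "coef (f \<otimes>\<^bsub>G\<^esub> g) (Suc i) = coef f (Suc i) \<otimes>\<^bsub>step_base R i\<^esub> coef g (Suc i)"
  proof (cases "i = 0")
    case True
    then show ?thesis
      using cf_msubst_linear[of s t] s t unfolding fg cf
      by (simp add: step_base_def units_of_def map_mult no_const_autos)
  next
    case False
    then have "s - T \<in> J (Suc i)" "t - T \<in> J (Suc i)"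
      using f g s t filt_K[OF _ i'] by (auto intro: no_const_autos)
    then have "\<phi> (cf (msubst s (uni t)) (\<lambda>_. Suc i)) = \<phi> (cf s (\<lambda>_. Suc i) + cf t (\<lambda>_. Suc i))"
      using coef_comp[of s t i] s t False by (simp add: map_eq_iff no_const_autos)
    with False show ?thesis
      unfolding fg cf by (simp add: step_base_def map_add)
  qed
  show "coef f (Suc i) \<in> carrier (step_base R i)"
  proof (cases "i = 0")
    case True
    then show ?thesis
      using s(2) unit_map unfolding cf by (auto simp: step_base_def units_of_def autos_def)
  next
    case False
    then show ?thesis unfolding cf by (simp add: step_base_def)
  qed
qed

lemma kernel_step:
  "kernel (G\<lparr>carrier := carrier G \<inter> filt_step R i\<rparr>) (step_base R i) (\<lambda>f. coef f (Suc i)) =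
    carrier G \<inter> filt_step R (Suc i)"
  by (auto simp: kernel_def filt_step_Suc step_base_def units_of_def)

text \<open>Induction along the filtration, each step being the kernel of a homomorphism on the
  preceding one.\<close>

lemma subgroup_filt: "enat i \<le> N \<Longrightarrow> subgroup (carrier G \<inter> filt_step R i) G"
proof (induction i)
  case 0
  then show ?case
    using group.subgroup_self[OF group_G] by (simp add: filt_step_def)
next
  case (Suc i)
  interpret G: group G by (rule group_G)
  let ?A = "G\<lparr>carrier := carrier G \<inter> filt_step R i\<rparr>"
  have sub: "subgroup (carrier G \<inter> filt_step R i) G"
    using Suc by (meson enat_ord_simps(1) order_trans le_SucI order_refl)
  have A: "group ?A" by (rule G.subgroup_imp_group[OF sub])
  have "(\<lambda>f. coef f (Suc i)) \<in> hom ?A (step_base R i)"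
    using G_hom_step[OF Suc(2)] by (auto simp: hom_def)
  then have "group_hom ?A (step_base R i) (\<lambda>f. coef f (Suc i))"
    using A group_step_base by (simp add: group_hom_def group_hom_axioms_def)
  from group_hom.subgroup_kernel[OF this] show ?case
    unfolding kernel_step by (rule G.incl_subgroup[OF sub])
qed

lemma group_hom_step:
  assumes "enat (Suc i) \<le> N"
  shows "group_hom (G\<lparr>carrier := carrier G \<inter> filt_step R i\<rparr>) (step_base R i) (\<lambda>f. coef f (Suc i))"
proof -
  interpret G: group G by (rule group_G)
  have "subgroup (carrier G \<inter> filt_step R i) G"
    using assms by (intro subgroup_filt) (meson enat_ord_simps(1) order_trans le_SucI order_refl)
  then have "group (G\<lparr>carrier := carrier G \<inter> filt_step R i\<rparr>)"
    by (rule G.subgroup_imp_group)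
  then show ?thesis
    using G_hom_step[OF assms] group_step_base
    by (auto simp: group_hom_def group_hom_axioms_def hom_def)
qed

lemma step_image_lift:
  assumes i: "enat (Suc i) \<le> N" and q: "enat (p ^ h) \<le> N" and a: "a \<in> step_image R p (p ^ h) N i"
  obtains s where "s \<in> autos" "i = 0 \<or> s - T \<in> J (Suc i)" "\<phi> (cf s (\<lambda>_. Suc i)) = a"
proof -
  have q0: "p ^ h > 0" by simp
  have "a \<in> carrier R"
    using a by (auto simp: step_image_def split: if_splits)
  then obtain \<alpha> where \<alpha>: "\<phi> \<alpha> = a" using map_surj by blast
  have fix_iff: "\<alpha> ^ (p ^ h) - \<alpha> \<in> ker" if "a [^] (p ^ h) = a"
    using that unfolding map_eq_iff[symmetric] by (simp add: map_power \<alpha>)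
  consider "i = 0" | k where "i \<noteq> 0" "Suc i = p ^ k" | "i \<noteq> 0" "\<forall>k. Suc i \<noteq> p ^ k" by blast
  then show ?thesis
  proof cases
    case 1
    have au: "a \<in> Units R" "a [^] (p ^ h - 1) = \<one>"
      using a 1 by (auto simp: step_image_def)
    \<comment> \<open>A root of unity of order dividing p^h - 1 satisfies the equation that lifting
      imposes at the power p^0 = 1.\<close>
    have "a [^] (p ^ h) = a [^] Suc (p ^ h - 1)"
      using q0 by (simp only: Suc_diff_1)
    also have "\<dots> = a"
      using au \<open>a \<in> carrier R\<close> by (simp only: nat_pow_Suc) simp
    finally have fr: "\<alpha> ^ (p ^ h) - \<alpha> \<in> ker"
      by (rule fix_iff)
    \<comment> \<open>The start is \<alpha> T; its coefficients at p^k with k >= 1 are 0 and satisfy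
      the equation trivially.\<close>
    define f0 where "f0 = (monom (\<lambda>_. 1) \<alpha> :: (1, 'b) mps)"
    have nc: "no_const f0"
      by (simp add: f0_def cf_monom fun_eq_iff)
    have "enat 2 \<le> eSuc N"
      using N_ge_1 by (metis eSuc_ile_mono eSuc_enat numeral_2_eq_2 one_enat_def One_nat_def)
    then obtain f :: "(1, 'b) mps" where f: "no_const f" "\<And>k. k < 2 \<Longrightarrow> cf f (\<lambda>_. k) = cf f0 (\<lambda>_. k)"
      "\<And>m. enat m \<le> eSuc N \<Longrightarrow> defect f \<in> J m"
    proof (rule defect_lift[OF nc defect_linear[OF nc]])
      fix k assume "enat (p ^ k * p ^ h) \<le> N"
      show "cf f0 (\<lambda>_. p ^ k) ^ (p ^ h) - cf f0 (\<lambda>_. p ^ k) \<in> ker"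
        using fr p_gt_1 by (simp add: f0_def cf_monom fun_eq_iff power_0_left)
    qed auto
    have f1: "cf f (\<lambda>_. 1) = \<alpha>"
      using f(2)[of 1] by (simp add: f0_def cf_monom)
    obtain b where b: "b \<in> carrier R" "a \<otimes> b = \<one>"
      using au by (auto simp: Units_def)
    then obtain \<beta> where "\<phi> \<beta> = b" using map_surj by blast
    then have "\<phi> (\<alpha> * \<beta>) = \<phi> 1"
      using b \<alpha> by (simp add: map_mult)
    then have "\<alpha> * \<beta> - 1 \<in> ker"
      by (simp only: map_eq_iff)
    then have "f \<in> autos"
      using f f1 by (auto simp: autos_def)
    with that[of f] 1 f1 \<alpha> show ?thesis by simp
  next
    case (2 k)
    then have k: "k \<ge> 1"
      by (cases k) auto
    \<comment> \<open>The defect already vanishes through degree i + 1, so lifting begins in degree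
      i + 2 and keeps \<alpha>. If p^h (i + 1) exceeds N, no condition on \<alpha> arises.\<close>
    define f0 where "f0 = (T + monom (\<lambda>_. Suc i) \<alpha> :: (1, 'b) mps)"
    have nc: "no_const f0"
      by (simp add: f0_def cf_monom fun_eq_iff uvec_1)
    have cf0: "cf f0 (\<lambda>_. j) = (if j = 1 then 1 else if j = Suc i then \<alpha> else 0)" for j
      using 2(1) by (auto simp: f0_def cf_monom fun_eq_iff uvec_1)
    have "enat (Suc (Suc i)) \<le> eSuc N" "Suc (Suc i) \<ge> 2"
      using i by (auto simp flip: eSuc_enat)
    then obtain f :: "(1, 'b) mps" where f: "no_const f" "\<And>j. j < Suc (Suc i) \<Longrightarrow> cf f (\<lambda>_. j) = cf f0 (\<lambda>_. j)"
      "\<And>m. enat m \<le> eSuc N \<Longrightarrow> defect f \<in> J m"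
    proof (rule defect_lift[OF nc defect_T_plus_power[OF k, of \<alpha>, folded 2(2), folded f0_def]])
      fix j assume j: "enat (p ^ j * p ^ h) \<le> N"
      have "\<alpha> ^ (p ^ h) - \<alpha> \<in> ker" if "p ^ j = Suc i"
        by (rule fix_iff) (use a 2 j that in \<open>auto simp: step_image_def mult.commute split: if_splits\<close>)
      then show "cf f0 (\<lambda>_. p ^ j) ^ (p ^ h) - cf f0 (\<lambda>_. p ^ j) \<in> ker"
        using p_gt_1 by (simp add: cf0 power_0_left)
    qed auto
    have "f \<in> autos"
      using f f(2)[of 1] cf0[of 1] by (auto simp: autos_def intro!: exI[of _ 1])
    moreover have "f - T \<in> J (Suc i)"
      unfolding J_1_iff
    proof (intro allI impI)
      fix j assume "j < Suc i"
      then show "cf (f - T) (\<lambda>_. j) \<in> ker"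
        using f(2)[of j] by (simp add: cf0 cf_monom uvec_1 fun_eq_iff)
    qed
    moreover have "cf f (\<lambda>_. Suc i) = \<alpha>"
      using 2(1) f(2)[of "Suc i"] cf0[of "Suc i"] by simp
    ultimately show ?thesis
      using that[of f] \<alpha> by simp
  next
    case 3
    then have "a = \<zero>"
      using a by (auto simp: step_image_def)
    then have "\<phi> (cf T (\<lambda>_. Suc i)) = a"
      using 3 by (simp add: cf_monom uvec_1 fun_eq_iff)
    then show ?thesis
      by (intro that[OF T_autos]) simp_all
  qed
qed

text \<open>\<open>coef_power\<close> applies whenever p^h (i + 1) is at most N. For i = 0 this is
  the hypothesis on p^h, and the unit a cancels from a^(p^h) = a. If i + 1 is not a power of p,
  \<open>coef_not_power\<close> applies.\<close>

lemma coef_in_step_image: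
  assumes i: "enat (Suc i) \<le> N" and q: "enat (p ^ h) \<le> N"
    and s: "s \<in> autos" "i = 0 \<or> s - T \<in> J (Suc i)"
  shows "\<phi> (cf s (\<lambda>_. Suc i)) \<in> step_image R p (p ^ h) N i"
proof -
  define a where "a = \<phi> (cf s (\<lambda>_. Suc i))"
  have nc: "no_const s" using s by (simp add: no_const_autos)
  have D: "defect s \<in> J (Suc m)" if "enat m \<le> N" for m
    using s(1) that by (auto simp: autos_def simp flip: eSuc_enat)
  have fr: "a [^] (p ^ h) = a" if "enat (p ^ h * Suc i) \<le> N"
  proof -
    have "cf s (\<lambda>_. Suc i) ^ (p ^ h) - cf s (\<lambda>_. Suc i) \<in> ker"
      using coef_power[OF nc D[OF that], of "Suc i"] by simp
    then show ?thesis
      by (simp only: a_def map_eq_iff map_power[symmetric])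
  qed
  consider "i = 0" | k where "i \<noteq> 0" "Suc i = p ^ k" | "i \<noteq> 0" "\<forall>k. Suc i \<noteq> p ^ k" by blast
  then show ?thesis
  proof cases
    case 1
    have U: "a \<in> Units R"
      using s(1) 1 unit_map by (auto simp: autos_def a_def)
    have "p ^ h > 0" by simp
    then have "a [^] Suc (p ^ h - 1) = a"
      using fr 1 q by (simp only: Suc_diff_1) simp
    then have "a [^] (p ^ h - 1) \<otimes> a = \<one> \<otimes> a"
      using U by (simp only: nat_pow_Suc) (simp add: Units_closed)
    then have "a [^] (p ^ h - 1) = \<one>"
      using U by (metis Units_closed m_comm nat_pow_closed one_closed Units_l_cancel)
    with U 1 show ?thesis
      by (simp add: step_image_def a_def)
  next
    case (2 k)
    then show ?thesis
      using fr by (auto simp: step_image_def a_def)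
  next
    case 3
    have "cf s (\<lambda>_. Suc i) \<in> ker"
      using coef_not_power[OF nc _ _ _ , of "Suc i"] D[OF i] s 3 by auto
    then have "a = \<zero>" by (simp add: a_def ker_def)
    with 3 show ?thesis by (auto simp: step_image_def a_def)
  qed
qed

lemma image_step:
  assumes i: "enat (Suc i) \<le> N" and q: "enat (p ^ h) \<le> N"
  shows "(\<lambda>f. coef f (Suc i)) ` (carrier G \<inter> filt_step R i) = step_image R p (p ^ h) N i"
proof -
  have i': "enat i \<le> N"
    using i by (meson enat_ord_simps(1) order_trans le_SucI order_refl)
  show ?thesis
  proof (intro equalityI subsetI)
    fix a assume "a \<in> (\<lambda>f. coef f (Suc i)) ` (carrier G \<inter> filt_step R i)"
    then obtain s where "s \<in> autos" "K s \<in> filt_step R i" "a = coef (K s) (Suc i)"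
      by (auto simp: carrier_G)
    then show "a \<in> step_image R p (p ^ h) N i"
      using coef_in_step_image[OF i q, of s] filt_K[OF _ i', of s] i by (simp add: coef_K no_const_autos)
  next
    fix a assume "a \<in> step_image R p (p ^ h) N i"
    then obtain s where "s \<in> autos" "i = 0 \<or> s - T \<in> J (Suc i)" "\<phi> (cf s (\<lambda>_. Suc i)) = a"
      by (rule step_image_lift[OF i q])
    then show "a \<in> (\<lambda>f. coef f (Suc i)) ` (carrier G \<inter> filt_step R i)"
      using filt_K[OF _ i', of s] i K_autos by (intro image_eqI[of _ _ "K s"]) (auto simp: coef_K no_const_autos)
  qed
qed

end

section \<open>Global sections of schemes over the prime field\<close>

lemma (in field) primeideal_eq_zero:
  assumes "primeideal P R"
  shows "P = {\<zero>}"
proof -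
  interpret P: primeideal P R by fact
  have "x = \<zero>" if "x \<in> P" for x
  proof (rule ccontr)
    assume "x \<noteq> \<zero>"
    then have U: "x \<in> Units R"
      using that P.Icarr field_Units by auto
    then have "inv x \<otimes> x \<in> P"
      using that P.I_l_closed by blast
    then have "\<one> \<in> P"
      using U by simp
    then show False
      using P.one_imp_carrier P.I_notcarr by simp
  qed
  moreover have "\<zero> \<in> P"
    using P.additive_subgroup_axioms additive_subgroup.zero_closed by blast
  ultimately show ?thesis by blast
qed

text \<open>Serves to show that the constants of a field map homomorphically to the global sections
  of its spectrum, whose only possible point is the zero ideal.\<close>

locale field_Spec = field A for A :: "'a ring" (structure)
begin

lemma mem_lfrac_iff:
  assumes "a \<in> carrier A" "s \<in> carrier A"
  shows "(b, t) \<in> lfrac A {\<zero>} a s \<longleftrightarrow>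
    b \<in> carrier A \<and> t \<in> carrier A \<and> t \<noteq> \<zero> \<and> a \<otimes> t = b \<otimes> s"
proof -
  have "(\<exists>u\<in>carrier A - {\<zero>}. u \<otimes> (a \<otimes> t \<ominus> b \<otimes> s) = \<zero>) \<longleftrightarrow> a \<otimes> t = b \<otimes> s"
    if "b \<in> carrier A" "t \<in> carrier A"
  proof
    assume "\<exists>u\<in>carrier A - {\<zero>}. u \<otimes> (a \<otimes> t \<ominus> b \<otimes> s) = \<zero>"
    then obtain u where "u \<in> carrier A" "u \<noteq> \<zero>" "u \<otimes> (a \<otimes> t \<ominus> b \<otimes> s) = \<zero>"
      by auto
    then have "a \<otimes> t \<ominus> b \<otimes> s = \<zero>"
      using integral[of u] that assms by auto
    then show "a \<otimes> t = b \<otimes> s"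
      using that assms by (simp add: r_right_minus_eq)
  next
    assume "a \<otimes> t = b \<otimes> s"
    then show "\<exists>u\<in>carrier A - {\<zero>}. u \<otimes> (a \<otimes> t \<ominus> b \<otimes> s) = \<zero>"
      using that assms by (intro bexI[of _ \<one>]) (auto simp: r_right_minus_eq)
  qed
  then show ?thesis
    by (auto simp: lfrac_def)
qed

lemma lfrac_nonempty: "a \<in> carrier A \<Longrightarrow> (a, \<one>) \<in> lfrac A {\<zero>} a \<one>"
  by (simp add: mem_lfrac_iff)

lemma lfrac_cancel:
  assumes "a \<in> carrier A" "s \<in> carrier A" "s \<noteq> \<zero>"
  shows "lfrac A {\<zero>} (a \<otimes> s) s = lfrac A {\<zero>} a \<one>"
proof -
  have "(a \<otimes> s) \<otimes> t = b \<otimes> s \<longleftrightarrow> a \<otimes> t = b" if "b \<in> carrier A" "t \<in> carrier A" for b t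
  proof -
    have "(a \<otimes> s) \<otimes> t = (a \<otimes> t) \<otimes> s"
      using assms that by (simp add: m_assoc m_comm[of s t])
    then show ?thesis
      using assms that by (simp add: m_rcancel)
  qed
  then show ?thesis
    using assms by (auto simp: mem_lfrac_iff)
qed

text \<open>The operations of \<open>localization\<close> are unions over all pairs of
  representatives. Those of a / 1 are the pairs (a s, s), and if all of them give the same class,
  the union is that class.\<close>

lemma lfrac_UN:
  assumes "a \<in> carrier A" "b \<in> carrier A"
    and "\<And>s t. s \<in> carrier A \<Longrightarrow> t \<in> carrier A \<Longrightarrow> s \<noteq> \<zero> \<Longrightarrow> t \<noteq> \<zero> \<Longrightarrow> F (a \<otimes> s) s (b \<otimes> t) t = C"
  shows "(\<Union>(a', s)\<in>lfrac A {\<zero>} a \<one>. \<Union>(b', t)\<in>lfrac A {\<zero>} b \<one>. F a' s b' t) = C"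
proof -
  have "F a' s b' t = C" if "(a', s) \<in> lfrac A {\<zero>} a \<one>" "(b', t) \<in> lfrac A {\<zero>} b \<one>" for a' s b' t
  proof -
    have "a' = a \<otimes> s" "b' = b \<otimes> t" "s \<in> carrier A" "t \<in> carrier A" "s \<noteq> \<zero>" "t \<noteq> \<zero>"
      using that assms(1,2) by (auto simp: mem_lfrac_iff)
    then show ?thesis using assms(3) by simp
  qed
  then show ?thesis
    using lfrac_nonempty[OF assms(1)] lfrac_nonempty[OF assms(2)] by fastforce
qed

lemma localization_mult:
  assumes "a \<in> carrier A" "b \<in> carrier A"
  shows "lfrac A {\<zero>} a \<one> \<otimes>\<^bsub>localization A {\<zero>}\<^esub> lfrac A {\<zero>} b \<one> = lfrac A {\<zero>} (a \<otimes> b) \<one>"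
proof -
  have "lfrac A {\<zero>} ((a \<otimes> s) \<otimes> (b \<otimes> t)) (s \<otimes> t) = lfrac A {\<zero>} (a \<otimes> b) \<one>"
    if "s \<in> carrier A" "t \<in> carrier A" "s \<noteq> \<zero>" "t \<noteq> \<zero>" for s t
  proof -
    have "(a \<otimes> s) \<otimes> (b \<otimes> t) = (a \<otimes> b) \<otimes> (s \<otimes> t)"
      using assms that by (simp add: m_ac)
    moreover have "s \<otimes> t \<noteq> \<zero>"
      using that integral by blast
    ultimately show ?thesis
      using lfrac_cancel[of "a \<otimes> b" "s \<otimes> t"] assms that by simp
  qed
  then show ?thesis
    unfolding localization_def using assms by (simp add: lfrac_UN)
qed

lemma localization_add:
  assumes "a \<in> carrier A" "b \<in> carrier A"
  shows "lfrac A {\<zero>} a \<one> \<oplus>\<^bsub>localization A {\<zero>}\<^esub> lfrac A {\<zero>} b \<one> = lfrac A {\<zero>} (a \<oplus> b) \<one>"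
proof -
  have "lfrac A {\<zero>} ((a \<otimes> s) \<otimes> t \<oplus> (b \<otimes> t) \<otimes> s) (s \<otimes> t) = lfrac A {\<zero>} (a \<oplus> b) \<one>"
    if "s \<in> carrier A" "t \<in> carrier A" "s \<noteq> \<zero>" "t \<noteq> \<zero>" for s t
  proof -
    have "(a \<otimes> s) \<otimes> t \<oplus> (b \<otimes> t) \<otimes> s = (a \<oplus> b) \<otimes> (s \<otimes> t)"
      using assms that by (simp add: l_distr m_assoc m_comm[of t s])
    moreover have "s \<otimes> t \<noteq> \<zero>"
      using that integral by blast
    ultimately show ?thesis
      using lfrac_cancel[of "a \<oplus> b" "s \<otimes> t"] assms that by simp
  qed
  then show ?thesis
    unfolding localization_def using assms by (simp add: lfrac_UN)
qed

lemma mem_Spec: "P \<in> topspace (spec_top A) \<Longrightarrow> P = {\<zero>}"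
  using primeideal_eq_zero by (auto simp: spec_top_def topology_generated_by_topspace)

text \<open>The global section with value c / 1 everywhere; \<open>scalar\<close> is its pullback
  along the structure morphism.\<close>

definition canonical :: "'a \<Rightarrow> 'a set \<Rightarrow> ('a \<times> 'a) set" where
  "canonical c = (\<lambda>P\<in>topspace (spec_top A). lfrac A P c \<one>)"

lemma canonical_hom: "canonical \<in> ring_hom A (sec (Spec A) (topspace (spec_top A)))"
proof (rule ring_hom_memI)
  fix c assume c: "c \<in> carrier A"
  have "lfrac A P c \<one> \<in> carrier (localization A P)" if "P \<in> topspace (spec_top A)" for P
  proof -
    have "\<one> \<in> carrier A - P"
      using mem_Spec[OF that] by simp
    with c show ?thesis
      unfolding localization_def partial_object.select_convs by blast
  qed
  moreover have "\<exists>V a s. openin (spec_top A) V \<and> P \<in> V \<and> V \<subseteq> topspace (spec_top A) \<and> a \<in> carrier A \<and>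
      s \<in> carrier A \<and> (\<forall>Q\<in>V. s \<notin> Q \<and> canonical c Q = lfrac A Q a s)" if "P \<in> topspace (spec_top A)" for P
    using that c by (intro exI[of _ "topspace (spec_top A)"] exI[of _ c] exI[of _ \<one>])
      (auto simp: canonical_def dest: mem_Spec)
  ultimately show "canonical c \<in> carrier (sec (Spec A) (topspace (spec_top A)))"
    by (auto simp: Spec_def spec_sections_def canonical_def)
next
  fix c d assume cd: "c \<in> carrier A" "d \<in> carrier A"
  have "canonical c P \<otimes>\<^bsub>localization A P\<^esub> canonical d P = lfrac A P (c \<otimes> d) \<one> \<and>
    canonical c P \<oplus>\<^bsub>localization A P\<^esub> canonical d P = lfrac A P (c \<oplus> d) \<one>"
    if P: "P \<in> topspace (spec_top A)" for P
  proof -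
    have "canonical c P = lfrac A {\<zero>} c \<one>" "canonical d P = lfrac A {\<zero>} d \<one>"
      using P mem_Spec[OF P] by (simp_all add: canonical_def)
    then show ?thesis
      using cd mem_Spec[OF P] by (simp add: localization_mult localization_add)
  qed
  then show "canonical (c \<otimes> d) = canonical c \<otimes>\<^bsub>sec (Spec A) (topspace (spec_top A))\<^esub> canonical d"
    "canonical (c \<oplus> d) = canonical c \<oplus>\<^bsub>sec (Spec A) (topspace (spec_top A))\<^esub> canonical d"
    by (simp_all add: Spec_def canonical_def[of "c \<otimes> d"] canonical_def[of "c \<oplus> d"] cong: restrict_cong)
next
  show "canonical \<one> = \<one>\<^bsub>sec (Spec A) (topspace (spec_top A))\<^esub>"
    by (auto simp: Spec_def canonical_def localization_def)
qed

end

section \<open>Global sections and base change of the law\<close>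

lemma preim_topspace: "lrs_mor V W f \<Longrightarrow> preim V f (topspace (rtop W)) = topspace (rtop V)"
  by (auto simp: lrs_mor_def preim_def continuous_map_def)

lemma lrs_mor_global:
  "lrs_mor V W f \<Longrightarrow> pull f (topspace (rtop W)) \<in> ring_hom (sec W (topspace (rtop W))) (sec V (topspace (rtop V)))"
  using preim_topspace[of V W f] by (auto simp: lrs_mor_def)

lemma cring_Gam: "is_fp_scheme p S \<Longrightarrow> cring (Gam S)"
  by (auto simp: is_fp_scheme_def scheme_def locally_ringed_space_def ringed_space_def Gam_def)

lemma scalar_hom:
  assumes "prime p" "is_fp_scheme p S"
  shows "scalar p S \<in> ring_hom (prime_field p) (Gam S)"
proof -
  interpret residues_prime p "prime_field p"
    by unfold_locales (use assms in auto)
  interpret F: field_Spec "prime_field p"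
    by (simp add: field_Spec_def is_field)
  have "pull (struct S) (topspace (spec_top (prime_field p))) \<in>
    ring_hom (sec (Spec (prime_field p)) (topspace (spec_top (prime_field p)))) (Gam S)"
    using lrs_mor_global[of "total S" "Spec (prime_field p)" "struct S"] assms(2)
    by (simp add: is_fp_scheme_def Gam_def Spec_def)
  from ring_hom_trans[OF F.canonical_hom this] show ?thesis
    by (simp add: scalar_def[abs_def] F.canonical_def[abs_def] comp_def)
qed

lemma Gam_map_hom: "is_fp_mor p S' S g \<Longrightarrow> Gam_map S g \<in> ring_hom (Gam S) (Gam S')"
  using lrs_mor_global by (auto simp: is_fp_mor_def Gam_map_def Gam_def)

lemma Gam_map_id: "Gam_map S rmor_id s = s"
  by (simp add: Gam_map_def rmor_id_def)

lemma Gam_map_comp: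
  "is_fp_mor p S' S g \<Longrightarrow> Gam_map S (rmor_comp (total S') g g') s = Gam_map S' g' (Gam_map S g s)"
  by (simp add: Gam_map_def rmor_comp_def is_fp_mor_def preim_topspace)

text \<open>Both maps are additive and preserve 1, hence agree on the multiples of 1. The multiple p
  is 0 in the prime field.\<close>

lemma scalar_eq_map:
  fixes \<phi> :: "'c::comm_ring_1 \<Rightarrow> 'b" and S :: "('a, 'b) fp_scheme"
  assumes p: "prime p" and S: "is_fp_scheme p S" and \<phi>: "cring_map (Gam S) \<phi>"
  shows "\<phi> (of_nat p) = \<zero>\<^bsub>Gam S\<^esub>"
    and "c \<in> {0..int p - 1} \<Longrightarrow> scalar p S c = \<phi> (of_int c)"
proof -
  interpret cring_map "Gam S" \<phi> by fact
  interpret F: residues_prime p "prime_field p"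
    by unfold_locales (use assms in auto)
  have hom: "scalar p S \<in> ring_hom (prime_field p) (Gam S)"
    by (rule scalar_hom[OF p S])
  have p1: "int p > 1" using p prime_gt_1_nat by auto
  have zero: "scalar p S 0 = \<zero>\<^bsub>Gam S\<^esub>"
    using ring_hom_zero[OF hom F.ring_axioms ring_axioms] by (simp add: F.res_zero_eq)
  have nat: "scalar p S (int k mod int p) = \<phi> (of_nat k)" for k
  proof (induction k)
    case (Suc k)
    have "int (Suc k) mod int p = (int k mod int p) \<oplus>\<^bsub>prime_field p\<^esub> 1"
      by (simp add: F.res_add_eq mod_simps add.commute)
    moreover have "int k mod int p \<in> carrier (prime_field p)" "1 \<in> carrier (prime_field p)"
      using p1 by (auto simp: F.res_carrier_eq)
    ultimately have "scalar p S (int (Suc k) mod int p) = scalar p S (int k mod int p) \<oplus>\<^bsub>Gam S\<^esub> scalar p S 1"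
      using ring_hom_add[OF hom] by simp
    also have "scalar p S 1 = \<one>\<^bsub>Gam S\<^esub>"
      using ring_hom_one[OF hom] p1 by (simp add: F.res_one_eq)
    finally show ?case
      using Suc by (simp add: map_add a_comm)
  qed (simp add: zero)
  from nat[of p] zero show "\<phi> (of_nat p) = \<zero>\<^bsub>Gam S\<^esub>" by simp
  assume c: "c \<in> {0..int p - 1}"
  then have "int (nat c) mod int p = c" "of_nat (nat c) = (of_int c :: 'c)"
    by (auto simp: mod_pos_pos_trivial)
  with nat[of "nat c"] show "scalar p S c = \<phi> (of_int c)"
    by simp
qed

lemma base_change_eq:
  assumes "prime p" "is_fp_scheme p S" "cring_map (Gam S) \<phi>" "H \<in> carrier (PS (prime_field p))"
  shows "base_change p (gtrunc (prime_field p) N H) S =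
    gtrunc (Gam S) N (cring_map.Phi \<phi> (mps_of_int (Mps H)))"
proof
  fix \<beta> :: "2 \<Rightarrow> nat"
  interpret cring_map "Gam S" \<phi> by fact
  interpret F: residues_prime p "prime_field p"
    by unfold_locales (use assms in auto)
  have p1: "int p > 1" using assms(1) prime_gt_1_nat by auto
  have "H \<beta> \<in> {0..int p - 1}"
    using assms(4) by (auto simp: PS_def F.res_carrier_eq)
  then show "base_change p (gtrunc (prime_field p) N H) S \<beta> = gtrunc (Gam S) N (Phi (mps_of_int (Mps H))) \<beta>"
    using scalar_eq_map(2)[OF assms(1-3)] scalar_eq_map(2)[OF assms(1-3), of 0] p1
    by (auto simp: base_change_def gtrunc_def Phi_def F.res_zero_eq)
qed

section \<open>Filtrations with a surjective leading coefficient\<close>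

text \<open>The presheaf-theoretic part in the abstract: M is the group containing the coefficients,
  T the image in it, and B the kernel in A of the coefficient map.\<close>

locale coef_steps =
  fixes p i :: nat and A B :: "('a, 'b, (1, 'b) pser) presheaf" and M T :: "('a, 'b, 'b) presheaf"
  assumes presheaf_A: "group_presheaf p A" and presheaf_M: "group_presheaf p M"
    and hom: "\<And>S. is_fp_scheme p S \<Longrightarrow> group_hom (ob A S) (ob M S) (\<lambda>f. coef f (i + 1))"
    and ker: "\<And>S. is_fp_scheme p S \<Longrightarrow> carrier (ob B S) = kernel (ob A S) (ob M S) (\<lambda>f. coef f (i + 1))"
    and ob_B: "\<And>S. ob B S = (ob A S)\<lparr>carrier := carrier (ob B S)\<rparr>"
    and res_B: "res B = res A"
    and nat: "\<And>S' S g f. is_fp_scheme p S' \<Longrightarrow> is_fp_scheme p S \<Longrightarrow> is_fp_mor p S' S g \<Longrightarrow>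
      f \<in> carrier (ob A S) \<Longrightarrow> coef (res A S' S g f) (i + 1) = res M S' S g (coef f (i + 1))"
    and ob_T: "\<And>S. is_fp_scheme p S \<Longrightarrow>
      ob T S = (ob M S)\<lparr>carrier := (\<lambda>f. coef f (i + 1)) ` carrier (ob A S)\<rparr>"
    and res_T: "res T = res M"
begin

abbreviation c :: "(1, 'b) pser \<Rightarrow> 'b" where "c \<equiv> \<lambda>f. coef f (i + 1)"

lemma res_A_hom:
  "is_fp_scheme p S' \<Longrightarrow> is_fp_scheme p S \<Longrightarrow> is_fp_mor p S' S g \<Longrightarrow> res A S' S g \<in> hom (ob A S) (ob A S')"
  and res_M_hom:
  "is_fp_scheme p S' \<Longrightarrow> is_fp_scheme p S \<Longrightarrow> is_fp_mor p S' S g \<Longrightarrow> res M S' S g \<in> hom (ob M S) (ob M S')"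
  and group_A: "is_fp_scheme p S \<Longrightarrow> group (ob A S)"
  and group_M: "is_fp_scheme p S \<Longrightarrow> group (ob M S)"
  using presheaf_A presheaf_M by (auto simp: group_presheaf_def)

lemma normal_B: "is_fp_scheme p S \<Longrightarrow> carrier (ob B S) \<lhd> ob A S"
  using group_hom.normal_kernel[OF hom] ker by simp

lemma res_B_mem:
  assumes "is_fp_scheme p S'" "is_fp_scheme p S" "is_fp_mor p S' S g" "f \<in> carrier (ob B S)"
  shows "res A S' S g f \<in> carrier (ob B S')"
proof -
  have f: "f \<in> carrier (ob A S)" "c f = \<one>\<^bsub>ob M S\<^esub>"
    using assms ker by (auto simp: kernel_def)
  have "res A S' S g f \<in> carrier (ob A S')"
    using res_A_hom[OF assms(1-3)] f by (auto simp: hom_def)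
  moreover have "c (res A S' S g f) = \<one>\<^bsub>ob M S'\<^esub>"
    using nat[OF assms(1-3) f(1)] f(2) hom_one[OF res_M_hom[OF assms(1-3)]] group_M assms by simp
  ultimately show ?thesis
    using ker assms by (auto simp: kernel_def)
qed

lemma presheaf_B: "group_presheaf p B"
  unfolding group_presheaf_def
proof (intro conjI allI impI)
  fix S :: "('a, 'b) fp_scheme" assume S: "is_fp_scheme p S"
  show "group (ob B S)"
    using group.subgroup_imp_group[OF group_A[OF S] normal_imp_subgroup[OF normal_B[OF S]]] ob_B[of S] by simp
next
  fix S' S :: "('a, 'b) fp_scheme" and g assume *: "is_fp_scheme p S' \<and> is_fp_scheme p S \<and> is_fp_mor p S' S g"
  have "f \<in> carrier (ob B S) \<Longrightarrow> f \<in> carrier (ob A S)" for f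
    using ker * by (auto simp: kernel_def)
  then show "res B S' S g \<in> hom (ob B S) (ob B S')"
    unfolding res_B using res_A_hom[of S' S g] res_B_mem[of S' S g] *
    by (subst ob_B[of S], subst ob_B[of S']) (auto simp: hom_def)
next
  fix S :: "('a, 'b) fp_scheme" and x assume *: "is_fp_scheme p S \<and> x \<in> carrier (ob B S)"
  then show "res B S S rmor_id x = x"
    using presheaf_A ker unfolding res_B by (auto simp: group_presheaf_def kernel_def)
next
  fix S'' S' S :: "('a, 'b) fp_scheme" and g' g x
  assume *: "is_fp_scheme p S'' \<and> is_fp_scheme p S' \<and> is_fp_scheme p S \<and>
    is_fp_mor p S'' S' g' \<and> is_fp_mor p S' S g \<and> x \<in> carrier (ob B S)"
  then have "x \<in> carrier (ob A S)"
    using ker by (auto simp: kernel_def)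
  with * show "res B S'' S (rmor_comp (total S') g g') x = res B S'' S' g' (res B S' S g x)"
    using presheaf_A unfolding res_B group_presheaf_def by blast
qed

lemma normal_subpresheaf: "normal_subpresheaf p B A"
  unfolding normal_subpresheaf_def
  using presheaf_A presheaf_B normal_B ob_B res_B by auto

lemma presheaf_T: "group_presheaf p T"
  unfolding group_presheaf_def
proof (intro conjI allI impI)
  fix S :: "('a, 'b) fp_scheme" assume S: "is_fp_scheme p S"
  show "group (ob T S)"
    unfolding ob_T[OF S]
    by (intro group.subgroup_imp_group group_M S group_hom.img_is_subgroup hom)
next
  fix S' S :: "('a, 'b) fp_scheme" and g assume *: "is_fp_scheme p S' \<and> is_fp_scheme p S \<and> is_fp_mor p S' S g"
  then have S: "is_fp_scheme p S" "is_fp_scheme p S'" and g: "is_fp_mor p S' S g" by auto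
  have cM: "c f \<in> carrier (ob M S)" if "f \<in> carrier (ob A S)" for f
    using group_hom.hom_closed[OF hom[OF S(1)]] that by simp
  have "res M S' S g (c f) \<in> c ` carrier (ob A S')" if "f \<in> carrier (ob A S)" for f
    using nat[OF S(2,1) g that] res_A_hom[OF S(2,1) g] that
    by (intro image_eqI[of _ _ "res A S' S g f"]) (auto simp: hom_def)
  then show "res T S' S g \<in> hom (ob T S) (ob T S')"
    unfolding ob_T[OF S(1)] ob_T[OF S(2)] res_T using res_M_hom[OF S(2,1) g] cM
    by (auto simp: hom_def)
next
  fix S :: "('a, 'b) fp_scheme" and x assume *: "is_fp_scheme p S \<and> x \<in> carrier (ob T S)"
  then have "x \<in> carrier (ob M S)"
    using group_hom.hom_closed[OF hom[of S]] by (auto simp: ob_T)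
  with * show "res T S S rmor_id x = x"
    using presheaf_M unfolding res_T by (auto simp: group_presheaf_def)
next
  fix S'' S' S :: "('a, 'b) fp_scheme" and g' g x
  assume *: "is_fp_scheme p S'' \<and> is_fp_scheme p S' \<and> is_fp_scheme p S \<and>
    is_fp_mor p S'' S' g' \<and> is_fp_mor p S' S g \<and> x \<in> carrier (ob T S)"
  then have "x \<in> carrier (ob M S)"
    using group_hom.hom_closed[OF hom[of S]] by (auto simp: ob_T)
  with * show "res T S'' S (rmor_comp (total S') g g') x = res T S'' S' g' (res T S' S g x)"
    using presheaf_M unfolding res_T group_presheaf_def by blast
qed

text \<open>The hypotheses concern the restriction map alone and not a morphism of schemes, so that
  the lemma applies to composites without first showing that these are morphisms.\<close>

lemma quotient_map_coset:
  assumes S: "is_fp_scheme p S'" "is_fp_scheme p S" and f: "f \<in> carrier (ob A S)"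
    and r: "res A S' S g \<in> hom (ob A S) (ob A S')"
    and rB: "\<And>n. n \<in> carrier (ob B S) \<Longrightarrow> res A S' S g n \<in> carrier (ob B S')"
  shows "res (quotient_presheaf A B) S' S g (carrier (ob B S) #>\<^bsub>ob A S\<^esub> f) =
    carrier (ob B S') #>\<^bsub>ob A S'\<^esub> res A S' S g f"
proof -
  interpret N: normal "carrier (ob B S)" "ob A S" by (rule normal_B[OF S(2)])
  interpret N': normal "carrier (ob B S')" "ob A S'" by (rule normal_B[OF S(1)])
  let ?r = "res A S' S g"
  have rf: "?r f \<in> carrier (ob A S')" using r f by (auto simp: hom_def)
  have img: "?r ` (carrier (ob B S) #>\<^bsub>ob A S\<^esub> f) = (\<lambda>n. ?r n \<otimes>\<^bsub>ob A S'\<^esub> ?r f) ` carrier (ob B S)"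
  proof -
    have "?r (n \<otimes>\<^bsub>ob A S\<^esub> f) = ?r n \<otimes>\<^bsub>ob A S'\<^esub> ?r f" if "n \<in> carrier (ob B S)" for n
      using hom_mult[OF r] f that by simp
    moreover have "carrier (ob B S) #>\<^bsub>ob A S\<^esub> f = (\<lambda>n. n \<otimes>\<^bsub>ob A S\<^esub> f) ` carrier (ob B S)"
      by (auto simp: r_coset_def)
    ultimately show ?thesis by (auto simp: image_image intro!: image_cong)
  qed
  have "carrier (ob B S') <#>\<^bsub>ob A S'\<^esub> (?r ` (carrier (ob B S) #>\<^bsub>ob A S\<^esub> f)) =
    carrier (ob B S') #>\<^bsub>ob A S'\<^esub> ?r f"
  proof (intro equalityI subsetI)
    fix y assume "y \<in> carrier (ob B S') <#>\<^bsub>ob A S'\<^esub> (?r ` (carrier (ob B S) #>\<^bsub>ob A S\<^esub> f))"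
    then obtain m n where "m \<in> carrier (ob B S')" "n \<in> carrier (ob B S)"
      "y = m \<otimes>\<^bsub>ob A S'\<^esub> (?r n \<otimes>\<^bsub>ob A S'\<^esub> ?r f)"
      unfolding img by (auto simp: set_mult_def)
    moreover from this have "?r n \<in> carrier (ob B S')"
      using rB by blast
    ultimately show "y \<in> carrier (ob B S') #>\<^bsub>ob A S'\<^esub> ?r f"
      using rf by (auto simp: r_coset_def N'.m_assoc intro!: bexI[of _ "m \<otimes>\<^bsub>ob A S'\<^esub> ?r n"])
  next
    fix y assume "y \<in> carrier (ob B S') #>\<^bsub>ob A S'\<^esub> ?r f"
    then obtain m where m: "m \<in> carrier (ob B S')" "y = m \<otimes>\<^bsub>ob A S'\<^esub> ?r f"
      by (auto simp: r_coset_def)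
    have "?r f \<in> ?r ` (carrier (ob B S) #>\<^bsub>ob A S\<^esub> f)"
      by (rule imageI[OF N.rcos_self[OF f normal_imp_subgroup[OF normal_B[OF S(2)]]]])
    with m show "y \<in> carrier (ob B S') <#>\<^bsub>ob A S'\<^esub> (?r ` (carrier (ob B S) #>\<^bsub>ob A S\<^esub> f))"
      unfolding set_mult_def by blast
  qed
  then show ?thesis by (simp add: quotient_presheaf_def)
qed

lemma res_quotient:
  assumes S: "is_fp_scheme p S'" "is_fp_scheme p S" "is_fp_mor p S' S g" and f: "f \<in> carrier (ob A S)"
  shows "res (quotient_presheaf A B) S' S g (carrier (ob B S) #>\<^bsub>ob A S\<^esub> f) =
    carrier (ob B S') #>\<^bsub>ob A S'\<^esub> res A S' S g f"
  by (rule quotient_map_coset[OF S(1,2) f res_A_hom[OF S] res_B_mem[OF S]])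

lemma carrier_quotient:
  "carrier (ob (quotient_presheaf A B) S) = (\<lambda>f. carrier (ob B S) #>\<^bsub>ob A S\<^esub> f) ` carrier (ob A S)"
  by (simp add: quotient_presheaf_def carrier_FactGroup)

lemma presheaf_quotient: "group_presheaf p (quotient_presheaf A B)"
  unfolding group_presheaf_def
proof (intro conjI allI impI)
  fix S :: "('a, 'b) fp_scheme" assume S: "is_fp_scheme p S"
  show "group (ob (quotient_presheaf A B) S)"
    using normal.factorgroup_is_group[OF normal_B[OF S]] by (simp add: quotient_presheaf_def)
next
  fix S' S :: "('a, 'b) fp_scheme" and g assume *: "is_fp_scheme p S' \<and> is_fp_scheme p S \<and> is_fp_mor p S' S g"
  then have S: "is_fp_scheme p S'" "is_fp_scheme p S" "is_fp_mor p S' S g" by auto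
  interpret N: normal "carrier (ob B S)" "ob A S" by (rule normal_B[OF S(2)])
  interpret N': normal "carrier (ob B S')" "ob A S'" by (rule normal_B[OF S(1)])
  note r = res_A_hom[OF S]
  have mult: "X \<otimes>\<^bsub>ob (quotient_presheaf A B) S\<^esub> Y = X <#>\<^bsub>ob A S\<^esub> Y" for X Y and S :: "('a, 'b) fp_scheme"
    by (simp add: quotient_presheaf_def)
  show "res (quotient_presheaf A B) S' S g \<in> hom (ob (quotient_presheaf A B) S) (ob (quotient_presheaf A B) S')"
  proof (rule homI)
    fix X assume "X \<in> carrier (ob (quotient_presheaf A B) S)"
    then show "res (quotient_presheaf A B) S' S g X \<in> carrier (ob (quotient_presheaf A B) S')"
      using r by (auto simp: carrier_quotient res_quotient[OF S] hom_def)
  next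
    fix X Y assume "X \<in> carrier (ob (quotient_presheaf A B) S)" "Y \<in> carrier (ob (quotient_presheaf A B) S)"
    then obtain f k where fk: "X = carrier (ob B S) #>\<^bsub>ob A S\<^esub> f" "Y = carrier (ob B S) #>\<^bsub>ob A S\<^esub> k"
      "f \<in> carrier (ob A S)" "k \<in> carrier (ob A S)"
      by (auto simp: carrier_quotient)
    have rfk: "res A S' S g f \<in> carrier (ob A S')" "res A S' S g k \<in> carrier (ob A S')"
      using r fk by (auto simp: hom_def)
    have fk_closed: "f \<otimes>\<^bsub>ob A S\<^esub> k \<in> carrier (ob A S)"
      using fk by simp
    have sum: "X <#>\<^bsub>ob A S\<^esub> Y = carrier (ob B S) #>\<^bsub>ob A S\<^esub> (f \<otimes>\<^bsub>ob A S\<^esub> k)"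
      unfolding fk(1,2) by (rule N.rcos_sum[OF fk(3,4)])
    show "res (quotient_presheaf A B) S' S g (X \<otimes>\<^bsub>ob (quotient_presheaf A B) S\<^esub> Y) =
      res (quotient_presheaf A B) S' S g X \<otimes>\<^bsub>ob (quotient_presheaf A B) S'\<^esub> res (quotient_presheaf A B) S' S g Y"
      unfolding mult sum unfolding fk(1,2) res_quotient[OF S fk(3)] res_quotient[OF S fk(4)]
        res_quotient[OF S fk_closed] hom_mult[OF r fk(3,4)]
      by (rule N'.rcos_sum[OF rfk, symmetric])
  qed
next
  fix S :: "('a, 'b) fp_scheme" and X assume "is_fp_scheme p S \<and> X \<in> carrier (ob (quotient_presheaf A B) S)"
  then have S: "is_fp_scheme p S" and "X \<in> carrier (ob (quotient_presheaf A B) S)" by auto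
  then obtain f where f: "X = carrier (ob B S) #>\<^bsub>ob A S\<^esub> f" "f \<in> carrier (ob A S)"
    by (auto simp: carrier_quotient)
  then have "res A S S rmor_id ` X = X"
  proof -
    interpret N: normal "carrier (ob B S)" "ob A S" by (rule normal_B[OF S])
    have "x \<in> carrier (ob A S)" if "x \<in> X" for x
      using that f N.r_coset_subset_G N.subset by blast
    then have "res A S S rmor_id x = x" if "x \<in> X" for x
      using that presheaf_A S by (auto simp: group_presheaf_def)
    then show ?thesis by simp
  qed
  moreover have "carrier (ob B S) <#>\<^bsub>ob A S\<^esub> X = X"
  proof -
    interpret N: normal "carrier (ob B S)" "ob A S" by (rule normal_B[OF S])
    show ?thesis
      using f N.rcosets_mult_eq[of X] by (auto simp: RCOSETS_def)
  qed
  ultimately show "res (quotient_presheaf A B) S S rmor_id X = X"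
    by (simp add: quotient_presheaf_def)
next
  fix S'' S' S :: "('a, 'b) fp_scheme" and g' g X
  assume *: "is_fp_scheme p S'' \<and> is_fp_scheme p S' \<and> is_fp_scheme p S \<and>
    is_fp_mor p S'' S' g' \<and> is_fp_mor p S' S g \<and> X \<in> carrier (ob (quotient_presheaf A B) S)"
  then have S: "is_fp_scheme p S''" "is_fp_scheme p S'" "is_fp_scheme p S"
    and g': "is_fp_mor p S'' S' g'" and g: "is_fp_mor p S' S g" by auto
  obtain f where f: "X = carrier (ob B S) #>\<^bsub>ob A S\<^esub> f" "f \<in> carrier (ob A S)"
    using * by (auto simp: carrier_quotient)
  have comp: "res A S'' S (rmor_comp (total S') g g') x = res A S'' S' g' (res A S' S g x)"
    if "x \<in> carrier (ob A S)" for x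
    using presheaf_A that S g g' unfolding group_presheaf_def by blast
  note r = res_A_hom[OF S(2,3) g] and r' = res_A_hom[OF S(1,2) g']
  have rf: "res A S' S g x \<in> carrier (ob A S')" if "x \<in> carrier (ob A S)" for x
    using r that by (auto simp: hom_def)
  interpret A: group "ob A S" by (rule group_A[OF S(3)])
  have "res A S'' S (rmor_comp (total S') g g') \<in> hom (ob A S) (ob A S'')"
  proof (rule homI)
    fix x y assume xy: "x \<in> carrier (ob A S)" "y \<in> carrier (ob A S)"
    then show "res A S'' S (rmor_comp (total S') g g') (x \<otimes>\<^bsub>ob A S\<^esub> y) =
      res A S'' S (rmor_comp (total S') g g') x \<otimes>\<^bsub>ob A S''\<^esub> res A S'' S (rmor_comp (total S') g g') y"
      using hom_mult[OF r xy] hom_mult[OF r' rf[OF xy(1)] rf[OF xy(2)]] by (simp add: comp)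
  next
    fix x assume x: "x \<in> carrier (ob A S)"
    then show "res A S'' S (rmor_comp (total S') g g') x \<in> carrier (ob A S'')"
      using r' rf[OF x] by (auto simp: comp hom_def)
  qed
  moreover have "res A S'' S (rmor_comp (total S') g g') n \<in> carrier (ob B S'')" if "n \<in> carrier (ob B S)" for n
  proof -
    have "n \<in> carrier (ob A S)"
      using that ker[OF S(3)] by (auto simp: kernel_def)
    then show ?thesis
      using that res_B_mem[OF S(2,3) g] res_B_mem[OF S(1,2) g'] by (simp add: comp)
  qed
  ultimately have "res (quotient_presheaf A B) S'' S (rmor_comp (total S') g g') X =
    carrier (ob B S'') #>\<^bsub>ob A S''\<^esub> res A S'' S' g' (res A S' S g f)"
    unfolding f(1) comp[OF f(2), symmetric] by (intro quotient_map_coset S f(2)) auto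
  then show "res (quotient_presheaf A B) S'' S (rmor_comp (total S') g g') X =
    res (quotient_presheaf A B) S'' S' g' (res (quotient_presheaf A B) S' S g X)"
    using f rf by (simp add: res_quotient[OF S(2,3) g] res_quotient[OF S(1,2) g'])
qed

theorem coef_identification: "coef_identification p i A B T"
  unfolding coef_identification_def
proof (intro conjI exI allI impI)
  show "normal_subpresheaf p B A" by (rule normal_subpresheaf)
  \<comment> \<open>The coefficient is constant on each coset of the kernel, so the image of a coset
    is a singleton.\<close>
  define \<alpha> where "\<alpha> = (\<lambda>S :: ('a, 'b) fp_scheme. \<lambda>X. the_elem (c ` X))"
  have coset: "\<alpha> S (carrier (ob B S) #>\<^bsub>ob A S\<^esub> f) = c f"
    if S: "is_fp_scheme p S" and f: "f \<in> carrier (ob A S)" for S f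
  proof -
    interpret h: group_hom "ob A S" "ob M S" c by (rule hom[OF S])
    have "c ` (carrier (ob B S) #>\<^bsub>ob A S\<^esub> f) = {c f}"
    proof (intro equalityI subsetI)
      fix y assume "y \<in> c ` (carrier (ob B S) #>\<^bsub>ob A S\<^esub> f)"
      then obtain n where "n \<in> carrier (ob B S)" "y = c (n \<otimes>\<^bsub>ob A S\<^esub> f)"
        by (auto simp: r_coset_def)
      then have "y = c n \<otimes>\<^bsub>ob M S\<^esub> c f" "c n = \<one>\<^bsub>ob M S\<^esub>"
        using h.hom_mult[of n f] f by (auto simp: ker[OF S] kernel_def)
      then show "y \<in> {c f}"
        using h.hom_closed[OF f] by simp
    next
      fix y assume "y \<in> {c f}"
      moreover have "f \<in> carrier (ob B S) #>\<^bsub>ob A S\<^esub> f"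
        using h.G.rcos_self[OF f normal_imp_subgroup[OF normal_B[OF S]]] .
      ultimately show "y \<in> c ` (carrier (ob B S) #>\<^bsub>ob A S\<^esub> f)" by blast
    qed
    then show ?thesis by (simp add: \<alpha>_def)
  qed
  show "presheaf_iso p (quotient_presheaf A B) T \<alpha>"
    unfolding presheaf_iso_def
  proof (intro conjI allI impI)
    show "group_presheaf p (quotient_presheaf A B)" by (rule presheaf_quotient)
    show "group_presheaf p T" by (rule presheaf_T)
  next
    fix S :: "('a, 'b) fp_scheme" assume S: "is_fp_scheme p S"
    interpret h: group_hom "ob A S" "ob M S" c by (rule hom[OF S])
    have T: "group (ob T S)" using presheaf_T S by (auto simp: group_presheaf_def)
    \<comment> \<open>With its image as codomain the coefficient map has the same kernel and is
      surjective, so the first isomorphism theorem applies.\<close>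
    have "c \<in> Group.hom (ob A S) (ob T S)"
      using h.homh by (auto simp: ob_T[OF S] hom_def)
    then interpret t: group_hom "ob A S" "ob T S" c
      using T h.G.group_axioms by (simp add: group_hom_def group_hom_axioms_def)
    have "kernel (ob A S) (ob T S) c = carrier (ob B S)"
      by (simp add: kernel_def ker[OF S] ob_T[OF S])
    then show "\<alpha> S \<in> iso (ob (quotient_presheaf A B) S) (ob T S)"
      using t.FactGroup_iso_set by (simp add: \<alpha>_def quotient_presheaf_def ob_T[OF S])
  next
    fix S' S :: "('a, 'b) fp_scheme" and g X
    assume *: "is_fp_scheme p S' \<and> is_fp_scheme p S \<and> is_fp_mor p S' S g \<and>
      X \<in> carrier (ob (quotient_presheaf A B) S)"
    then have S: "is_fp_scheme p S'" "is_fp_scheme p S" "is_fp_mor p S' S g" by auto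
    obtain f where f: "X = carrier (ob B S) #>\<^bsub>ob A S\<^esub> f" "f \<in> carrier (ob A S)"
      using * by (auto simp: carrier_quotient)
    have "res A S' S g f \<in> carrier (ob A S')"
      using res_A_hom[OF S] f by (auto simp: hom_def)
    then show "\<alpha> S' (res (quotient_presheaf A B) S' S g X) = res T S' S g (\<alpha> S X)"
      using f S nat[OF S f(2)] by (simp add: res_quotient[OF S] coset res_T)
  qed
  show "\<alpha> S (carrier (ob B S) #>\<^bsub>ob A S\<^esub> f) = coef f (i + 1)"
    if "is_fp_scheme p S \<and> f \<in> carrier (ob A S)" for S f
    using coset that by blast
qed

end

section \<open>The filtration presheaves\<close>

definition A_gen :: "nat \<Rightarrow> (2, int) pser \<Rightarrow> enat \<Rightarrow> nat \<Rightarrow> ('a, 'b, (1, 'b) pser) presheaf" where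
  "A_gen p H N i =
    \<lparr>ob = (\<lambda>S. let G = gAut (Gam S) N (base_change p (gtrunc (prime_field p) N H) S)
       in G\<lparr>carrier := carrier G \<inter> filt_step (Gam S) i\<rparr>),
     res = (\<lambda>S' S g f \<beta>. Gam_map S g (f \<beta>))\<rparr>"

lemma A_full_eq: "A_full p H i = A_gen p H \<infinity> i"
  by (simp add: A_full_def A_gen_def gAut_infinity)

lemma A_bud_eq: "A_bud p H n i = A_gen p H (enat n) i"
  by (simp add: A_bud_def A_gen_def gAut_enat gtrunc_enat)

lemma res_A_gen [simp]: "res (A_gen p H N i) S' S g f = (\<lambda>\<beta>. Gam_map S g (f \<beta>))"
  by (simp add: A_gen_def)

section \<open>The additive and multiplicative group presheaves\<close>

lemma group_presheaf_Ga: "group_presheaf p Ga"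
  unfolding group_presheaf_def
proof (intro conjI allI impI)
  fix S :: "('a, 'b) fp_scheme" assume "is_fp_scheme p S"
  then interpret cring "Gam S" by (rule cring_Gam)
  show "group (ob Ga S)"
    using group_step_base[of 1] by (simp add: Ga_def step_base_def)
next
  fix S' S :: "('a, 'b) fp_scheme" and g assume "is_fp_scheme p S' \<and> is_fp_scheme p S \<and> is_fp_mor p S' S g"
  then have "Gam_map S g \<in> ring_hom (Gam S) (Gam S')"
    using Gam_map_hom by blast
  then show "res Ga S' S g \<in> hom (ob Ga S) (ob Ga S')"
    by (auto simp: Ga_def hom_def ring_hom_def)
qed (auto simp: Ga_def Gam_map_id Gam_map_comp)

lemma ring_hom_Units:
  assumes "f \<in> ring_hom R S" "a \<in> Units R"
  shows "f a \<in> Units S"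
proof -
  obtain b where b: "b \<in> carrier R" "a \<in> carrier R" "b \<otimes>\<^bsub>R\<^esub> a = \<one>\<^bsub>R\<^esub>" "a \<otimes>\<^bsub>R\<^esub> b = \<one>\<^bsub>R\<^esub>"
    using assms(2) by (auto simp: Units_def)
  then have "f b \<otimes>\<^bsub>S\<^esub> f a = \<one>\<^bsub>S\<^esub>" "f a \<otimes>\<^bsub>S\<^esub> f b = \<one>\<^bsub>S\<^esub>"
    using ring_hom_mult[OF assms(1), of b a] ring_hom_mult[OF assms(1), of a b] ring_hom_one[OF assms(1)] by auto
  then show ?thesis
    using b ring_hom_closed[OF assms(1)] by (auto simp: Units_def)
qed

lemma group_presheaf_Gm: "group_presheaf p Gm"
  unfolding group_presheaf_def
proof (intro conjI allI impI)
  fix S :: "('a, 'b) fp_scheme" assume "is_fp_scheme p S"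
  then interpret cring "Gam S" by (rule cring_Gam)
  show "group (ob Gm S)"
    by (simp add: Gm_def units_group)
next
  fix S' S :: "('a, 'b) fp_scheme" and g assume "is_fp_scheme p S' \<and> is_fp_scheme p S \<and> is_fp_mor p S' S g"
  then have r: "Gam_map S g \<in> ring_hom (Gam S) (Gam S')"
    using Gam_map_hom by blast
  have "a \<in> carrier (Gam S)" if "a \<in> Units (Gam S)" for a
    using that by (simp add: Units_def)
  then show "res Gm S' S g \<in> hom (ob Gm S) (ob Gm S')"
    by (auto simp: Gm_def hom_def units_of_def ring_hom_Units[OF r] ring_hom_mult[OF r])
qed (auto simp: Gm_def Gam_map_id Gam_map_comp)

text \<open>The bound on p^h makes the equation for the linear coefficient available, hence the
  roots of unity at i = 0. For buds it follows from h <= l.\<close>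

locale fgl_prime_field =
  fixes p h :: nat and H :: "(2, int) pser" and N :: enat
  assumes prime_p: "prime p" and h_ge_1: "h \<ge> 1"
    and law: "formal_group_law (prime_field p) H"
    and mult_p: "fgl_mult (prime_field p) H p = var (prime_field p) 0 [^]\<^bsub>PS (prime_field p)\<^esub> (p ^ h)"
    and q_le_N: "enat (p ^ h) \<le> N"
begin

lemma fgl_map_Gam:
  assumes "is_fp_scheme p S" "cring_map (Gam S) \<phi>"
  shows "fgl_map (Gam S) \<phi> p h H N"
proof -
  show ?thesis
  proof (rule fgl_map.intro, rule assms(2), rule fgl_map_axioms.intro)
    show "fgl_modulus {c :: int. int p dvd c} p (Mps H) h"
      by (rule fgl_modulus_prime_field[OF prime_p h_ge_1 law mult_p])
    show "\<phi> (of_nat p) = \<zero>\<^bsub>Gam S\<^esub>"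
      by (rule scalar_eq_map(1)[OF prime_p assms])
    have "1 \<le> p ^ h"
      using prime_gt_0_nat[OF prime_p] by (simp add: Suc_le_eq)
    then show "1 \<le> N"
      using q_le_N by (metis enat_ord_simps(1) one_enat_def order_trans)
  qed
qed

lemma fgl_cover_Gam:
  assumes "is_fp_scheme p S"
  shows "fgl_cover (Gam S) (cring.ev (Gam S)) p h H N"
proof -
  have c: "cring_cover (Gam S) (cring.ev (Gam S))"
    by (rule cring.cring_cover_ev[OF cring_Gam[OF assms]])
  then have "cring_map (Gam S) (cring.ev (Gam S))"
    by (rule cring_cover.axioms)
  from fgl_map_Gam[OF assms this] c show ?thesis
    by (rule fgl_cover.intro)
qed

lemma ob_A_gen:
  assumes "is_fp_scheme p S" "cring_map (Gam S) \<phi>"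
  shows "ob (A_gen p H N i) S =
    (let G = gAut (Gam S) N (gtrunc (Gam S) N (cring_map.Phi \<phi> (mps_of_int (Mps H))))
     in G\<lparr>carrier := carrier G \<inter> filt_step (Gam S) i\<rparr>)"
proof -
  have "H \<in> carrier (PS (prime_field p))"
    using law by (simp add: formal_group_law_def)
  from base_change_eq[OF prime_p assms this] show ?thesis
    by (simp add: A_gen_def)
qed

text \<open>Following the cover of the source ring by the restriction gives a
  \<open>cring_map\<close> with a larger kernel, which need not be surjective. Lifts of
  automorphisms over the source are therefore lifts over the target as well.\<close>

lemma res_A_gen_hom:
  assumes S: "is_fp_scheme p S'" "is_fp_scheme p S" and g: "is_fp_mor p S' S g"
  shows "res (A_gen p H N i) S' S g \<in> hom (ob (A_gen p H N i) S) (ob (A_gen p H N i) S')"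
proof -
  define \<rho> where "\<rho> = Gam_map S g"
  define \<phi> where "\<phi> = cring.ev (Gam S)"
  have \<rho>: "\<rho> \<in> ring_hom (Gam S) (Gam S')"
    unfolding \<rho>_def by (rule Gam_map_hom[OF g])
  interpret C: fgl_cover "Gam S" \<phi> p h H N
    unfolding \<phi>_def by (rule fgl_cover_Gam[OF S(2)])
  interpret R': cring "Gam S'" by (rule cring_Gam[OF S(1)])
  have D: "cring_map (Gam S') (\<lambda>a. \<rho> (\<phi> a))"
    using \<rho> by unfold_locales
      (auto simp: ring_hom_closed ring_hom_add ring_hom_mult ring_hom_one C.map_add C.map_mult)
  interpret D: fgl_map "Gam S'" "\<lambda>a. \<rho> (\<phi> a)" p h H N
    by (rule fgl_map_Gam[OF S(1) D])
  have zero: "\<rho> \<zero>\<^bsub>Gam S\<^esub> = \<zero>\<^bsub>Gam S'\<^esub>"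
    by (rule ring_hom_zero[OF \<rho> C.ring_axioms R'.ring_axioms])
  have K: "(\<lambda>\<beta>. \<rho> (C.K s \<beta>)) = D.K s" for s :: "(1, 'b multiset \<Rightarrow>\<^sub>0 int) mps"
    by (auto simp: gtrunc_def C.Phi_def D.Phi_def zero)
  have "C.ker \<subseteq> D.ker"
    by (auto simp: C.ker_def D.ker_def zero)
  then have "C.J m \<subseteq> D.J m" for m
    by (auto simp: C.J_def D.J_def)
  then have autos: "s \<in> D.autos" if "s \<in> C.autos" for s
    using that \<open>C.ker \<subseteq> D.ker\<close> unfolding C.autos_def D.autos_def by blast
  have filt: "(\<lambda>\<beta>. \<rho> (f \<beta>)) \<in> filt_step (Gam S') i" if "f \<in> filt_step (Gam S) i" for f
    using that zero ring_hom_one[OF \<rho>] by (auto simp: filt_step_def)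
  have mem: "(\<lambda>\<beta>. \<rho> (f \<beta>)) \<in> carrier D.G" if "f \<in> carrier C.G" for f
    using that K D.K_autos autos by (auto simp: C.carrier_G)
  have mult: "(\<lambda>\<beta>. \<rho> ((f \<otimes>\<^bsub>C.G\<^esub> k) \<beta>)) = (\<lambda>\<beta>. \<rho> (f \<beta>)) \<otimes>\<^bsub>D.G\<^esub> (\<lambda>\<beta>. \<rho> (k \<beta>))"
    if fk: "f \<in> carrier C.G" "k \<in> carrier C.G" for f k
  proof -
    obtain s t where st: "f = C.K s" "k = C.K t" "s \<in> C.autos" "t \<in> C.autos"
      using fk by (auto simp: C.carrier_G)
    then have "no_const t" by (simp add: C.no_const_autos)
    show ?thesis
      unfolding st C.mult_G[OF \<open>no_const t\<close>] K D.mult_G[OF \<open>no_const t\<close>] ..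
  qed
  show ?thesis
    unfolding ob_A_gen[OF S(1) D] ob_A_gen[OF S(2) C.cring_map_axioms] Let_def
    using mem filt mult by (auto simp: hom_def simp flip: \<rho>_def)
qed

lemma group_presheaf_A_gen:
  assumes "enat i \<le> N"
  shows "group_presheaf p (A_gen p H N i)"
  unfolding group_presheaf_def
proof (intro conjI allI impI)
  fix S :: "('a, 'b) fp_scheme" assume S: "is_fp_scheme p S"
  interpret C: fgl_cover "Gam S" "cring.ev (Gam S)" p h H N
    by (rule fgl_cover_Gam[OF S])
  show "group (ob (A_gen p H N i) S)"
    unfolding ob_A_gen[OF S C.cring_map_axioms] Let_def
    by (rule group.subgroup_imp_group[OF C.group_G C.subgroup_filt[OF assms]])
next
  fix S' S :: "('a, 'b) fp_scheme" and g assume "is_fp_scheme p S' \<and> is_fp_scheme p S \<and> is_fp_mor p S' S g"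
  then show "res (A_gen p H N i) S' S g \<in> hom (ob (A_gen p H N i) S) (ob (A_gen p H N i) S')"
    using res_A_gen_hom by blast
qed (auto simp: Gam_map_id Gam_map_comp)

theorem coef_identification_A_gen:
  fixes T :: "('a, 'b, 'b) presheaf"
  assumes i: "enat (Suc i) \<le> N"
    and T: "\<And>S. ob T S = (step_base (Gam S) i)\<lparr>carrier := step_image (Gam S) p (p ^ h) N i\<rparr>"
    and res_T: "res T = (\<lambda>S' S g. Gam_map S g)"
  shows "coef_identification p i (A_gen p H N i) (A_gen p H N (i + 1)) T"
proof -
  define M :: "('a, 'b, 'b) presheaf" where "M = (if i = 0 then Gm else Ga)"
  have ob_M: "ob M S = step_base (Gam S) i" for S
    by (simp add: M_def step_base_def Gm_def Ga_def)
  have res_M: "res M = (\<lambda>S' S g. Gam_map S g)"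
    by (simp add: M_def Gm_def Ga_def)
  have i': "enat i \<le> N"
    using i by (meson enat_ord_simps(1) order_trans le_SucI order_refl)
  have "coef_steps p i (A_gen p H N i) (A_gen p H N (i + 1)) M T"
  proof (rule coef_steps.intro)
    show "group_presheaf p (A_gen p H N i)"
      by (rule group_presheaf_A_gen[OF i'])
    show "group_presheaf p M"
      by (simp add: M_def group_presheaf_Gm group_presheaf_Ga)
    show "res T = res M"
      by (simp add: res_T res_M)
    fix S :: "('a, 'b) fp_scheme"
    show "ob (A_gen p H N (i + 1)) S = (ob (A_gen p H N i) S)\<lparr>carrier := carrier (ob (A_gen p H N (i + 1)) S)\<rparr>"
      by (simp add: A_gen_def Let_def)
    assume S: "is_fp_scheme p S"
    interpret C: fgl_cover "Gam S" "cring.ev (Gam S)" p h H N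
      by (rule fgl_cover_Gam[OF S])
    note ob = ob_A_gen[OF S C.cring_map_axioms, unfolded Let_def]
    show "group_hom (ob (A_gen p H N i) S) (ob M S) (\<lambda>f. coef f (i + 1))"
      unfolding ob ob_M using C.group_hom_step[OF i] by simp
    show "carrier (ob (A_gen p H N (i + 1)) S) = kernel (ob (A_gen p H N i) S) (ob M S) (\<lambda>f. coef f (i + 1))"
      unfolding ob ob_M using C.kernel_step[of i] by simp
    show "ob T S = (ob M S)\<lparr>carrier := (\<lambda>f. coef f (i + 1)) ` carrier (ob (A_gen p H N i) S)\<rparr>"
      unfolding ob ob_M T using C.image_step[OF i q_le_N] by simp
  qed (simp_all add: A_gen_def res_M)
  then show ?thesis
    by (rule coef_steps.coef_identification)
qed

end

lemma ob_targets:
  "ob (mu m) S = (step_base (Gam S) 0)\<lparr>carrier := {a \<in> Units (Gam S). a [^]\<^bsub>Gam S\<^esub> m = \<one>\<^bsub>Gam S\<^esub>}\<rparr>"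
  "i \<noteq> 0 \<Longrightarrow> ob (Ga_Fr q) S = (step_base (Gam S) i)\<lparr>carrier := {a \<in> carrier (Gam S). a [^]\<^bsub>Gam S\<^esub> q = a}\<rparr>"
  "i \<noteq> 0 \<Longrightarrow> ob Ga S = (step_base (Gam S) i)\<lparr>carrier := carrier (Gam S)\<rparr>"
  "i \<noteq> 0 \<Longrightarrow> ob Ga_zero S = (step_base (Gam S) i)\<lparr>carrier := {\<zero>\<^bsub>Gam S\<^esub>}\<rparr>"
  by (simp_all add: mu_def Ga_Fr_def Ga_zero_def Gm_def Ga_def step_base_def)

lemma res_targets:
  "res (mu m) = (\<lambda>S' S g. Gam_map S g)" "res (Ga_Fr q) = (\<lambda>S' S g. Gam_map S g)"
  "res Ga = (\<lambda>S' S g. Gam_map S g)" "res Ga_zero = (\<lambda>S' S g. Gam_map S g)"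
  by (simp_all add: mu_def Ga_Fr_def Ga_zero_def Gm_def Ga_def)

theorem mainTheorem4:
  fixes p h n l :: nat and H :: "(2, int) pser"
  assumes "prime p" and "h \<ge> 1" and "n \<ge> 1"
    and "p ^ l \<le> n" and "n < p ^ (l + 1)" and "h \<le> l"
    and "formal_group_law (prime_field p) H"
    and "fgl_mult (prime_field p) H p = var (prime_field p) 0 [^]\<^bsub>PS (prime_field p)\<^esub> (p ^ h)"
  shows "(\<forall>i<n. coef_identification p i
            (A_bud p H n i :: ('a, 'b, (1, 'b) pser) presheaf) (A_bud p H n (i + 1))
            (if i = 0 then mu (p ^ h - 1)
             else if \<exists>k. 1 \<le> k \<and> k \<le> l - h \<and> i = p ^ k - 1 then Ga_Fr (p ^ h)
             else if \<exists>k. l - h + 1 \<le> k \<and> k \<le> l \<and> i = p ^ k - 1 then Ga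
             else Ga_zero)) \<and>
         (\<forall>i. coef_identification p i
            (A_full p H i :: ('a, 'b, (1, 'b) pser) presheaf) (A_full p H (i + 1))
            (if i = 0 then mu (p ^ h - 1)
             else if \<exists>k\<ge>1. i = p ^ k - 1 then Ga_Fr (p ^ h)
             else Ga_zero))"
proof (intro conjI allI impI)
  have p: "p > 1" using assms(1) prime_gt_1_nat by auto
  have Suc_pow: "i = p ^ k - 1 \<longleftrightarrow> Suc i = p ^ k" for i k
    using p by (metis Suc_pred' diff_Suc_1 gr0I less_zeroE power_eq_0_iff)
  fix i assume "i < n"
  have "p ^ h \<le> p ^ l"
    using p assms(6) by (simp add: power_increasing)
  then interpret fgl_prime_field p h H "enat n"
    by unfold_locales (use assms in auto)
  show "coef_identification p i
            (A_bud p H n i :: ('a, 'b, (1, 'b) pser) presheaf) (A_bud p H n (i + 1))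
            (if i = 0 then mu (p ^ h - 1)
             else if \<exists>k. 1 \<le> k \<and> k \<le> l - h \<and> i = p ^ k - 1 then Ga_Fr (p ^ h)
             else if \<exists>k. l - h + 1 \<le> k \<and> k \<le> l \<and> i = p ^ k - 1 then Ga
             else Ga_zero)" (is "coef_identification p i _ _ ?T")
    unfolding A_bud_eq
  proof (rule coef_identification_A_gen)
    show "enat (Suc i) \<le> enat n" using \<open>i < n\<close> by simp
    show "res ?T = (\<lambda>S' S g. Gam_map S g)"
      by (simp add: res_targets)
    fix S :: "('a, 'b) fp_scheme"
    \<comment> \<open>The exponent k is at most l because i < n < p^(l+1), and positive because i is
      not 0. Comparing k with l - h decides whether p^h (i + 1) = p^(h+k) is at most n.\<close>
    consider "i = 0" | k where "i \<noteq> 0" "1 \<le> k" "k \<le> l - h" "Suc i = p ^ k"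
      | k where "i \<noteq> 0" "l - h + 1 \<le> k" "k \<le> l" "Suc i = p ^ k" | "i \<noteq> 0" "\<forall>k. Suc i \<noteq> p ^ k"
    proof (cases "\<exists>k. Suc i = p ^ k")
      case True
      then obtain k where k: "Suc i = p ^ k" by blast
      have "p ^ k < p ^ (l + 1)"
        using k \<open>i < n\<close> assms(5) by linarith
      then have "k < l + 1"
        using p by (simp only: power_strict_increasing_iff)
      moreover have "i \<noteq> 0 \<Longrightarrow> 1 \<le> k"
        using k by (cases k) auto
      ultimately show ?thesis
        using k that(1) that(2)[of k] that(3)[of k] by (cases "k \<le> l - h") auto
    qed (use that in blast)
    then show "ob ?T S = (step_base (Gam S) i)\<lparr>carrier := step_image (Gam S) p (p ^ h) (enat n) i\<rparr>"
    proof cases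
      case 1
      then show ?thesis by (simp add: ob_targets step_image_def)
    next
      case (2 k)
      have "p ^ h * Suc i = p ^ (h + k)"
        using 2 by (simp add: power_add)
      also have "\<dots> \<le> p ^ l"
        using 2 p assms(6) by (intro power_increasing) auto
      finally have "p ^ h * Suc i \<le> n" using assms(4) by simp
      then have "step_image (Gam S) p (p ^ h) (enat n) i = {a \<in> carrier (Gam S). a [^]\<^bsub>Gam S\<^esub> (p ^ h) = a}"
        using 2 unfolding step_image_def by auto
      moreover have "?T = Ga_Fr (p ^ h)"
        using 2 unfolding Suc_pow by auto
      ultimately show ?thesis
        using 2 ob_targets(2)[of i "p ^ h" S] by simp
    next
      case (3 k)
      have "n < p ^ (l + 1)" by (rule assms(5))
      also have "\<dots> \<le> p ^ (h + k)"
        using 3 p by (intro power_increasing) auto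
      also have "\<dots> = p ^ h * Suc i"
        using 3 by (simp add: power_add)
      finally have "\<not> p ^ h * Suc i \<le> n" by simp
      then have "step_image (Gam S) p (p ^ h) (enat n) i = carrier (Gam S)"
        using 3 unfolding step_image_def by auto
      moreover have "\<not> (1 \<le> j \<and> j \<le> l - h \<and> Suc i = p ^ j)" for j
        using 3 p power_inject_exp[OF p, of k j] by auto
      then have "?T = Ga"
        using 3 unfolding Suc_pow by auto
      ultimately show ?thesis
        using 3 ob_targets(3)[of i S] by simp
    next
      case 4
      then have "step_image (Gam S) p (p ^ h) (enat n) i = {\<zero>\<^bsub>Gam S\<^esub>}"
        unfolding step_image_def by auto
      moreover have "?T = Ga_zero"
        using 4 unfolding Suc_pow by auto
      ultimately show ?thesis
        using 4 ob_targets(4)[of i S] by simp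
    qed
  qed
next
  have p: "p > 1" using assms(1) prime_gt_1_nat by auto
  have Suc_pow: "i = p ^ k - 1 \<longleftrightarrow> Suc i = p ^ k" for i k
    using p by (metis Suc_pred' diff_Suc_1 gr0I less_zeroE power_eq_0_iff)
  fix i
  interpret fgl_prime_field p h H "\<infinity>"
    by unfold_locales (use assms in auto)
  show "coef_identification p i
            (A_full p H i :: ('a, 'b, (1, 'b) pser) presheaf) (A_full p H (i + 1))
            (if i = 0 then mu (p ^ h - 1)
             else if \<exists>k\<ge>1. i = p ^ k - 1 then Ga_Fr (p ^ h)
             else Ga_zero)" (is "coef_identification p i _ _ ?T")
    unfolding A_full_eq
  proof (rule coef_identification_A_gen)
    show "enat (Suc i) \<le> \<infinity>" by simp
    show "res ?T = (\<lambda>S' S g. Gam_map S g)"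
      by (simp add: res_targets)
    fix S :: "('a, 'b) fp_scheme"
    show "ob ?T S = (step_base (Gam S) i)\<lparr>carrier := step_image (Gam S) p (p ^ h) \<infinity> i\<rparr>"
    proof (cases "i = 0")
      case False
      \<comment> \<open>The exponent 0 belongs to i = 0, which is excluded here.\<close>
      have "(\<exists>k\<ge>1. Suc i = p ^ k) \<longleftrightarrow> (\<exists>k. Suc i = p ^ k)"
        using False by (metis One_nat_def Suc_inject less_one not_le power_0)
      with False show ?thesis
        unfolding Suc_pow step_image_def
        using ob_targets(2)[of i "p ^ h" S] ob_targets(4)[of i S] by simp
    qed (simp add: ob_targets step_image_def)
  qed
qed

end
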